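(* Let $\alpha\ne0$ be a real number and let $\mathring{U}_{(\alpha)}(t)$, $0\le t\le1$, be the Ornstein--Uhlenbeck process starting at zero, i.e. the centered continuous Gaussian process with covariance $$G(t,s)=\frac{e^{-\alpha|t-s|}-e^{-\alpha(t+s)}}{2\alpha},\qquad s,t\in[0,1].$$ Let $\psi:[0,1]\to\mathbb{R}$ be positive and twice continuously differentiable on $[0,1]$, and let $\vartheta=\int_0^1\sqrt{\psi(t)}\,dt$. Then, as $\varepsilon\to0+$, $$ \mathsf{P}\{\|\mathring{U}_{(\alpha)}\|_\psi\leq\varepsilon\}\sim \frac{4e^{\alpha/2}\,\psi^{1/8}(0)}{\sqrt{\pi}\,\vartheta\,\psi^{1/8}(1)}\, \varepsilon\, \exp\left(-\frac{\vartheta^2}{8}\varepsilon^{-2}\right). $$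
   Context: For a process $X(t)$, $0\le t\le 1$, and a non-negative weight $\psi$ on $[0,1]$, $\|X\|_\psi=\left(\int_0^1X^2(t)\psi(t)\,dt\right)^{1/2}$. The notation $f(\varepsilon)\sim g(\varepsilon)$ means $f(\varepsilon)/g(\varepsilon)\to1$. $\psi^{a}(t)$ means $(\psi(t))^{a}$. *)

theory Defs
  imports "HOL-Probability.Probability" "HOL-Library.Landau_Symbols"
begin

text \<open>
  The normal law with mean \<open>\<mu>\<close> and standard deviation \<open>\<sigma>\<close>; the degenerate case \<open>\<sigma> = 0\<close>
  (point mass at \<open>\<mu>\<close>) is included, as is needed for linear combinations of the values of a
  Gaussian process.
\<close>

definition normal_law :: "real \<Rightarrow> real \<Rightarrow> real measure" where
  "normal_law \<mu> \<sigma> =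
     (if \<sigma> = 0 then return borel \<mu>
      else density lborel (\<lambda>x. ennreal (normal_density \<mu> \<sigma> x)))"

definition gaussian_rv :: "'a measure \<Rightarrow> ('a \<Rightarrow> real) \<Rightarrow> bool" where
  "gaussian_rv M Y \<longleftrightarrow>
     Y \<in> borel_measurable M \<and> (\<exists>\<mu> \<sigma>. 0 \<le> \<sigma> \<and> distr M borel Y = normal_law \<mu> \<sigma>)"

definition gaussian_process_on :: "'a measure \<Rightarrow> 't set \<Rightarrow> ('t \<Rightarrow> 'a \<Rightarrow> real) \<Rightarrow> bool" where
  "gaussian_process_on M T X \<longleftrightarrow>
     (\<forall>F c. finite F \<longrightarrow> F \<subseteq> T \<longrightarrow> gaussian_rv M (\<lambda>\<omega>. \<Sum>t\<in>F. c t * X t \<omega>))"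

definition centered_process_on :: "'a measure \<Rightarrow> 't set \<Rightarrow> ('t \<Rightarrow> 'a \<Rightarrow> real) \<Rightarrow> bool" where
  "centered_process_on M T X \<longleftrightarrow>
     (\<forall>t\<in>T. integrable M (X t) \<and> integral\<^sup>L M (X t) = 0)"

definition continuous_process_on ::
  "'a measure \<Rightarrow> 't::topological_space set \<Rightarrow> ('t \<Rightarrow> 'a \<Rightarrow> real) \<Rightarrow> bool" where
  "continuous_process_on M T X \<longleftrightarrow> (\<forall>\<omega>\<in>space M. continuous_on T (\<lambda>t. X t \<omega>))"

definition covariance :: "'a measure \<Rightarrow> ('a \<Rightarrow> real) \<Rightarrow> ('a \<Rightarrow> real) \<Rightarrow> real" where
  "covariance M Y Z =
     (LINT \<omega>|M. (Y \<omega> - integral\<^sup>L M Y) * (Z \<omega> - integral\<^sup>L M Z))"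

definition ou_zero_cov :: "real \<Rightarrow> real \<Rightarrow> real \<Rightarrow> real" where
  "ou_zero_cov \<alpha> t s = (exp (- \<alpha> * \<bar>t - s\<bar>) - exp (- \<alpha> * (t + s))) / (2 * \<alpha>)"

definition ou_process_from_zero :: "real \<Rightarrow> 'a measure \<Rightarrow> (real \<Rightarrow> 'a \<Rightarrow> real) \<Rightarrow> bool" where
  "ou_process_from_zero \<alpha> M U \<longleftrightarrow>
     prob_space M \<and>
     gaussian_process_on M {0..1} U \<and>
     centered_process_on M {0..1} U \<and>
     continuous_process_on M {0..1} U \<and>
     (\<forall>s\<in>{0..1}. \<forall>t\<in>{0..1}. covariance M (U t) (U s) = ou_zero_cov \<alpha> t s)"

definition weighted_L2_norm :: "(real \<Rightarrow> real) \<Rightarrow> (real \<Rightarrow> real) \<Rightarrow> real" where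
  "weighted_L2_norm \<psi> f = sqrt (LINT t:{0..1}|lborel. (f t)\<^sup>2 * \<psi> t)"

text \<open>Derivatives at the endpoints of \<open>S\<close> are one-sided.\<close>

definition twice_continuously_differentiable_on :: "(real \<Rightarrow> real) \<Rightarrow> real set \<Rightarrow> bool" where
  "twice_continuously_differentiable_on f S \<longleftrightarrow>
     (\<exists>f' f''.
        (\<forall>x\<in>S. (f has_real_derivative f' x) (at x within S)) \<and>
        (\<forall>x\<in>S. (f' has_real_derivative f'' x) (at x within S)) \<and>
        continuous_on S f'')"

end

theory Submission
  imports Defs "HOL-Complex_Analysis.Complex_Analysis"
begin

text \<open>
  Let \<open>W = \<integral>U\<^sup>2\<psi>\<close> and \<open>L(s) = E exp(-sW)\<close>. Replacing \<open>W\<close> by Riemann sums makes \<open>1/L\<^sup>2\<close> a polynomial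
  in \<open>s\<close>, given by a two-term recursion that discretises the system \<open>q' = e\<^bsup>2\<alpha>t\<^esup> p\<close>,
  \<open>p' = 2s\<psi>e\<^bsup>-2\<alpha>t\<^esup> q\<close>; for real \<open>s\<close> this is a Gaussian computation, and analytic continuation extends
  it to \<open>Re s > 0\<close>. A WKB analysis of the recursion, uniform in complex \<open>s\<close>, gives
  \<open>L(s) = A\<^sub>0 exp(-\<theta>\<surd>(2s)/2)(1 + O((Re s)\<^bsup>-1/2\<^esup>))\<close> with \<open>A\<^sub>0 = \<surd>2 e\<^bsup>\<alpha>/2\<^esup> (\<psi>(0)/\<psi>(1))\<^bsup>1/8\<^esup>\<close>.
  Since this holds on whole vertical lines, Fourier inversion of the distribution function along the
  line through the saddle point \<open>\<gamma> = \<theta>\<^sup>2/(8\<epsilon>\<^sup>4)\<close> and dominated convergence give the exact asymptotics.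
\<close>

section \<open>Gaussian quadratic functionals\<close>

text \<open>The obstacle is uniformity. A sharp constant requires relative error o(1) for
  \<open>L\<close> along the whole line Re s = \<gamma>, so the WKB error must be controlled by Re s
  alone, whatever Im s is. The bound for the recursion therefore has a constant chosen before the
  parameter \<kappa>, a root of 2s. Only the mesh from which it holds may depend on \<kappa>; this
  is harmless, since the mesh tends to 0 at fixed s. With frequency \<omega> = sqrt \<psi>, the
  amplitude g = e^(\<alpha> t) \<psi>^(-1/4) makes pg/\<kappa> and q/g drive each other at the same
  rate \<kappa>\<omega>. The growing and the decaying mode are then coupled through g'/g, which is
  free of \<kappa>. Their sum is 2pg/\<kappa>, so p(1) behaves like e^(\<kappa>\<theta>)
  g(0)/(2g(1)). As L^2 = 1/p(1), this yields A0^2 = 2g(1)/g(0). The saddle point is the stationary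
  point of s\<epsilon>^2 - \<theta> sqrt(2s)/2. The phase on the line through it has an exact closed
  form whose real part grows at least like the square root of the rescaled variable, and this
  supplies the majorant.\<close>

lemma exp_half_add: "exp (- (x + y) / 2) = exp (- x / 2) * exp (- y / 2)" for x y :: real
  by (simp add: exp_add [symmetric] add_divide_distrib [symmetric])

text \<open>Completing the square in \<open>z\<close>: with
  \<open>D = 1 + \<sigma>\<^sup>2 * b\<close> the integrand against the density is the right-hand
  side times a normal density of mean \<open>- (b * \<sigma> * x) / D\<close> and standard deviation
  \<open>1 / sqrt D\<close>. The change from \<open>b\<close> to \<open>b / D\<close> is the Riccati
  step.\<close>

lemma std_normal_integral_exp_square:
  fixes b x \<sigma> :: real
  assumes "b \<ge> 0"
  shows "(LINT z|std_normal_distribution. exp (- (b * (x + \<sigma> * z)\<^sup>2) / 2))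
    = exp (- (b / (1 + \<sigma>\<^sup>2 * b) * x\<^sup>2) / 2) / sqrt (1 + \<sigma>\<^sup>2 * b)"
proof -
  define D where "D = 1 + \<sigma>\<^sup>2 * b"
  have D: "D > 0" using assms by (simp add: D_def add_pos_nonneg)
  have eq: "std_normal_density z * exp (- (b * (x + \<sigma> * z)\<^sup>2) / 2)
    = exp (- (b / D * x\<^sup>2) / 2) / sqrt D * normal_density (- (b * \<sigma> * x) / D) (1 / sqrt D) z" for z
  proof -
    have "z\<^sup>2 + b * (x + \<sigma> * z)\<^sup>2 = D * (z + b * \<sigma> * x / D)\<^sup>2 + b / D * x\<^sup>2"
    proof -
      have "D * (z + b * \<sigma> * x / D)\<^sup>2 + b / D * x\<^sup>2
         = D * z\<^sup>2 + 2 * b * \<sigma> * x * z + b * x\<^sup>2 * ((b * \<sigma>\<^sup>2 + 1) / D)"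
        using D by (simp add: power2_eq_square field_simps)
      also have "(b * \<sigma>\<^sup>2 + 1) / D = 1" using D by (simp add: D_def algebra_simps)
      finally show ?thesis by (simp add: D_def power2_eq_square algebra_simps)
    qed
    moreover have "- s / 2 + - t / 2 = - v / 2 + - u / 2" if "s + t = u + v" for s t u v :: real
      using that by linarith
    ultimately have "- z\<^sup>2 / 2 + - (b * (x + \<sigma> * z)\<^sup>2) / 2 = - (b / D * x\<^sup>2) / 2 + - (D * (z + b * \<sigma> * x / D)\<^sup>2) / 2"
      by blast
    hence "exp (- z\<^sup>2 / 2) * exp (- (b * (x + \<sigma> * z)\<^sup>2) / 2)
        = exp (- (b / D * x\<^sup>2) / 2) * exp (- (D * (z + b * \<sigma> * x / D)\<^sup>2) / 2)"
      by (simp add: exp_add [symmetric])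
    thus ?thesis using D
      by (simp add: normal_density_def real_sqrt_divide real_sqrt_mult power_divide)
  qed
  have "(LINT z|std_normal_distribution. exp (- (b * (x + \<sigma> * z)\<^sup>2) / 2))
      = (LINT z|lborel. std_normal_density z * exp (- (b * (x + \<sigma> * z)\<^sup>2) / 2))"
    by (subst integral_density) auto
  also have "\<dots> = exp (- (b / D * x\<^sup>2) / 2) / sqrt D"
    unfolding eq using D by simp
  finally show ?thesis by (simp add: D_def)
qed

text \<open>Linearises a square in the exponent: the right-hand side is the characteristic function
  of the standard normal law at \<open>sqrt a * y\<close>, so \<open>y\<close> enters only through a
  character.\<close>

lemma exp_neg_square_eq_normal_integral:
  fixes a y :: real
  assumes "a \<ge> 0"
  shows "complex_of_real (exp (- (a * y\<^sup>2) / 2)) = (CLINT z|std_normal_distribution. cis (sqrt a * z * y))"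
proof -
  have "char std_normal_distribution (sqrt a * y) = (CLINT z|std_normal_distribution. cis (sqrt a * z * y))"
    unfolding char_def by (intro Bochner_Integration.integral_cong) (auto simp: cis_conv_exp mult_ac)
  thus ?thesis using assms by (simp add: char_std_normal_distribution power_mult_distrib)
qed

text \<open>
  The coefficient of the quadratic exponent obeys a Riccati recursion. It is kept as a quotient, so that
  numerator and denominator obey a linear recursion and are polynomial in the weights \<open>a\<close>.
\<close>

fun riccati_num :: "(nat \<Rightarrow> 'b::comm_ring_1) \<Rightarrow> (nat \<Rightarrow> 'b) \<Rightarrow> nat \<Rightarrow> 'b"
  and riccati_den :: "(nat \<Rightarrow> 'b::comm_ring_1) \<Rightarrow> (nat \<Rightarrow> 'b) \<Rightarrow> nat \<Rightarrow> 'b" where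
  "riccati_num d a 0 = 0"
| "riccati_num d a (Suc i) = riccati_num d a i + d i * riccati_den d a i"
| "riccati_den d a 0 = 1"
| "riccati_den d a (Suc i) = riccati_den d a i + a i * (riccati_num d a i + d i * riccati_den d a i)"

lemma riccati_nonneg:
  fixes d a :: "nat \<Rightarrow> real"
  assumes "\<And>i. d i \<ge> 0" "\<And>i. a i \<ge> 0"
  shows "riccati_num d a i \<ge> 0 \<and> riccati_den d a i \<ge> 1"
proof (induction i)
  case (Suc i)
  hence "riccati_num d a i + d i * riccati_den d a i \<ge> 0" using assms by simp
  moreover from this have "a i * (riccati_num d a i + d i * riccati_den d a i) \<ge> 0" using assms by simp
  ultimately show ?case using Suc by simp
qed simp

text \<open>
  Each factor \<open>exp(-aY\<^sup>2/2)\<close> is a Gaussian average of the characters \<open>exp(i\<surd>a z Y)\<close>. Integrating the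
  auxiliary variables \<open>z\<close> one at a time uses only the joint characteristic function of the \<open>Y k\<close>.
\<close>

lemma (in prob_space) gaussian_quadratic_laplace:
  fixes Y :: "nat \<Rightarrow> 'a \<Rightarrow> real" and d a :: "nat \<Rightarrow> real"
  assumes Y [measurable]: "\<And>k. k < n \<Longrightarrow> Y k \<in> borel_measurable M"
    and chr: "\<And>c. (CLINT \<omega>|M. cis (\<Sum>k<n. c k * Y k \<omega>))
        = complex_of_real (exp (- (\<Sum>j<n. d j * (\<Sum>k\<in>{j..<n}. c k)\<^sup>2) / 2))"
    and d: "\<And>i. d i \<ge> 0" and a: "\<And>i. a i \<ge> 0"
  shows "expectation (\<lambda>\<omega>. exp (- (\<Sum>k<n. a k * (Y k \<omega>)\<^sup>2) / 2)) = 1 / sqrt (riccati_den d a n)"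
proof -
  let ?p = "riccati_den d a" and ?q = "riccati_num d a"
  interpret N: prob_space std_normal_distribution by (rule prob_space_normal_density) simp
  interpret P: pair_sigma_finite M std_normal_distribution ..
  \<comment> \<open>The squares with index below \<open>i\<close> are already in the exponent; the
    other variables are still tested against characters. The frequencies \<open>c\<close> stay
    arbitrary because the next step inserts its auxiliary variable as the frequency at index
    \<open>i\<close>.\<close>
  have claim: "i \<le> n \<Longrightarrow> (CLINT \<omega>|M. complex_of_real (exp (- (\<Sum>k<i. a k * (Y k \<omega>)\<^sup>2) / 2)) * cis (\<Sum>k\<in>{i..<n}. c k * Y k \<omega>))
     = complex_of_real (exp (- (?q i / ?p i * (\<Sum>k\<in>{i..<n}. c k)\<^sup>2 + (\<Sum>j\<in>{i..<n}. d j * (\<Sum>k\<in>{j..<n}. c k)\<^sup>2)) / 2) / sqrt (?p i))"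
    for i c
  proof (induction i arbitrary: c)
    case 0
    show ?case using chr[of c] by (simp add: atLeast0LessThan)
  next
    case (Suc i)
    hence i: "i < n" by simp
    have [measurable]: "Y i \<in> borel_measurable M" using i by simp
    have [measurable]: "(\<lambda>\<omega>. (\<Sum>k<i. a k * (Y k \<omega>)\<^sup>2)) \<in> borel_measurable M"
      using i by (intro borel_measurable_sum) auto
    have [measurable]: "(\<lambda>\<omega>. (\<Sum>k\<in>{Suc i..<n}. c k * Y k \<omega>)) \<in> borel_measurable M"
      using i by (intro borel_measurable_sum) auto
    have p: "?p i \<ge> 1" "?q i \<ge> 0" using riccati_nonneg[of d a i] d a by auto
    define c' where "c' z = c(i := sqrt (a i) * z)" for z
    define S where "S = (\<Sum>k\<in>{Suc i..<n}. c k)"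
    define T where "T = (\<Sum>j\<in>{Suc i..<n}. d j * (\<Sum>k\<in>{j..<n}. c k)\<^sup>2)"
    define f where "f \<omega> z = complex_of_real (exp (- (\<Sum>k<i. a k * (Y k \<omega>)\<^sup>2) / 2))
        * (cis (\<Sum>k\<in>{Suc i..<n}. c k * Y k \<omega>) * cis (sqrt (a i) * z * Y i \<omega>))" for \<omega> z
    have rng: "{i..<n} = insert i {Suc i..<n}" using i by auto
    have fc': "f \<omega> z = complex_of_real (exp (- (\<Sum>k<i. a k * (Y k \<omega>)\<^sup>2) / 2)) * cis (\<Sum>k\<in>{i..<n}. c' z k * Y k \<omega>)" for \<omega> z
    proof -
      have "(\<Sum>k\<in>{i..<n}. c' z k * Y k \<omega>) = sqrt (a i) * z * Y i \<omega> + (\<Sum>k\<in>{Suc i..<n}. c k * Y k \<omega>)"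
        unfolding rng by (subst sum.insert) (auto simp: c'_def intro!: sum.cong)
      thus ?thesis by (simp add: f_def cis_mult add.commute)
    qed
    have Sc': "(\<Sum>k\<in>{i..<n}. c' z k) = S + sqrt (a i) * z" for z
      unfolding rng S_def by (subst sum.insert) (auto simp: c'_def intro!: sum.cong)
    have Tc': "(\<Sum>j\<in>{i..<n}. d j * (\<Sum>k\<in>{j..<n}. c' z k)\<^sup>2) = d i * (S + sqrt (a i) * z)\<^sup>2 + T" for z
    proof -
      have "(\<Sum>j\<in>{i..<n}. d j * (\<Sum>k\<in>{j..<n}. c' z k)\<^sup>2)
          = d i * (\<Sum>k\<in>{i..<n}. c' z k)\<^sup>2 + (\<Sum>j\<in>{Suc i..<n}. d j * (\<Sum>k\<in>{j..<n}. c' z k)\<^sup>2)"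
        by (subst rng, subst sum.insert) auto
      also have "(\<Sum>j\<in>{Suc i..<n}. d j * (\<Sum>k\<in>{j..<n}. c' z k)\<^sup>2) = T"
        unfolding T_def by (intro sum.cong arg_cong2[where f="(*)"] arg_cong[where f="\<lambda>x. x\<^sup>2"]) (auto simp: c'_def)
      finally show ?thesis by (simp add: Sc')
    qed
    have le: "exp (- (\<Sum>k<i. a k * (Y k \<omega>)\<^sup>2) / 2) \<le> 1" for \<omega>
      using a by (auto intro!: sum_nonneg)
    have "integrable (M \<Otimes>\<^sub>M std_normal_distribution) (\<lambda>(\<omega>, z). f \<omega> z)"
    proof (rule finite_measure.integrable_const_bound[where B=1])
      show "finite_measure (M \<Otimes>\<^sub>M std_normal_distribution)"
        by (intro prob_space.finite_measure prob_space_pair) (auto simp: prob_space_axioms N.prob_space_axioms)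
    next
      show "AE x in M \<Otimes>\<^sub>M std_normal_distribution. norm (case x of (\<omega>, z) \<Rightarrow> f \<omega> z) \<le> 1"
        using le by (intro AE_I2) (auto simp: f_def norm_mult)
    next
      show "(\<lambda>(\<omega>, z). f \<omega> z) \<in> borel_measurable (M \<Otimes>\<^sub>M std_normal_distribution)"
        unfolding f_def cis_conv_exp by measurable
    qed
    note fub = P.Fubini_integral[OF this]
    have "(CLINT \<omega>|M. complex_of_real (exp (- (\<Sum>k<Suc i. a k * (Y k \<omega>)\<^sup>2) / 2)) * cis (\<Sum>k\<in>{Suc i..<n}. c k * Y k \<omega>))
       = (CLINT \<omega>|M. (CLINT z|std_normal_distribution. f \<omega> z))"
    proof (intro Bochner_Integration.integral_cong refl)
      fix \<omega>
      have h: "complex_of_real (exp (- (\<Sum>k<Suc i. a k * (Y k \<omega>)\<^sup>2) / 2))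
          = complex_of_real (exp (- (\<Sum>k<i. a k * (Y k \<omega>)\<^sup>2) / 2)) * complex_of_real (exp (- (a i * (Y i \<omega>)\<^sup>2) / 2))"
        unfolding exp_half_add [symmetric] of_real_mult [symmetric] sum.lessThan_Suc by (simp add: algebra_simps)
      show "complex_of_real (exp (- (\<Sum>k<Suc i. a k * (Y k \<omega>)\<^sup>2) / 2)) * cis (\<Sum>k\<in>{Suc i..<n}. c k * Y k \<omega>)
          = (CLINT z|std_normal_distribution. f \<omega> z)"
        unfolding f_def h integral_mult_right_zero exp_neg_square_eq_normal_integral[OF a]
        by (simp only: mult_ac)
    qed
    also have "\<dots> = (CLINT z|std_normal_distribution. (CLINT \<omega>|M. f \<omega> z))"
      by (rule fub [symmetric])
    also have "\<dots> = (CLINT z|std_normal_distribution. complex_of_real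
          (exp (- T / 2) / sqrt (?p i) * exp (- ((?q i / ?p i + d i) * (S + sqrt (a i) * z)\<^sup>2) / 2)))"
    proof (intro Bochner_Integration.integral_cong refl)
      fix z
      show "(CLINT \<omega>|M. f \<omega> z) = complex_of_real
          (exp (- T / 2) / sqrt (?p i) * exp (- ((?q i / ?p i + d i) * (S + sqrt (a i) * z)\<^sup>2) / 2))"
      proof -
        have e: "?q i / ?p i * w + (d i * w + T) = T + (?q i / ?p i + d i) * w" for w
          by (simp only: ring_distribs ac_simps)
        show ?thesis unfolding fc' Suc.IH[OF less_imp_le[OF i]] Sc' Tc' e exp_half_add by simp
      qed
    qed
    also have "\<dots> = complex_of_real (exp (- T / 2) / sqrt (?p i) *
          (exp (- ((?q i / ?p i + d i) / (1 + (sqrt (a i))\<^sup>2 * (?q i / ?p i + d i)) * S\<^sup>2) / 2)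
              / sqrt (1 + (sqrt (a i))\<^sup>2 * (?q i / ?p i + d i))))"
      by (subst integral_complex_of_real, subst integral_mult_right_zero,
          subst std_normal_integral_exp_square) (use p d in auto)
    \<comment> \<open>The Riccati step takes \<rho> = q/p + d to \<rho> / (1 + a\<rho>). Written for
      the quotient q/p it is the linear recursion, and the normalising square roots telescope to
      \<open>sqrt (?p (Suc i))\<close>.\<close>
    also have "1 + (sqrt (a i))\<^sup>2 * (?q i / ?p i + d i) = ?p (Suc i) / ?p i"
      using p a[of i] by (simp add: field_simps)
    also have "?q i / ?p i + d i = ?q (Suc i) / ?p i"
      using p by (simp add: field_simps)
    also have "?q (Suc i) / ?p i / (?p (Suc i) / ?p i) = ?q (Suc i) / ?p (Suc i)"
      using p by simp
    also have "exp (- T / 2) / sqrt (?p i) * (exp (- (?q (Suc i) / ?p (Suc i) * S\<^sup>2) / 2) / sqrt (?p (Suc i) / ?p i))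
         = exp (- (?q (Suc i) / ?p (Suc i) * S\<^sup>2 + T) / 2) / sqrt (?p (Suc i))"
      using p unfolding exp_half_add by (simp add: real_sqrt_divide del: riccati_num.simps riccati_den.simps)
    finally show ?case unfolding S_def T_def .
  qed
  have "complex_of_real (expectation (\<lambda>\<omega>. exp (- (\<Sum>k<n. a k * (Y k \<omega>)\<^sup>2) / 2))) = complex_of_real (1 / sqrt (?p n))"
    using claim[of n "\<lambda>_. 0"] by (simp add: integral_complex_of_real [symmetric] del: integral_complex_of_real)
  thus ?thesis unfolding of_real_eq_iff .
qed

section \<open>Characteristic functions of a centered Gaussian process\<close>

lemma (in prob_space) gaussian_rv_mean_zero:
  assumes "gaussian_rv M Y" and mean: "expectation Y = 0"
  shows gaussian_rv_integrable_square: "integrable M (\<lambda>\<omega>. (Y \<omega>)\<^sup>2)"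
    and gaussian_rv_char: "(CLINT \<omega>|M. cis (Y \<omega>)) = complex_of_real (exp (- expectation (\<lambda>\<omega>. (Y \<omega>)\<^sup>2) / 2))"
proof -
  from assms(1) obtain \<mu> \<sigma> where Y [measurable]: "Y \<in> borel_measurable M" and \<sigma>: "\<sigma> \<ge> 0"
    and D: "distr M borel Y = normal_law \<mu> \<sigma>"
    by (auto simp: gaussian_rv_def)
  have "integrable M (\<lambda>\<omega>. (Y \<omega>)\<^sup>2) \<and> (CLINT \<omega>|M. cis (Y \<omega>)) = complex_of_real (exp (- expectation (\<lambda>\<omega>. (Y \<omega>)\<^sup>2) / 2))"
  \<comment> \<open>For \<open>\<sigma> = 0\<close> the law is a point mass, located at 0 by the
    mean condition, and \<open>Y\<close> vanishes almost surely. Otherwise the mean condition gives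
    \<open>\<mu> = 0\<close>, and the second moment is \<open>\<sigma>\<^sup>2\<close>.\<close>
  proof (cases "\<sigma> = 0")
    case True
    hence D: "distr M borel Y = return borel \<mu>" using D by (simp add: normal_law_def)
    have "AE y in distr M borel Y. y = \<mu>"
      unfolding D by (subst AE_return) auto
    hence ae': "AE \<omega> in M. Y \<omega> = \<mu>"
      by (subst (asm) AE_distr_iff) auto
    have "expectation Y = (LINT \<omega>|M. \<mu>)" by (intro integral_cong_AE) (use ae' in \<open>auto elim!: eventually_mono\<close>)
    hence "\<mu> = 0" using mean by (simp add: prob_space)
    hence ae: "AE \<omega> in M. Y \<omega> = 0" using ae' by simp
    have "expectation (\<lambda>\<omega>. (Y \<omega>)\<^sup>2) = (LINT \<omega>|M. 0)" by (intro integral_cong_AE) (use ae in \<open>auto elim!: eventually_mono\<close>)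
    moreover have "(CLINT \<omega>|M. cis (Y \<omega>)) = (CLINT \<omega>|M. 1)"
      by (intro integral_cong_AE) (use ae in \<open>auto simp: cis_conv_exp elim!: eventually_mono\<close>)
    moreover have "integrable M (\<lambda>\<omega>. (Y \<omega>)\<^sup>2) \<longleftrightarrow> integrable M (\<lambda>\<omega>. 0::real)"
      by (intro integrable_cong_AE) (use ae in \<open>auto elim!: eventually_mono\<close>)
    ultimately show ?thesis by (simp add: prob_space)
  next
    case False
    hence s: "\<sigma> > 0" using \<sigma> by simp
    have D: "distr M borel Y = density lborel (\<lambda>x. ennreal (normal_density \<mu> \<sigma> x))"
      using D False by (simp add: normal_law_def)
    have dd: "distributed M lborel Y (normal_density \<mu> \<sigma>)"
      unfolding distributed_def using D by (simp cong: distr_cong)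
    have "expectation Y = \<mu>" using normal_distributed_expectation[OF s dd] .
    hence [simp]: "\<mu> = 0" using mean by simp
    have sq: "expectation (\<lambda>\<omega>. (Y \<omega>)\<^sup>2) = \<sigma>\<^sup>2"
      using normal_distributed_variance[OF s dd] mean by simp
    have int: "integrable M (\<lambda>\<omega>. (Y \<omega>)\<^sup>2)"
      using distributed_integrable[OF dd, of "\<lambda>x. x\<^sup>2"] integrable_normal_moment[OF s, of 0 2] by simp
    have "distributed M lborel (\<lambda>\<omega>. Y \<omega> / \<sigma>) std_normal_density"
      using normal_standard_normal_convert[OF s, of Y 0] dd by simp
    hence Z: "distr M lborel (\<lambda>\<omega>. Y \<omega> / \<sigma>) = std_normal_distribution"
      by (simp add: distributed_def)
    have "(CLINT \<omega>|M. cis (Y \<omega>)) = (CLINT \<omega>|M. iexp (\<sigma> * (Y \<omega> / \<sigma>)))"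
      using s by (intro Bochner_Integration.integral_cong) (auto simp: cis_conv_exp)
    also have "\<dots> = char (distr M lborel (\<lambda>\<omega>. Y \<omega> / \<sigma>)) \<sigma>"
      unfolding char_def by (subst integral_distr) auto
    also have "\<dots> = complex_of_real (exp (- \<sigma>\<^sup>2 / 2))"
      unfolding Z char_std_normal_distribution ..
    finally show ?thesis using sq int by simp
  qed
  thus "integrable M (\<lambda>\<omega>. (Y \<omega>)\<^sup>2)"
    and "(CLINT \<omega>|M. cis (Y \<omega>)) = complex_of_real (exp (- expectation (\<lambda>\<omega>. (Y \<omega>)\<^sup>2) / 2))" by auto
qed


lemma (in prob_space) gaussian_process_char:
  fixes c t :: "nat \<Rightarrow> real"
  assumes G: "gaussian_process_on M T X" and C: "centered_process_on M T X"
    and t: "inj_on t {..<n}" "\<And>k. k < n \<Longrightarrow> t k \<in> T"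
  shows "(CLINT \<omega>|M. cis (\<Sum>k<n. c k * X (t k) \<omega>))
    = complex_of_real (exp (- (\<Sum>j<n. \<Sum>k<n. c j * c k * covariance M (X (t j)) (X (t k))) / 2))"
proof -
  have int: "integrable M (X s)" "expectation (X s) = 0" if "s \<in> T" for s
    using C that by (auto simp: centered_process_on_def)
  have g1: "gaussian_rv M (X s)" if "s \<in> T" for s
    using G[unfolded gaussian_process_on_def, rule_format, of "{s}" "\<lambda>_. 1"] that by simp
  have sq: "integrable M (\<lambda>\<omega>. (X s \<omega>)\<^sup>2)" if "s \<in> T" for s
    using gaussian_rv_integrable_square[OF g1[OF that] int(2)[OF that]] .
  have prod: "integrable M (\<lambda>\<omega>. X s \<omega> * X s' \<omega>)" if "s \<in> T" "s' \<in> T" for s s'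
  proof (rule Bochner_Integration.integrable_bound)
    show "integrable M (\<lambda>\<omega>. (X s \<omega>)\<^sup>2 + (X s' \<omega>)\<^sup>2)" using sq that by auto
    show "(\<lambda>\<omega>. X s \<omega> * X s' \<omega>) \<in> borel_measurable M"
      using int(1)[OF that(1)] int(1)[OF that(2)] by auto
    have "\<bar>x * y\<bar> \<le> x\<^sup>2 + y\<^sup>2" for x y :: real
      using sum_squares_bound[of "\<bar>x\<bar>" "\<bar>y\<bar>"] zero_le_power2[of x] zero_le_power2[of y]
      unfolding abs_mult power2_abs by linarith
    thus "AE \<omega> in M. norm (X s \<omega> * X s' \<omega>) \<le> norm ((X s \<omega>)\<^sup>2 + (X s' \<omega>)\<^sup>2)"
      by (intro AE_I2) auto
  qed
  let ?Y = "\<lambda>\<omega>. \<Sum>k<n. c k * X (t k) \<omega>"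
  \<comment> \<open>\<open>gaussian_process_on\<close> speaks of sums over sets of times;
    injectivity of \<open>t\<close> brings the indexed sum into that form.\<close>
  have "?Y = (\<lambda>\<omega>. \<Sum>s\<in>t ` {..<n}. c (the_inv_into {..<n} t s) * X s \<omega>)"
    by (intro ext) (simp add: sum.reindex[OF t(1)] the_inv_into_f_f[OF t(1)])
  hence gY: "gaussian_rv M ?Y"
    using G[unfolded gaussian_process_on_def, rule_format, of "t ` {..<n}" "\<lambda>s. c (the_inv_into {..<n} t s)"] t(2)
    by auto
  have EY: "expectation ?Y = 0"
    using t int by (subst Bochner_Integration.integral_sum) auto
  have "expectation (\<lambda>\<omega>. (?Y \<omega>)\<^sup>2) = expectation (\<lambda>\<omega>. \<Sum>j<n. \<Sum>k<n. c j * c k * (X (t j) \<omega> * X (t k) \<omega>))"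
    by (intro Bochner_Integration.integral_cong) (auto simp: power2_eq_square sum_product mult_ac)
  also have "\<dots> = (\<Sum>j<n. \<Sum>k<n. c j * c k * expectation (\<lambda>\<omega>. X (t j) \<omega> * X (t k) \<omega>))"
  proof -
    have i: "integrable M (\<lambda>\<omega>. c j * c k * (X (t j) \<omega> * X (t k) \<omega>))" if "j < n" "k < n" for j k
      using prod[OF t(2)[OF that(1)] t(2)[OF that(2)]] by simp
    have "expectation (\<lambda>\<omega>. \<Sum>j<n. \<Sum>k<n. c j * c k * (X (t j) \<omega> * X (t k) \<omega>))
      = (\<Sum>j<n. expectation (\<lambda>\<omega>. \<Sum>k<n. c j * c k * (X (t j) \<omega> * X (t k) \<omega>)))"
      by (intro Bochner_Integration.integral_sum Bochner_Integration.integrable_sum i) auto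
    also have "\<dots> = (\<Sum>j<n. \<Sum>k<n. expectation (\<lambda>\<omega>. c j * c k * (X (t j) \<omega> * X (t k) \<omega>)))"
      by (intro sum.cong refl Bochner_Integration.integral_sum i) auto
    finally show ?thesis by simp
  qed
  also have "\<dots> = (\<Sum>j<n. \<Sum>k<n. c j * c k * covariance M (X (t j)) (X (t k)))"
    using int t(2) by (intro sum.cong) (auto simp: covariance_def)
  finally show ?thesis using gaussian_rv_char[OF gY EY] by simp
qed

text \<open>The left side is the quadratic form of the covariance of a random walk with independent
  increments of variance \<open>d i\<close>. Regrouping by increments diagonalises it, because
  increment \<open>i\<close> is contained in every position \<open>k \<ge> i\<close>.\<close>

lemma sum_min_eq_sum_squares:
  fixes d c :: "nat \<Rightarrow> 'b::comm_ring_1"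
  shows "(\<Sum>j<n. \<Sum>k<n. c j * c k * (\<Sum>i\<le>min j k. d i)) = (\<Sum>i<n. d i * (\<Sum>k\<in>{i..<n}. c k)\<^sup>2)"
proof -
  have *: "(\<Sum>i\<le>min j k. d i) = (\<Sum>i<n. (if i \<le> j then 1 else 0) * (if i \<le> k then 1 else 0) * d i)"
    if "j < n" "k < n" for j k
    using that by (intro sum.mono_neutral_cong_left) auto
  have S: "(\<Sum>k\<in>{i..<n}. c k) = (\<Sum>k<n. c k * (if i \<le> k then 1 else 0))" for i
    by (intro sum.mono_neutral_cong_left) auto
  have "(\<Sum>j<n. \<Sum>k<n. c j * c k * (\<Sum>i\<le>min j k. d i))
     = (\<Sum>j<n. \<Sum>k<n. \<Sum>i<n. d i * ((c j * (if i \<le> j then 1 else 0)) * (c k * (if i \<le> k then 1 else 0))))"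
  proof (intro sum.cong refl)
    fix j k assume jk: "j \<in> {..<n}" "k \<in> {..<n}"
    show "c j * c k * (\<Sum>i\<le>min j k. d i)
      = (\<Sum>i<n. d i * ((c j * (if i \<le> j then 1 else 0)) * (c k * (if i \<le> k then 1 else 0))))"
      using jk unfolding *[OF jk[unfolded lessThan_iff]] sum_distrib_left by (intro sum.cong) (simp_all add: mult_ac)
  qed
  also have "\<dots> = (\<Sum>j<n. \<Sum>i<n. \<Sum>k<n. d i * ((c j * (if i \<le> j then 1 else 0)) * (c k * (if i \<le> k then 1 else 0))))"
    by (intro sum.cong refl sum.swap)
  also have "\<dots> = (\<Sum>i<n. \<Sum>j<n. \<Sum>k<n. d i * ((c j * (if i \<le> j then 1 else 0)) * (c k * (if i \<le> k then 1 else 0))))"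
    by (rule sum.swap)
  also have "\<dots> = (\<Sum>i<n. d i * (\<Sum>k\<in>{i..<n}. c k)\<^sup>2)"
    unfolding S power2_eq_square sum_product by (simp only: sum_distrib_left)
  finally show ?thesis .
qed

text \<open>
  \<open>e\<^bsup>\<alpha>t\<^esup>U(t)\<close> is a Brownian motion run with the clock \<open>(e\<^bsup>2\<alpha>t\<^esup> - 1)/(2\<alpha>)\<close>.
\<close>

definition ou_clock_step :: "real \<Rightarrow> nat \<Rightarrow> nat \<Rightarrow> real" where
  "ou_clock_step \<alpha> n i = (exp (2 * \<alpha> * real (Suc i) / real n) - exp (2 * \<alpha> * real i / real n)) / (2 * \<alpha>)"

lemma ou_clock_step_nonneg: "ou_clock_step \<alpha> n i \<ge> 0"
proof (cases "\<alpha> > 0")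
  case True
  thus ?thesis unfolding ou_clock_step_def
    by (intro divide_nonneg_nonneg) (auto intro!: divide_right_mono)
next
  case False
  hence "exp (2 * \<alpha> * real (Suc i) / real n) \<le> exp (2 * \<alpha> * real i / real n)"
    unfolding exp_le_cancel_iff by (intro divide_right_mono mult_left_mono_neg) auto
  thus ?thesis using False unfolding ou_clock_step_def by (intro divide_nonpos_nonpos) auto
qed

lemma sum_ou_clock_step:
  "(\<Sum>i\<le>m. ou_clock_step \<alpha> n i) = (exp (2 * \<alpha> * real (Suc m) / real n) - 1) / (2 * \<alpha>)"
  by (induction m) (auto simp: ou_clock_step_def add_divide_distrib [symmetric] diff_divide_distrib [symmetric])

lemma ou_process_quadratic_laplace:
  fixes w :: "nat \<Rightarrow> real" and n :: nat
  assumes \<alpha>: "\<alpha> \<noteq> 0" and U: "ou_process_from_zero \<alpha> M U" and w: "\<And>k. w k \<ge> 0"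
  defines "t \<equiv> \<lambda>k. real (Suc k) / real n"
  shows "(LINT \<omega>|M. exp (- (\<Sum>k<n. w k * (U (t k) \<omega>)\<^sup>2) / 2))
    = 1 / sqrt (riccati_den (ou_clock_step \<alpha> n) (\<lambda>k. w k * exp (- 2 * \<alpha> * t k)) n)"
proof -
  interpret prob_space M using U by (simp add: ou_process_from_zero_def)
  have G: "gaussian_process_on M {0..1} U" and C: "centered_process_on M {0..1} U"
    and cov: "\<And>s t. s \<in> {0..1} \<Longrightarrow> t \<in> {0..1} \<Longrightarrow> covariance M (U t) (U s) = ou_zero_cov \<alpha> t s"
    using U by (auto simp: ou_process_from_zero_def)
  have t01: "t k \<in> {0..1}" if "k < n" for k using that by (auto simp: t_def field_simps)
  have inj: "inj_on t {..<n}" by (auto simp: inj_on_def t_def)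
  \<comment> \<open>Removes the mean reversion: the covariance of \<open>Y\<close> is that of
    Brownian motion on the clock. The factor is paid back as
    \<open>exp (- 2 * \<alpha> * t k)\<close> in the weights. The grid starts at 1/n, and clock step
    0 covers the stretch from time 0 to it.\<close>
  define Y where "Y k \<omega> = exp (\<alpha> * t k) * U (t k) \<omega>" for k \<omega>
  have covY: "exp (\<alpha> * t j) * exp (\<alpha> * t k) * ou_zero_cov \<alpha> (t j) (t k) = (\<Sum>i\<le>min j k. ou_clock_step \<alpha> n i)"
    if "j < n" "k < n" for j k
  proof -
    have *: "exp (\<alpha> * t j) * exp (\<alpha> * t k) * ou_zero_cov \<alpha> (t j) (t k) = (exp (2 * \<alpha> * t (min j k)) - 1) / (2 * \<alpha>)"
    proof -
      have "\<alpha> * t j + \<alpha> * t k + - \<alpha> * \<bar>t j - t k\<bar> = 2 * \<alpha> * t (min j k)"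
      proof (cases "j \<le> k")
        case True
        hence "t j \<le> t k" by (auto simp: t_def divide_right_mono)
        thus ?thesis using True by (simp add: algebra_simps min_def)
      next
        case False
        hence "t k \<le> t j" by (auto simp: t_def divide_right_mono)
        thus ?thesis using False by (simp add: algebra_simps min_def)
      qed
      hence "exp (\<alpha> * t j) * exp (\<alpha> * t k) * exp (- \<alpha> * \<bar>t j - t k\<bar>) = exp (2 * \<alpha> * t (min j k))"
        by (simp only: exp_add [symmetric])
      moreover have "exp (\<alpha> * t j) * exp (\<alpha> * t k) * exp (- \<alpha> * (t j + t k)) = 1"
        by (simp add: exp_add [symmetric] algebra_simps)
      ultimately show ?thesis unfolding ou_zero_cov_def by (simp add: right_diff_distrib)
    qed
    show ?thesis unfolding * sum_ou_clock_step by (simp add: t_def)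
  qed
  have meas: "Y k \<in> borel_measurable M" if "k < n" for k
  proof -
    have [measurable]: "U (t k) \<in> borel_measurable M"
      using C t01[OF that] unfolding centered_process_on_def by auto
    show ?thesis unfolding Y_def by measurable
  qed
  have chr: "(CLINT \<omega>|M. cis (\<Sum>k<n. c k * Y k \<omega>))
      = complex_of_real (exp (- (\<Sum>j<n. ou_clock_step \<alpha> n j * (\<Sum>k\<in>{j..<n}. c k)\<^sup>2) / 2))" for c
  proof -
    have "(CLINT \<omega>|M. cis (\<Sum>k<n. c k * Y k \<omega>)) = (CLINT \<omega>|M. cis (\<Sum>k<n. (c k * exp (\<alpha> * t k)) * U (t k) \<omega>))"
      by (simp add: Y_def mult_ac)
    also have "\<dots> = complex_of_real (exp (- (\<Sum>j<n. \<Sum>k<n. (c j * exp (\<alpha> * t j)) * (c k * exp (\<alpha> * t k))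
         * covariance M (U (t j)) (U (t k))) / 2))"
      by (rule gaussian_process_char[OF G C inj t01])
    also have "(\<Sum>j<n. \<Sum>k<n. (c j * exp (\<alpha> * t j)) * (c k * exp (\<alpha> * t k)) * covariance M (U (t j)) (U (t k)))
      = (\<Sum>j<n. \<Sum>k<n. c j * c k * (\<Sum>i\<le>min j k. ou_clock_step \<alpha> n i))"
    proof (intro sum.cong refl)
      fix j k assume "j \<in> {..<n}" "k \<in> {..<n}"
      hence jk: "j < n" "k < n" by auto
      show "(c j * exp (\<alpha> * t j)) * (c k * exp (\<alpha> * t k)) * covariance M (U (t j)) (U (t k))
        = c j * c k * (\<Sum>i\<le>min j k. ou_clock_step \<alpha> n i)"
        unfolding cov[OF t01[OF jk(2)] t01[OF jk(1)]] covY[OF jk, symmetric] by simp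
    qed
    finally show ?thesis unfolding sum_min_eq_sum_squares .
  qed
  have "expectation (\<lambda>\<omega>. exp (- (\<Sum>k<n. (w k * exp (- 2 * \<alpha> * t k)) * (Y k \<omega>)\<^sup>2) / 2))
      = 1 / sqrt (riccati_den (ou_clock_step \<alpha> n) (\<lambda>k. w k * exp (- 2 * \<alpha> * t k)) n)"
    by (rule gaussian_quadratic_laplace[OF meas chr ou_clock_step_nonneg]) (auto simp: w)
  moreover have "(w k * exp (- 2 * \<alpha> * t k)) * (Y k \<omega>)\<^sup>2 = w k * (U (t k) \<omega>)\<^sup>2" for k \<omega>
  proof -
    have "exp (- 2 * \<alpha> * t k) * (exp (\<alpha> * t k))\<^sup>2 = 1"
      by (simp add: power2_eq_square exp_add [symmetric])
    hence "w k * (exp (- 2 * \<alpha> * t k) * (exp (\<alpha> * t k))\<^sup>2) * (U (t k) \<omega>)\<^sup>2 = w k * (U (t k) \<omega>)\<^sup>2"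
      by simp
    thus ?thesis by (simp only: Y_def power_mult_distrib mult.assoc)
  qed
  ultimately show ?thesis by (simp only:)
qed

section \<open>Complex Laplace transforms\<close>

definition laplace_transform :: "'a measure \<Rightarrow> ('a \<Rightarrow> real) \<Rightarrow> complex \<Rightarrow> complex" where
  "laplace_transform M W s = (CLINT \<omega>|M. exp (- (s * complex_of_real (W \<omega>))))"

lemma norm_partial_exp_le: "norm (\<Sum>k<N. z ^ k / fact k) \<le> exp (norm (z :: complex))"
proof -
  have "norm (\<Sum>k<N. z ^ k / fact k) \<le> (\<Sum>k<N. norm z ^ k / fact k)"
    by (rule order_trans[OF norm_sum]) (simp add: norm_divide norm_power)
  also have "\<dots> = (\<Sum>k<N. norm z ^ k /\<^sub>R fact k)" by (simp add: divide_inverse mult.commute)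
  also have "\<dots> \<le> (\<Sum>k. norm z ^ k /\<^sub>R fact k)"
    by (intro sum_le_suminf summable_exp_generic) (auto simp: divide_inverse)
  also have "\<dots> = exp (norm z)" by (simp add: exp_def)
  finally show ?thesis .
qed

text \<open>Power series at \<open>s0\<close> with radius \<open>Re s0\<close>. Every partial sum of
  the exponential series, times \<open>exp (- s0 * W)\<close>, has norm at most
  \<open>exp (- Re s0 * W) * exp (norm (s - s0) * W)\<close>, hence at most 1, so dominated
  convergence exchanges series and expectation.\<close>

lemma (in prob_space) laplace_transform_holomorphic:
  assumes W [measurable]: "W \<in> borel_measurable M" and W0: "\<And>\<omega>. W \<omega> \<ge> 0"
  shows "laplace_transform M W holomorphic_on {s. Re s > 0}"
proof -
  have "laplace_transform M W field_differentiable (at s0 within {s. Re s > 0})" if s0: "Re s0 > 0" for s0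
  proof -
    define a where "a n = (CLINT \<omega>|M. exp (- (s0 * complex_of_real (W \<omega>))) * ((- complex_of_real (W \<omega>)) ^ n / fact n))" for n :: nat
    have "laplace_transform M W holomorphic_on ball s0 (Re s0)"
    proof (rule power_series_holomorphic)
      fix s assume "s \<in> ball s0 (Re s0)"
      hence s: "norm (s - s0) < Re s0" by (simp add: dist_norm norm_minus_commute)
      define g where "g k \<omega> = exp (- (s0 * complex_of_real (W \<omega>))) * ((- (s - s0) * complex_of_real (W \<omega>)) ^ k / fact k)" for k \<omega>
      have [measurable]: "g k \<in> borel_measurable M" for k
        unfolding g_def by measurable
      have bd: "exp (- (Re s0 * W \<omega>)) * exp (norm (- (s - s0) * complex_of_real (W \<omega>))) \<le> 1" for \<omega>
      proof -
        have "norm (- (s - s0) * complex_of_real (W \<omega>)) \<le> Re s0 * W \<omega>"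
          using s W0[of \<omega>] by (simp add: norm_mult norm_minus_commute mult_right_mono)
        thus ?thesis by (simp add: exp_add [symmetric])
      qed
      have pb: "norm (\<Sum>k<N. g k \<omega>) \<le> 1" for N \<omega>
      proof -
        have "norm (\<Sum>k<N. g k \<omega>) = exp (- (Re s0 * W \<omega>)) * norm (\<Sum>k<N. (- (s - s0) * complex_of_real (W \<omega>)) ^ k / fact k)"
          by (simp only: g_def sum_distrib_left [symmetric] norm_mult) simp
        also have "\<dots> \<le> exp (- (Re s0 * W \<omega>)) * exp (norm (- (s - s0) * complex_of_real (W \<omega>)))"
          by (intro mult_left_mono norm_partial_exp_le) auto
        finally show ?thesis using bd[of \<omega>] by linarith
      qed
      \<comment> \<open>A term is the difference of two consecutive partial sums, so the bound for
        these also makes each term integrable.\<close>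
      have gb: "norm (g k \<omega>) \<le> 2" for k \<omega>
      proof -
        have "g k \<omega> = (\<Sum>k<Suc k. g k \<omega>) - (\<Sum>k<k. g k \<omega>)" by simp
        also have "norm \<dots> \<le> norm (\<Sum>k<Suc k. g k \<omega>) + norm (\<Sum>k<k. g k \<omega>)" by (rule norm_triangle_ineq4)
        finally show ?thesis using pb[of \<omega> "Suc k"] pb[of \<omega> k] by linarith
      qed
      have gi: "integrable M (g k)" for k
        by (rule integrable_const_bound[where B=2]) (use gb in auto)
      have lim: "(\<lambda>N. \<Sum>k<N. g k \<omega>) \<longlonglongrightarrow> exp (- (s * complex_of_real (W \<omega>)))" for \<omega>
      proof -
        have "(\<lambda>k. (- (s - s0) * complex_of_real (W \<omega>)) ^ k /\<^sub>R fact k) sums exp (- (s - s0) * complex_of_real (W \<omega>))"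
          by (rule exp_converges)
        hence "(\<lambda>k. exp (- (s0 * complex_of_real (W \<omega>))) * ((- (s - s0) * complex_of_real (W \<omega>)) ^ k / fact k)) sums
            (exp (- (s0 * complex_of_real (W \<omega>))) * exp (- (s - s0) * complex_of_real (W \<omega>)))"
          by (intro sums_mult) (simp add: scaleR_conv_of_real divide_inverse mult.commute)
        also have "exp (- (s0 * complex_of_real (W \<omega>))) * exp (- (s - s0) * complex_of_real (W \<omega>)) = exp (- (s * complex_of_real (W \<omega>)))"
          by (simp add: exp_add [symmetric] algebra_simps)
        finally show ?thesis by (simp add: sums_def g_def)
      qed
      have "(\<lambda>N. (CLINT \<omega>|M. (\<Sum>k<N. g k \<omega>))) \<longlonglongrightarrow> laplace_transform M W s"
        unfolding laplace_transform_def
        by (rule integral_dominated_convergence[where w="\<lambda>_. 1"]) (use lim pb in auto)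
      moreover have "(CLINT \<omega>|M. (\<Sum>k<N. g k \<omega>)) = (\<Sum>k<N. a k * (s - s0) ^ k)" for N
      proof -
        have "g k \<omega> = exp (- (s0 * complex_of_real (W \<omega>))) * ((- complex_of_real (W \<omega>)) ^ k / fact k) * (s - s0) ^ k" for k \<omega>
        proof -
          have "- (s - s0) * complex_of_real (W \<omega>) = (- complex_of_real (W \<omega>)) * (s - s0)" by (simp add: algebra_simps)
          thus ?thesis by (simp only: g_def power_mult_distrib) simp
        qed
        hence "(CLINT \<omega>|M. g k \<omega>) = a k * (s - s0) ^ k" for k
          by (simp only: a_def integral_mult_left_zero)
        thus ?thesis using gi by (subst Bochner_Integration.integral_sum) auto
      qed
      ultimately show "(\<lambda>n. a n * (s - s0) ^ n) sums laplace_transform M W s"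
        by (simp add: sums_def)
    qed
    hence "laplace_transform M W field_differentiable (at s0)"
      using s0 by (auto simp: holomorphic_on_open field_differentiable_def dest: bspec)
    thus ?thesis by (rule field_differentiable_at_within)
  qed
  thus ?thesis by (auto simp: holomorphic_on_def)
qed


section \<open>Continuation of the Gaussian formula to complex arguments\<close>

lemma riccati_holomorphic:
  fixes d b :: "nat \<Rightarrow> complex"
  shows "(\<lambda>s. riccati_num d (\<lambda>k. s * b k) i) holomorphic_on A \<and> (\<lambda>s. riccati_den d (\<lambda>k. s * b k) i) holomorphic_on A"
proof (induction i)
  case (Suc i)
  hence [holomorphic_intros]: "(\<lambda>s. riccati_num d (\<lambda>k. s * b k) i) holomorphic_on A"
    "(\<lambda>s. riccati_den d (\<lambda>k. s * b k) i) holomorphic_on A" by auto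
  show ?case by (auto intro!: holomorphic_intros)
qed simp

lemma riccati_of_real:
  fixes d a :: "nat \<Rightarrow> real"
  shows "riccati_num (\<lambda>k. complex_of_real (d k)) (\<lambda>k. complex_of_real (a k)) i = complex_of_real (riccati_num d a i) \<and>
    riccati_den (\<lambda>k. complex_of_real (d k)) (\<lambda>k. complex_of_real (a k)) i = complex_of_real (riccati_den d a i)"
  by (induction i) simp_all

text \<open>Squaring removes the square root, so no branch has to be chosen and the identity says
  that a holomorphic function vanishes. It vanishes on the positive reals, which accumulate at the
  interior point 1.\<close>

lemma (in prob_space) laplace_transform_riccati:
  fixes d b :: "nat \<Rightarrow> real"
  assumes W: "W \<in> borel_measurable M" "\<And>\<omega>. W \<omega> \<ge> 0" and db: "\<And>i. d i \<ge> 0" "\<And>i. b i \<ge> 0"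
    and real: "\<And>r. r > 0 \<Longrightarrow> expectation (\<lambda>\<omega>. exp (- (r * W \<omega>))) = 1 / sqrt (riccati_den d (\<lambda>k. r * b k) n)"
    and s: "Re s > 0"
  shows "(laplace_transform M W s)\<^sup>2 * riccati_den (\<lambda>k. complex_of_real (d k)) (\<lambda>k. s * complex_of_real (b k)) n = 1"
proof -
  let ?f = "\<lambda>s. (laplace_transform M W s)\<^sup>2 * riccati_den (\<lambda>k. complex_of_real (d k)) (\<lambda>k. s * complex_of_real (b k)) n - 1"
  have "?f s = 0"
  proof (rule analytic_continuation[where f = ?f and S = "{s. Re s > 0}" and U = "complex_of_real ` {0<..}" and \<xi> = 1])
    show "?f holomorphic_on {s. Re s > 0}"
      using laplace_transform_holomorphic[OF W] riccati_holomorphic[of "\<lambda>k. complex_of_real (d k)" "\<lambda>k. complex_of_real (b k)" n]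
      by (intro holomorphic_intros) auto
    show "open {s. Re s > 0}" by (rule open_halfspace_Re_gt)
    show "connected {s. Re s > 0}" by (intro convex_connected convex_halfspace_Re_gt)
    show "(1::complex) islimpt complex_of_real ` {0<..}"
      unfolding islimpt_sequential
    proof (intro exI conjI allI)
      show "complex_of_real (1 + 1 / real (Suc n)) \<in> complex_of_real ` {0<..} - {1}" for n
        by (auto simp: complex_eq_iff intro!: imageI add_pos_nonneg)
      have "(\<lambda>n. complex_of_real (1 + 1 / real (Suc n))) \<longlonglongrightarrow> complex_of_real (1 + 0)"
        by (intro tendsto_of_real tendsto_add tendsto_const LIMSEQ_Suc lim_1_over_n)
      thus "(\<lambda>n. complex_of_real (1 + 1 / real (Suc n))) \<longlonglongrightarrow> 1" by simp
    qed
  next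
    fix z assume "z \<in> complex_of_real ` {0<..}"
    then obtain r where r: "r > 0" "z = complex_of_real r" by auto
    have "laplace_transform M W z = complex_of_real (expectation (\<lambda>\<omega>. exp (- (r * W \<omega>))))"
      unfolding laplace_transform_def integral_complex_of_real [symmetric]
      by (intro Bochner_Integration.integral_cong) (auto simp: r exp_of_real [symmetric])
    also have "\<dots> = complex_of_real (1 / sqrt (riccati_den d (\<lambda>k. r * b k) n))"
      by (simp only: real[OF r(1)])
    finally have L: "laplace_transform M W z = \<dots>" .
    have p: "riccati_den (\<lambda>k. complex_of_real (d k)) (\<lambda>k. z * complex_of_real (b k)) n = complex_of_real (riccati_den d (\<lambda>k. r * b k) n)"
      using riccati_of_real[of d "\<lambda>k. r * b k" n] by (simp add: r)
    have pos: "riccati_den d (\<lambda>k. r * b k) n \<ge> 1"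
      using riccati_nonneg[of d "\<lambda>k. r * b k" n] db r by simp
    have "(1 / sqrt (riccati_den d (\<lambda>k. r * b k) n))\<^sup>2 * riccati_den d (\<lambda>k. r * b k) n = 1"
      using pos by (simp add: power_divide)
    hence "complex_of_real ((1 / sqrt (riccati_den d (\<lambda>k. r * b k) n))\<^sup>2 * riccati_den d (\<lambda>k. r * b k) n) = 1"
      by (simp only: of_real_1)
    thus "?f z = 0" unfolding L p by (simp only: of_real_mult of_real_power) simp
  qed (use s in auto)
  thus ?thesis by simp
qed

section \<open>WKB asymptotics of the recursion\<close>

lemma exp_neg_le_quadratic:
  assumes "y \<ge> (0::real)"
  shows "exp (- y) \<le> 1 - y + y\<^sup>2"
proof -
  have "exp (- y) \<le> 1 / (1 + y)"
    using exp_ge_add_one_self[of y] assms by (simp add: exp_minus field_simps)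
  also have "\<dots> \<le> 1 - y + y\<^sup>2"
  proof -
    have "(1 - y + y\<^sup>2) * (1 + y) = 1 + y ^ 3" by (simp add: algebra_simps power2_eq_square power3_eq_cube)
    thus ?thesis using assms by (simp add: field_simps)
  qed
  finally show ?thesis .
qed

lemma exp_minus_linear_le:
  assumes "norm z \<le> (K::real)"
  shows "norm (exp z - 1 - z) \<le> exp K * (norm (z::complex))\<^sup>2"
proof -
  have "norm (exp z - (\<Sum>k\<le>1. z ^ k / fact k)) \<le> exp \<bar>Re z\<bar> * norm z ^ Suc 1 / fact 1"
    by (rule Taylor_exp)
  hence "norm (exp z - 1 - z) \<le> exp \<bar>Re z\<bar> * (norm z)\<^sup>2"
    by (simp add: diff_diff_eq power2_eq_square)
  also have "\<dots> \<le> exp K * (norm z)\<^sup>2"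
    using assms abs_Re_le_cmod[of z] by (intro mult_right_mono) auto
  finally show ?thesis .
qed

text \<open>
  \<open>|m k - 1| + C/(cR) |n k|\<close> is almost decreasing: the damping of \<open>n\<close> pays for its coupling to \<open>m\<close>.
\<close>

lemma hyperbolic_recursion_bound:
  fixes m n :: "nat \<Rightarrow> complex" and c C R h :: real
  assumes c: "c > 0" and C: "C > 0" and R: "R \<ge> 1" and N: "h = 1 / real N" "N > 0" "c * R * h \<le> 1"
    and init: "m 0 = 1" "n 0 = 1"
    and stepm: "\<And>k. k < N \<Longrightarrow> norm (m (Suc k) - m k) \<le> h * (norm (m k) / R + C * norm (n k))"
    and stepn: "\<And>k. k < N \<Longrightarrow> norm (n (Suc k)) \<le> (1 - c * R * h) * norm (n k) + h * C * norm (m k)"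
  defines "A \<equiv> 1 + C\<^sup>2 / c"
  defines "B \<equiv> (A + C / c) * exp A"
  shows "norm (m N + n N - 1) \<le> (B + (1 + C * (1 + B)) / c) / R"
proof -
  have h: "h > 0" using N by simp
  have A: "A > 0" using c C by (simp add: A_def add_pos_nonneg)
  have B: "B > 0" using c C A by (simp add: B_def add_pos_pos)
  define V where "V k = norm (m k - 1) + C / (c * R) * norm (n k)" for k
  have V_nonneg: "V k \<ge> 0" for k using c C R by (simp add: V_def)
  have m_le: "norm (m k) \<le> 1 + V k" for k
  proof -
    have "norm (m k) \<le> norm (m k - 1) + norm (1::complex)" using norm_triangle_sub[of "m k" 1] by simp
    moreover have "0 \<le> C / (c * R) * norm (n k)" using c C R by simp
    ultimately show ?thesis by (simp add: V_def)
  qed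
  have V_step: "1 + V (Suc k) \<le> (1 + h * A / R) * (1 + V k)" if "k < N" for k
  proof -
    have "norm (m (Suc k) - 1) \<le> norm (m (Suc k) - m k) + norm (m k - 1)"
      using norm_triangle_ineq[of "m (Suc k) - m k" "m k - 1"] by simp
    also have "\<dots> \<le> h * (norm (m k) / R + C * norm (n k)) + norm (m k - 1)"
      using stepm[OF that] by simp
    finally have 1: "norm (m (Suc k) - 1) \<le> h * (norm (m k) / R + C * norm (n k)) + norm (m k - 1)" .
    have 2: "C / (c * R) * norm (n (Suc k)) \<le> C / (c * R) * ((1 - c * R * h) * norm (n k) + h * C * norm (m k))"
      using stepn[OF that] c C R by (intro mult_left_mono) auto
    have "V (Suc k) \<le> h * (norm (m k) / R + C * norm (n k)) + norm (m k - 1)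
       + C / (c * R) * ((1 - c * R * h) * norm (n k) + h * C * norm (m k))"
      unfolding V_def using 1 2 by linarith
    \<comment> \<open>The terms in \<open>norm (n k)\<close> cancel, since
      \<open>C / (c * R)\<close> times the damping \<open>c * R * h\<close> is \<open>C * h\<close>.
      What is left in front of \<open>norm (m k)\<close> is
      \<open>h / R + h * C\<^sup>2 / (c * R)\<close>, the origin of \<open>A\<close>.\<close>
    also have "\<dots> = V k + h * A / R * norm (m k)"
      using c R by (simp add: V_def A_def field_simps power2_eq_square)
    also have "\<dots> \<le> V k + h * A / R * (1 + V k)"
      using m_le[of k] h A R by (intro add_left_mono mult_left_mono) auto
    finally show ?thesis by (simp add: algebra_simps)
  qed
  have V_pow: "k \<le> N \<Longrightarrow> 1 + V k \<le> (1 + h * A / R) ^ k * (1 + C / (c * R))" for k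
  proof (induction k)
    case 0
    thus ?case by (simp add: V_def init)
  next
    case (Suc k)
    have "1 + V (Suc k) \<le> (1 + h * A / R) * (1 + V k)" using V_step Suc.prems by simp
    also have "\<dots> \<le> (1 + h * A / R) * ((1 + h * A / R) ^ k * (1 + C / (c * R)))"
      using Suc h A R by (intro mult_left_mono) auto
    finally show ?case by (simp add: mult.assoc)
  qed
  have V_le: "V k \<le> B / R" if "k \<le> N" for k
  proof -
    have "(1 + h * A / R) ^ k \<le> (1 + h * A / R) ^ N"
      using that h A R by (intro power_increasing) auto
    also have "\<dots> \<le> exp (h * A / R) ^ N"
      using h A R by (intro power_mono exp_ge_add_one_self) (auto simp: add_nonneg_nonneg)
    also have "\<dots> = exp (A / R)" using N by (simp add: exp_of_nat_mult [symmetric])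
    finally have "1 + V k \<le> exp (A / R) * (1 + C / (c * R))"
      using V_pow[OF that] c C R by (elim order_trans) (intro mult_right_mono, auto)
    \<comment> \<open>The inequality e^x \<le> 1 + x e^x isolates the leading 1, so that
      \<open>V\<close> comes out of order 1/R and not merely bounded.\<close>
    also have "exp (A / R) \<le> 1 + A / R * exp (A / R)"
    proof -
      have "exp (A / R) * (1 + - (A / R)) \<le> exp (A / R) * exp (- (A / R))"
        by (intro mult_left_mono exp_ge_add_one_self) auto
      thus ?thesis by (simp add: exp_minus algebra_simps)
    qed
    hence "exp (A / R) * (1 + C / (c * R)) \<le> 1 + A / R * exp (A / R) + exp (A / R) * (C / (c * R))"
      by (simp add: algebra_simps)
    also have "\<dots> = 1 + (A + C / c) * exp (A / R) / R" using c R by (simp add: field_simps)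
    also have "\<dots> \<le> 1 + (A + C / c) * exp A / R"
      using c C A R by (intro add_left_mono divide_right_mono mult_left_mono) (auto simp: field_simps)
    finally show ?thesis by (simp add: B_def)
  qed
  have mB: "norm (m k) \<le> 1 + B" if "k \<le> N" for k
  proof -
    have "B / R \<le> B" using B R by (simp add: field_simps)
    thus ?thesis using m_le[of k] V_le[OF that] by linarith
  qed
  \<comment> \<open>The constant \<open>C * (1 + B) / (c * R)\<close> is the fixed point of the
    damped recursion with forcing \<open>h * C * (1 + B)\<close>; the initial value 1 decays
    geometrically.\<close>
  have n_le: "k \<le> N \<Longrightarrow> norm (n k) \<le> (1 - c * R * h) ^ k + C * (1 + B) / (c * R)" for k
  proof (induction k)
    case 0
    thus ?case using c C R B by (simp add: init)
  next
    case (Suc k)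
    have "norm (n (Suc k)) \<le> (1 - c * R * h) * norm (n k) + h * C * norm (m k)"
      using stepn Suc.prems by simp
    also have "\<dots> \<le> (1 - c * R * h) * ((1 - c * R * h) ^ k + C * (1 + B) / (c * R)) + h * C * (1 + B)"
      using Suc N h C mB[of k] by (intro add_mono mult_left_mono) auto
    also have "\<dots> = (1 - c * R * h) ^ Suc k + C * (1 + B) / (c * R)"
      using c R by (simp add: field_simps)
    finally show ?case .
  qed
  have "(1 - c * R * h) ^ N \<le> exp (- (c * R * h)) ^ N"
    using N exp_ge_add_one_self[of "- (c * R * h)"] by (intro power_mono) auto
  also have "\<dots> = exp (- (c * R))" using N by (simp add: exp_of_nat_mult [symmetric])
  also have "\<dots> \<le> 1 / (c * R)"
  proof -
    have "c * R \<le> exp (c * R)" using exp_ge_add_one_self[of "c * R"] by linarith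
    thus ?thesis using c R by (simp add: exp_minus field_simps)
  qed
  finally have nN: "norm (n N) \<le> 1 / (c * R) + C * (1 + B) / (c * R)" using n_le[of N] by simp
  have mN: "norm (m N - 1) \<le> B / R"
  proof -
    have "0 \<le> C / (c * R) * norm (n N)" using c C R by simp
    thus ?thesis using V_le[of N] unfolding V_def by linarith
  qed
  have "norm (m N + n N - 1) \<le> norm (m N - 1) + norm (n N)"
    using norm_triangle_ineq[of "m N - 1" "n N"] by (simp add: algebra_simps)
  also have "\<dots> \<le> B / R + (1 / (c * R) + C * (1 + B) / (c * R))" using mN nN by simp
  also have "\<dots> = (B + (1 + C * (1 + B)) / c) / R" using c R by (simp add: field_simps)
  finally show ?thesis .
qed

text \<open>With \<open>k = norm \<kappa>\<close>, the summands bound, in this order, the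
  perturbations \<open>t1\<close> to \<open>t5\<close> of one step and the quadratic remainder of
  the exponential, all in units of \<open>h\<^sup>2\<close>.\<close>

definition wkb_const :: "real \<Rightarrow> real \<Rightarrow> real" where
  "wkb_const C k = C + k * C + k * C\<^sup>2 + k * C\<^sup>2 + 2 * k\<^sup>2 * C\<^sup>2 + exp (k * C) * (k * C)\<^sup>2"

lemma norm_sum5_le: "norm (a + b + c + d + e) \<le> norm a + norm b + norm c + norm d + norm (e :: 'b :: real_normed_vector)"
  using norm_triangle_ineq[of "a + b + c + d" e] norm_triangle_ineq[of "a + b + c" d]
    norm_triangle_ineq[of "a + b" c] norm_triangle_ineq[of a b] by linarith

text \<open>One step in the basis of modes, divided by the growth factor
  \<open>exp (\<kappa> * y)\<close>; \<open>r\<close> and \<open>\<rho>\<close> are ratios of the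
  amplitude at the two ends. The diagonal entries contain \<open>\<rho> + r\<close>, which is 2 up
  to order \<open>h\<^sup>2\<close>; the others contain \<open>\<rho> - r\<close>, of order
  \<open>h\<close>. So the coupling is \<open>C * h\<close> without \<open>\<kappa>\<close>, and the
  dependence of the errors on \<open>\<kappa>\<close> sits at order
  \<open>h\<^sup>2\<close>.\<close>

lemma wkb_step_coefficients:
  fixes \<kappa> :: complex and y \<delta> \<beta> r \<rho> C h :: real
  assumes \<kappa>: "Re \<kappa> \<ge> 0" and C: "C \<ge> 1" and h: "0 < h" "h \<le> 1"
    and y: "0 \<le> y" "y \<le> C * h" and \<delta>: "\<bar>\<delta> - y\<bar> \<le> C * h\<^sup>2" and \<beta>: "\<bar>\<beta> - y\<bar> \<le> C * h\<^sup>2"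
    and r: "0 \<le> r" "r \<le> C" "\<bar>r - 1\<bar> \<le> C * h" and \<rho>: "\<bar>\<rho> - r\<bar> \<le> 2 * C * h" "\<bar>\<rho> + r - 2\<bar> \<le> 2 * C * h\<^sup>2"
  defines "E \<equiv> exp (- (\<kappa> * of_real y))" and "K \<equiv> wkb_const C (norm \<kappa>)"
    and "T \<equiv> \<kappa>\<^sup>2 * of_real \<beta> * of_real \<delta>"
  shows "norm (E * ((of_real \<rho> + of_real r + \<kappa> * of_real \<delta> + \<kappa> * of_real \<beta> * of_real r + T) / 2) - 1) \<le> K * h\<^sup>2"
    and "norm (E * ((of_real \<rho> - of_real r + \<kappa> * of_real \<delta> - \<kappa> * of_real \<beta> * of_real r + T) / 2)) \<le> C * h + K * h\<^sup>2"
    and "norm (E * ((of_real \<rho> - of_real r - \<kappa> * of_real \<delta> + \<kappa> * of_real \<beta> * of_real r + T) / 2)) \<le> C * h + K * h\<^sup>2"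
    and "norm (E * ((of_real \<rho> + of_real r - \<kappa> * of_real \<delta> - \<kappa> * of_real \<beta> * of_real r + T) / 2))
        \<le> exp (- (2 * Re \<kappa> * y)) + K * h\<^sup>2"
proof -
  define k where "k = norm \<kappa>"
  have k: "k \<ge> 0" by (simp add: k_def)
  define z where "z = \<kappa> * complex_of_real y"
  define t1 where "t1 = complex_of_real (\<rho> + r - 2) / 2"
  define t2 where "t2 = \<kappa> * complex_of_real ((\<delta> - y) / 2)"
  define t3 where "t3 = \<kappa> * complex_of_real ((\<beta> - y) * r / 2)"
  define t4 where "t4 = \<kappa> * complex_of_real (y * (r - 1) / 2)"
  define t5 where "t5 = T / 2"
  define l where "l = complex_of_real (\<rho> - r) / 2"
  have t1: "norm t1 \<le> C * h\<^sup>2" using \<rho>(2) by (simp add: t1_def norm_divide del: of_real_add of_real_diff of_real_divide of_real_numeral)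
  have t2: "norm t2 \<le> k * C * h\<^sup>2"
  proof -
    have "\<bar>(\<delta> - y) / 2\<bar> \<le> C * h\<^sup>2" using \<delta> by simp
    thus ?thesis unfolding t2_def norm_mult norm_of_real k_def [symmetric] mult.assoc
      by (intro mult_left_mono k)
  qed
  have t3: "norm t3 \<le> k * C\<^sup>2 * h\<^sup>2"
  proof -
    have "\<bar>(\<beta> - y) * r / 2\<bar> \<le> \<bar>\<beta> - y\<bar> * r" using r by (simp add: abs_mult)
    also have "\<dots> \<le> (C * h\<^sup>2) * C" using \<beta> r C by (intro mult_mono) auto
    finally have "\<bar>(\<beta> - y) * r / 2\<bar> \<le> C\<^sup>2 * h\<^sup>2" by (simp add: power2_eq_square mult_ac)
    thus ?thesis unfolding t3_def norm_mult norm_of_real k_def [symmetric] mult.assoc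
      by (intro mult_left_mono k)
  qed
  have t4: "norm t4 \<le> k * C\<^sup>2 * h\<^sup>2"
  proof -
    have "\<bar>y * (r - 1) / 2\<bar> \<le> y * \<bar>r - 1\<bar>" using y by (simp add: abs_mult)
    also have "\<dots> \<le> (C * h) * (C * h)" using y r C h by (intro mult_mono) auto
    finally have "\<bar>y * (r - 1) / 2\<bar> \<le> C\<^sup>2 * h\<^sup>2" by (simp add: power2_eq_square mult_ac)
    thus ?thesis unfolding t4_def norm_mult norm_of_real k_def [symmetric] mult.assoc
      by (intro mult_left_mono k)
  qed
  have h2: "h\<^sup>2 \<le> h" using h by (simp add: power2_eq_square mult_left_le_one_le)
  have Ch2: "C * h\<^sup>2 \<le> C * h" using h2 C by simp
  have \<beta>2: "\<bar>\<beta>\<bar> \<le> 2 * C * h" and \<delta>2: "\<bar>\<delta>\<bar> \<le> 2 * C * h" using \<beta> \<delta> y Ch2 by linarith+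
  have t5: "norm t5 \<le> 2 * k\<^sup>2 * C\<^sup>2 * h\<^sup>2"
  proof -
    have "norm t5 = k\<^sup>2 * (\<bar>\<beta>\<bar> * \<bar>\<delta>\<bar>) / 2" by (simp add: t5_def T_def norm_mult norm_divide norm_power k_def)
    also have "\<dots> \<le> k\<^sup>2 * ((2 * C * h) * (2 * C * h)) / 2"
      using \<beta>2 \<delta>2 C h by (intro divide_right_mono mult_left_mono mult_mono) auto
    finally show ?thesis by (simp add: power2_eq_square mult_ac)
  qed
  have l: "norm l \<le> C * h" using \<rho>(1) by (simp add: l_def norm_divide del: of_real_add of_real_diff of_real_divide of_real_numeral)
  have E1: "norm E \<le> 1" using \<kappa> y by (simp add: E_def)
  have z: "norm z \<le> k * C"
  proof -
    have "y \<le> C" using y(2) mult_left_mono[of h 1 C] C h by linarith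
    thus ?thesis unfolding z_def using y by (simp add: norm_mult k_def mult_left_mono)
  qed
  have zh: "(norm z)\<^sup>2 \<le> (k * C)\<^sup>2 * h\<^sup>2"
  proof -
    have "norm z \<le> k * C * h" unfolding z_def using y by (simp add: norm_mult k_def mult_left_mono mult.assoc)
    hence "(norm z)\<^sup>2 \<le> (k * C * h)\<^sup>2" by (intro power_mono) auto
    thus ?thesis by (simp add: power_mult_distrib)
  qed
  define K1 where "K1 = C + k * C + k * C\<^sup>2 + k * C\<^sup>2 + 2 * k\<^sup>2 * C\<^sup>2"
  have K: "K = K1 + exp (k * C) * (k * C)\<^sup>2" by (simp add: K_def wkb_const_def K1_def k_def)
  have ts: "norm t1 + norm t2 + norm t3 + norm t4 + norm t5 \<le> K1 * h\<^sup>2"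
    using t1 t2 t3 t4 t5 unfolding K1_def distrib_right by linarith
  have e: "norm (exp w - 1 - w) \<le> (K - K1) * h\<^sup>2" if "norm w = norm z" for w :: complex
  proof -
    have "norm (exp w - 1 - w) \<le> exp (k * C) * (norm z)\<^sup>2"
      using exp_minus_linear_le[of w "k * C"] z that by simp
    also have "\<dots> \<le> exp (k * C) * ((k * C)\<^sup>2 * h\<^sup>2)" using zh by (intro mult_left_mono) auto
    finally show ?thesis by (simp add: K)
  qed
  have half_eqI: "x / 2 = w" if "x = 2 * w" for x w :: complex using that by simp
  have tu: "t1 * 2 = of_real \<rho> + of_real r - 2" "t2 * 2 = \<kappa> * of_real \<delta> - \<kappa> * of_real y"
      "t3 * 2 = \<kappa> * of_real \<beta> * of_real r - \<kappa> * of_real y * of_real r"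
      "t4 * 2 = \<kappa> * of_real y * of_real r - \<kappa> * of_real y" "t5 * 2 = T" "l * 2 = of_real \<rho> - of_real r"
    by (simp_all add: t1_def t2_def t3_def t4_def t5_def l_def field_simps)
  have EM: "norm (E * x) \<le> norm x" for x :: complex
    using mult_right_mono[OF E1, of "norm x"] by (simp add: norm_mult)
  have K1K: "K1 * h\<^sup>2 \<le> K * h\<^sup>2" by (simp add: K distrib_right)
  have Ez: "E * exp z = 1" by (simp add: E_def z_def exp_add [symmetric])
  have 1: "(of_real \<rho> + of_real r + \<kappa> * of_real \<delta> + \<kappa> * of_real \<beta> * of_real r + T) / 2 = 1 + z + (t1 + t2 + t3 + t4 + t5)"
    by (rule half_eqI) (simp add: ring_distribs tu z_def algebra_simps)
  \<comment> \<open>\<open>1 + z\<close> is \<open>exp z\<close>, the inverse of \<open>E\<close>,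
    up to the quadratic remainder of the exponential.\<close>
  have "E * (1 + z + (t1 + t2 + t3 + t4 + t5)) - 1 = E * ((t1 + t2 + t3 + t4 + t5) - (exp z - 1 - z))"
    using Ez by (simp add: algebra_simps)
  also have "norm \<dots> \<le> norm ((t1 + t2 + t3 + t4 + t5) - (exp z - 1 - z))" by (rule EM)
  also have "\<dots> \<le> norm (t1 + t2 + t3 + t4 + t5) + norm (exp z - 1 - z)" by (rule norm_triangle_ineq4)
  also have "\<dots> \<le> K1 * h\<^sup>2 + (K - K1) * h\<^sup>2"
    using ts e[of z] norm_sum5_le[of t1 t2 t3 t4 t5] by simp
  finally show "norm (E * ((of_real \<rho> + of_real r + \<kappa> * of_real \<delta> + \<kappa> * of_real \<beta> * of_real r + T) / 2) - 1) \<le> K * h\<^sup>2"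
    unfolding 1 by (simp add: algebra_simps)
  have 2: "(of_real \<rho> - of_real r + \<kappa> * of_real \<delta> - \<kappa> * of_real \<beta> * of_real r + T) / 2 = l + (t2 - t3 - t4 + t5)"
    by (rule half_eqI) (simp add: ring_distribs tu z_def algebra_simps)
  have "norm (l + (t2 - t3 - t4 + t5)) \<le> C * h + K * h\<^sup>2"
  proof -
    have "l + (t2 - t3 - t4 + t5) = l + t2 + - t3 + - t4 + t5" by simp
    thus ?thesis using l ts K1K norm_sum5_le[of l t2 "- t3" "- t4" t5, unfolded norm_minus_cancel] norm_ge_zero[of t1]
      by (simp only:)
  qed
  thus "norm (E * ((of_real \<rho> - of_real r + \<kappa> * of_real \<delta> - \<kappa> * of_real \<beta> * of_real r + T) / 2)) \<le> C * h + K * h\<^sup>2"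
    unfolding 2 using EM order_trans by blast
  have 3: "(of_real \<rho> - of_real r - \<kappa> * of_real \<delta> + \<kappa> * of_real \<beta> * of_real r + T) / 2 = l + (t3 - t2 + t4 + t5)"
    by (rule half_eqI) (simp add: ring_distribs tu z_def algebra_simps)
  have "norm (l + (t3 - t2 + t4 + t5)) \<le> C * h + K * h\<^sup>2"
  proof -
    have "l + (t3 - t2 + t4 + t5) = l + t3 + - t2 + t4 + t5" by simp
    thus ?thesis using l ts K1K norm_sum5_le[of l t3 "- t2" t4 t5, unfolded norm_minus_cancel] norm_ge_zero[of t1]
      by (simp only:)
  qed
  thus "norm (E * ((of_real \<rho> - of_real r - \<kappa> * of_real \<delta> + \<kappa> * of_real \<beta> * of_real r + T) / 2)) \<le> C * h + K * h\<^sup>2"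
    unfolding 3 using EM order_trans by blast
  have 4: "(of_real \<rho> + of_real r - \<kappa> * of_real \<delta> - \<kappa> * of_real \<beta> * of_real r + T) / 2
      = exp (- z) + ((t1 - t2 - t3 - t4 + t5) - (exp (- z) - 1 - - z))"
    by (rule half_eqI) (simp add: ring_distribs tu z_def algebra_simps)
  have "norm (E * (exp (- z) + ((t1 - t2 - t3 - t4 + t5) - (exp (- z) - 1 - - z))))
      \<le> norm (E * exp (- z)) + norm (E * ((t1 - t2 - t3 - t4 + t5) - (exp (- z) - 1 - - z)))"
    unfolding distrib_left by (rule norm_triangle_ineq)
  also have "\<dots> \<le> exp (- (2 * Re \<kappa> * y)) + (K1 * h\<^sup>2 + (K - K1) * h\<^sup>2)"
  proof (intro add_mono)
    show "norm (E * exp (- z)) \<le> exp (- (2 * Re \<kappa> * y))"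
      by (simp add: E_def z_def norm_mult exp_add [symmetric])
    have "norm ((t1 - t2 - t3 - t4 + t5) - (exp (- z) - 1 - - z)) \<le> K1 * h\<^sup>2 + (K - K1) * h\<^sup>2"
      using ts e[of "- z"] norm_sum5_le[of t1 "- t2" "- t3" "- t4" t5]
        norm_triangle_ineq4[of "t1 - t2 - t3 - t4 + t5" "exp (- z) - 1 - - z"] by simp
    thus "norm (E * ((t1 - t2 - t3 - t4 + t5) - (exp (- z) - 1 - - z))) \<le> K1 * h\<^sup>2 + (K - K1) * h\<^sup>2"
      using EM order_trans by blast
  qed
  finally show "norm (E * ((of_real \<rho> + of_real r - \<kappa> * of_real \<delta> - \<kappa> * of_real \<beta> * of_real r + T) / 2))
        \<le> exp (- (2 * Re \<kappa> * y)) + K * h\<^sup>2"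
    unfolding 4 by (simp add: algebra_simps)
qed

text \<open>The hypotheses of \<open>wkb_step_coefficients\<close> for a step from \<open>x\<close>
  to \<open>x + h\<close>, with one constant for all positions and meshes. The quantities are, in
  that lemma's notation, \<open>y\<close>, \<open>\<delta>\<close> (clock increment over both
  amplitudes), \<open>\<beta>\<close>, \<open>r\<close> and \<open>\<rho>\<close>.\<close>

definition grid_step_bounds :: "real \<Rightarrow> (real \<Rightarrow> real) \<Rightarrow> (real \<Rightarrow> real) \<Rightarrow> real \<Rightarrow> bool" where
  "grid_step_bounds \<alpha> g \<omega> C \<longleftrightarrow> C \<ge> 1 \<and> (\<forall>x h. 0 \<le> x \<longrightarrow> 0 < h \<longrightarrow> x + h \<le> 1 \<longrightarrow>
     h * \<omega> x \<le> C * h \<and>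
     \<bar>(exp (2 * \<alpha> * (x + h)) - exp (2 * \<alpha> * x)) / (2 * \<alpha>) / (g x * g (x + h)) - h * \<omega> x\<bar> \<le> C * h\<^sup>2 \<and>
     \<bar>h * \<omega> (x + h) - h * \<omega> x\<bar> \<le> C * h\<^sup>2 \<and>
     g x / g (x + h) \<le> C \<and> \<bar>g x / g (x + h) - 1\<bar> \<le> C * h \<and>
     \<bar>g (x + h) / g x - g x / g (x + h)\<bar> \<le> 2 * C * h \<and>
     \<bar>g (x + h) / g x + g x / g (x + h) - 2\<bar> \<le> 2 * C * h\<^sup>2)"

lemma exp_increment_bound:
  fixes \<alpha> x h :: real
  assumes "\<alpha> \<noteq> 0" "0 \<le> x" "x \<le> 1" "0 \<le> h" "h \<le> 1"
  shows "\<bar>(exp (2 * \<alpha> * (x + h)) - exp (2 * \<alpha> * x)) / (2 * \<alpha>) - h * exp (2 * \<alpha> * x)\<bar>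
    \<le> 2 * \<bar>\<alpha>\<bar> * exp (4 * \<bar>\<alpha>\<bar>) * h\<^sup>2"
proof -
  define u where "u = 2 * \<alpha> * h"
  have u: "\<bar>u\<bar> \<le> 2 * \<bar>\<alpha>\<bar>" using assms by (simp add: u_def abs_mult mult_left_le)
  have "norm (exp (complex_of_real u) - 1 - complex_of_real u) \<le> exp (2 * \<bar>\<alpha>\<bar>) * (norm (complex_of_real u))\<^sup>2"
    using u by (intro exp_minus_linear_le) simp
  also have "exp (complex_of_real u) - 1 - complex_of_real u = complex_of_real (exp u - 1 - u)"
    by (simp add: exp_of_real)
  finally have 1: "\<bar>exp u - 1 - u\<bar> \<le> exp (2 * \<bar>\<alpha>\<bar>) * u\<^sup>2" unfolding norm_of_real by simp
  have 2: "exp (2 * \<alpha> * x) \<le> exp (2 * \<bar>\<alpha>\<bar>)"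
  proof -
    have "\<alpha> * x \<le> \<bar>\<alpha>\<bar> * x" using assms by (intro mult_right_mono) auto
    also have "\<dots> \<le> \<bar>\<alpha>\<bar>" using assms by (intro mult_left_le) auto
    finally show ?thesis by simp
  qed
  have "(exp (2 * \<alpha> * (x + h)) - exp (2 * \<alpha> * x)) / (2 * \<alpha>) - h * exp (2 * \<alpha> * x)
      = exp (2 * \<alpha> * x) * (exp u - 1 - u) / (2 * \<alpha>)"
    using assms(1) by (simp add: u_def field_simps exp_add [symmetric])
  also have "\<bar>\<dots>\<bar> = exp (2 * \<alpha> * x) * \<bar>exp u - 1 - u\<bar> / (2 * \<bar>\<alpha>\<bar>)"
    by (simp add: abs_mult)
  also have "\<dots> \<le> exp (2 * \<bar>\<alpha>\<bar>) * (exp (2 * \<bar>\<alpha>\<bar>) * u\<^sup>2) / (2 * \<bar>\<alpha>\<bar>)"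
    using 1 2 by (intro divide_right_mono mult_mono) auto
  also have "\<dots> = exp (2 * \<bar>\<alpha>\<bar>) * exp (2 * \<bar>\<alpha>\<bar>) * (u\<^sup>2 / (2 * \<bar>\<alpha>\<bar>))" by simp
  also have "u\<^sup>2 / (2 * \<bar>\<alpha>\<bar>) = 2 * \<bar>\<alpha>\<bar> * h\<^sup>2"
    using assms(1) by (simp add: u_def power_mult_distrib field_simps) (simp add: power2_eq_square)
  also have "exp (2 * \<bar>\<alpha>\<bar>) * exp (2 * \<bar>\<alpha>\<bar>) = exp (4 * \<bar>\<alpha>\<bar>)" by (simp add: exp_add [symmetric])
  finally show ?thesis by (simp add: mult_ac)
qed

text \<open>The relation between \<open>\<omega>\<close> and \<open>g\<close> is the WKB condition:
  it makes the clock increment divided by \<open>g x * g (x + h)\<close> agree with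
  \<open>h * \<omega> x\<close> to first order, so that both equations of the system get the same
  rate. The rest is Lipschitz continuity.\<close>

lemma lipschitz_grid_step_bounds:
  fixes g \<omega> :: "real \<Rightarrow> real"
  assumes \<alpha>: "\<alpha> \<noteq> 0" and g0: "g0 > 0" and g: "\<And>x. x \<in> {0..1} \<Longrightarrow> g0 \<le> g x \<and> g x \<le> G"
    and \<omega>: "\<And>x. x \<in> {0..1} \<Longrightarrow> 0 \<le> \<omega> x \<and> \<omega> x \<le> Wm" and rel: "\<And>x. x \<in> {0..1} \<Longrightarrow> \<omega> x * (g x)\<^sup>2 = exp (2 * \<alpha> * x)"
    and Lg: "\<And>x y. x \<in> {0..1} \<Longrightarrow> y \<in> {0..1} \<Longrightarrow> \<bar>g x - g y\<bar> \<le> Lg * \<bar>x - y\<bar>"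
    and L\<omega>: "\<And>x y. x \<in> {0..1} \<Longrightarrow> y \<in> {0..1} \<Longrightarrow> \<bar>\<omega> x - \<omega> y\<bar> \<le> L\<omega> * \<bar>x - y\<bar>"
  shows "\<exists>C. grid_step_bounds \<alpha> g \<omega> C"
proof -
  define c1 where "c1 = Lg / g0"
  define c2 where "c2 = 2 * \<bar>\<alpha>\<bar> * exp (4 * \<bar>\<alpha>\<bar>) / g0\<^sup>2"
  define c3 where "c3 = Wm * c1"
  have Lg0: "Lg \<ge> 0" using Lg[of 0 1] by simp
  have L\<omega>0: "L\<omega> \<ge> 0" using L\<omega>[of 0 1] by simp
  have W0: "Wm \<ge> 0" using \<omega>[of 0] by simp
  have G0: "G \<ge> 0" using g[of 0] g0 by simp
  have c: "c1 \<ge> 0" "c2 \<ge> 0" "c3 \<ge> 0" using Lg0 W0 g0 by (auto simp: c1_def c2_def c3_def)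
  define C where "C = 1 + Wm + (c2 + c3) + L\<omega> + G / g0 + c1 + c1\<^sup>2"
  have Cge: "1 \<le> C" "Wm \<le> C" "c2 + c3 \<le> C" "L\<omega> \<le> C" "G / g0 \<le> C" "c1 \<le> C" "c1\<^sup>2 \<le> C"
    using c L\<omega>0 W0 divide_nonneg_pos[OF G0 g0] zero_le_power2[of c1] unfolding C_def by linarith+
  have "h * \<omega> x \<le> C * h \<and>
     \<bar>(exp (2 * \<alpha> * (x + h)) - exp (2 * \<alpha> * x)) / (2 * \<alpha>) / (g x * g (x + h)) - h * \<omega> x\<bar> \<le> C * h\<^sup>2 \<and>
     \<bar>h * \<omega> (x + h) - h * \<omega> x\<bar> \<le> C * h\<^sup>2 \<and>
     g x / g (x + h) \<le> C \<and> \<bar>g x / g (x + h) - 1\<bar> \<le> C * h \<and>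
     \<bar>g (x + h) / g x - g x / g (x + h)\<bar> \<le> 2 * C * h \<and>
     \<bar>g (x + h) / g x + g x / g (x + h) - 2\<bar> \<le> 2 * C * h\<^sup>2" if xh: "0 \<le> x" "0 < h" "x + h \<le> 1" for x h
  proof -
    have x: "x \<in> {0..1}" and x': "x + h \<in> {0..1}" using xh by auto
    define g1 where "g1 = g x"
    define g2 where "g2 = g (x + h)"
    have gp: "g1 \<ge> g0" "g2 \<ge> g0" "g1 \<le> G" "g1 > 0" "g2 > 0" using g[OF x] g[OF x'] g0 by (auto simp: g1_def g2_def)
    have dg: "\<bar>g1 - g2\<bar> \<le> Lg * h" using Lg[OF x x'] xh by (simp add: g1_def g2_def)
    have q: "\<bar>g1 - g2\<bar> / v \<le> c1 * h" if "v \<ge> g0" for v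
    proof -
      have "\<bar>g1 - g2\<bar> / v \<le> Lg * h / g0" using dg that g0 by (intro frac_le) auto
      thus ?thesis by (simp add: c1_def)
    qed
    have 1: "h * \<omega> x \<le> C * h" using \<omega>[OF x] Cge xh by (simp add: mult.commute)
    have r1: "\<bar>g1 / g2 - 1\<bar> \<le> c1 * h"
      using q[OF gp(2)] gp by (simp add: field_simps abs_if split: if_splits)
    have r2: "\<bar>g2 / g1 - 1\<bar> \<le> c1 * h"
      using q[OF gp(1)] gp by (simp add: field_simps abs_if split: if_splits)
    have c1h: "c1 * h \<le> C * h" using Cge xh by (intro mult_right_mono) auto
    have 4: "g1 / g2 \<le> C"
    proof -
      have "g1 / g2 \<le> G / g0" using gp g0 by (intro frac_le) auto
      thus ?thesis using Cge by linarith
    qed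
    have 7: "\<bar>g2 / g1 + g1 / g2 - 2\<bar> \<le> 2 * C * h\<^sup>2"
    proof -
      \<comment> \<open>A ratio plus its inverse minus 2 is a square divided by the product, hence
        of second order, although each ratio is only first-order close to 1.\<close>
      have e: "g2 / g1 + g1 / g2 - 2 = (\<bar>g1 - g2\<bar> / g1) * (\<bar>g1 - g2\<bar> / g2)"
        using gp by (simp add: field_simps power2_eq_square)
      have "\<bar>g2 / g1 + g1 / g2 - 2\<bar> = (\<bar>g1 - g2\<bar> / g1) * (\<bar>g1 - g2\<bar> / g2)" unfolding e using gp by (simp add: abs_mult)
      also have "\<dots> \<le> (c1 * h) * (c1 * h)" using q gp c xh by (intro mult_mono) auto
      also have "\<dots> = c1\<^sup>2 * h\<^sup>2" by (simp add: power2_eq_square)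
      also have "\<dots> \<le> (2 * C) * h\<^sup>2" using Cge by (intro mult_right_mono) auto
      finally show ?thesis .
    qed
    have 3: "\<bar>h * \<omega> (x + h) - h * \<omega> x\<bar> \<le> C * h\<^sup>2"
    proof -
      have "\<bar>h * \<omega> (x + h) - h * \<omega> x\<bar> = h * \<bar>\<omega> (x + h) - \<omega> x\<bar>"
        unfolding right_diff_distrib [symmetric] abs_mult using xh by simp
      also have "\<dots> \<le> h * (L\<omega> * h)" using L\<omega>[OF x' x] xh by (intro mult_left_mono) auto
      also have "\<dots> \<le> h * (C * h)" using Cge xh by (intro mult_left_mono mult_right_mono) auto
      finally show ?thesis by (simp add: power2_eq_square mult_ac)
    qed
    have 2: "\<bar>(exp (2 * \<alpha> * (x + h)) - exp (2 * \<alpha> * x)) / (2 * \<alpha>) / (g1 * g2) - h * \<omega> x\<bar> \<le> C * h\<^sup>2"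
    proof -
      define d where "d = (exp (2 * \<alpha> * (x + h)) - exp (2 * \<alpha> * x)) / (2 * \<alpha>)"
      have d: "\<bar>d - h * exp (2 * \<alpha> * x)\<bar> \<le> 2 * \<bar>\<alpha>\<bar> * exp (4 * \<bar>\<alpha>\<bar>) * h\<^sup>2"
        unfolding d_def using xh by (intro exp_increment_bound \<alpha>) auto
      have e: "exp (2 * \<alpha> * x) = \<omega> x * g1\<^sup>2" using rel[OF x] by (simp add: g1_def)
      \<comment> \<open>The first summand compares the clock increment with its tangent; the second
        is the cost of having \<open>g1 * g2\<close> in place of \<open>g1\<^sup>2\<close>.\<close>
      have "d / (g1 * g2) - h * \<omega> x = (d - h * exp (2 * \<alpha> * x)) / (g1 * g2) + h * \<omega> x * ((g1 - g2) / g2)"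
        unfolding e using gp by (simp add: field_simps power2_eq_square)
      also have "\<bar>\<dots>\<bar> \<le> \<bar>(d - h * exp (2 * \<alpha> * x)) / (g1 * g2)\<bar> + \<bar>h * \<omega> x * ((g1 - g2) / g2)\<bar>"
        by (rule abs_triangle_ineq)
      also have "\<bar>(d - h * exp (2 * \<alpha> * x)) / (g1 * g2)\<bar> \<le> (2 * \<bar>\<alpha>\<bar> * exp (4 * \<bar>\<alpha>\<bar>) * h\<^sup>2) / (g0 * g0)"
        unfolding abs_divide using d gp g0 by (intro frac_le) (auto simp: abs_mult intro!: mult_mono)
      also have "\<bar>h * \<omega> x * ((g1 - g2) / g2)\<bar> = h * \<omega> x * (\<bar>g1 - g2\<bar> / g2)"
        using \<omega>[OF x] xh gp by (simp add: abs_mult)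
      also have "\<dots> \<le> h * Wm * (c1 * h)"
        using \<omega>[OF x] xh q[OF gp(2)] gp W0 by (intro mult_mono) auto
      also have "(2 * \<bar>\<alpha>\<bar> * exp (4 * \<bar>\<alpha>\<bar>) * h\<^sup>2) / (g0 * g0) + h * Wm * (c1 * h) = (c2 + c3) * h\<^sup>2"
        by (simp add: c2_def c3_def power2_eq_square algebra_simps)
      also have "\<dots> \<le> C * h\<^sup>2" using Cge by (intro mult_right_mono) auto
      finally show ?thesis by (simp add: d_def)
    qed
    show ?thesis using 1 2 3 4 7 r1 r2 c1h unfolding g1_def [symmetric] g2_def [symmetric]
      by (intro conjI) linarith+
  qed
  thus ?thesis using Cge(1) unfolding grid_step_bounds_def by blast
qed

text \<open>
  The growing and the decaying WKB mode are \<open>p g/\<kappa> + q/g\<close> and \<open>p g/\<kappa> - q/g\<close>; divided by the growth factor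
  \<open>exp(\<kappa>\<integral>\<omega>)\<close> they become the sequences of \<open>hyperbolic_recursion_bound\<close>.
\<close>

lemma riccati_wkb:
  fixes g \<omega> :: "real \<Rightarrow> real" and \<alpha> C \<omega>0 :: real
  assumes G: "grid_step_bounds \<alpha> g \<omega> C" and \<omega>0: "\<omega>0 > 0" "\<And>x. x \<in> {0..1} \<Longrightarrow> \<omega>0 \<le> \<omega> x"
    and g: "\<And>x. x \<in> {0..1} \<Longrightarrow> g x > 0"
  obtains B where "\<And>\<kappa>. Re \<kappa> \<ge> 1 \<Longrightarrow> \<forall>\<^sub>F N in sequentially.
    norm (2 * riccati_den (\<lambda>k. complex_of_real (ou_clock_step \<alpha> N k))
       (\<lambda>k. \<kappa>\<^sup>2 * complex_of_real (\<omega> (real (Suc k) / real N) / (g (real (Suc k) / real N))\<^sup>2 / real N)) N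
       * complex_of_real (g 1 / g 0) * exp (- (\<kappa> * complex_of_real (\<Sum>k<N. \<omega> (real k / real N) / real N))) - 1) \<le> B / Re \<kappa>"
proof
  \<comment> \<open>The constants of \<open>hyperbolic_recursion_bound\<close> for damping
    \<open>\<omega>0\<close> and coupling \<open>2 * C\<close>. They are fixed before
    \<open>\<kappa>\<close> is introduced, which is the uniformity in
    \<open>\<kappa>\<close>.\<close>
  define A where "A = 1 + (2 * C)\<^sup>2 / \<omega>0"
  define B0 where "B0 = (A + (2 * C) / \<omega>0) * exp A"
  fix \<kappa> :: complex assume \<kappa>: "Re \<kappa> \<ge> 1"
  define R where "R = Re \<kappa>"
  have R: "R \<ge> 1" using \<kappa> by (simp add: R_def)
  have C: "C \<ge> 1" using G by (simp add: grid_step_bounds_def)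
  define K where "K = wkb_const C (norm \<kappa>)"
  have K: "K \<ge> 0" using C by (simp add: K_def wkb_const_def)
  \<comment> \<open>One mesh threshold for each of \<open>h1\<close> to \<open>h4\<close>: the
    diagonal error stays below \<open>h / R\<close>; the error in the coupling is absorbed by
    doubling \<open>C\<close>; the quadratic terms eat at most half of the damping; the damping
    factor stays nonnegative. These thresholds may depend on \<open>\<kappa>\<close>.\<close>
  define \<eta> where "\<eta> = min (min (1 / (R * (K + 1))) (C / (K + 1))) (min (R * \<omega>0 / (4 * R\<^sup>2 * \<omega>0\<^sup>2 + K + 1)) (1 / (\<omega>0 * R)))"
  have \<eta>: "\<eta> > 0" using R K C \<omega>0 by (auto simp: \<eta>_def intro!: divide_pos_pos add_nonneg_pos)
  have "(\<lambda>N. 1 / real N) \<longlonglongrightarrow> 0" by (rule lim_1_over_n)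
  hence "\<forall>\<^sub>F N in sequentially. 1 / real N < \<eta>" using \<eta> by (rule order_tendstoD)
  thus "\<forall>\<^sub>F N in sequentially.
    norm (2 * riccati_den (\<lambda>k. complex_of_real (ou_clock_step \<alpha> N k))
       (\<lambda>k. \<kappa>\<^sup>2 * complex_of_real (\<omega> (real (Suc k) / real N) / (g (real (Suc k) / real N))\<^sup>2 / real N)) N
       * complex_of_real (g 1 / g 0) * exp (- (\<kappa> * complex_of_real (\<Sum>k<N. \<omega> (real k / real N) / real N))) - 1)
      \<le> (B0 + (1 + (2 * C) * (1 + B0)) / \<omega>0) / Re \<kappa>"
    using eventually_gt_at_top[of 0]
  proof eventually_elim
    fix N :: nat assume hN: "1 / real N < \<eta>" and N: "0 < N"
    define h where "h = 1 / real N"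
    have h: "0 < h" "h \<le> 1" using N by (auto simp: h_def)
    have h\<eta>: "h < \<eta>" using hN by (simp add: h_def)
    have h1: "K * h \<le> 1 / R"
    proof -
      have "h \<le> 1 / (R * (K + 1))" using h\<eta> by (simp add: \<eta>_def)
      moreover have "R * (K + 1) > 0" using R K by simp
      ultimately have "(K + 1) * h * R \<le> 1" by (simp add: pos_le_divide_eq mult_ac)
      hence "(K + 1) * h \<le> 1 / R" using R by (simp add: pos_le_divide_eq)
      thus ?thesis using h by (simp add: distrib_right)
    qed
    have h2: "K * h \<le> C"
    proof -
      have "h \<le> C / (K + 1)" using h\<eta> by (simp add: \<eta>_def)
      hence "(K + 1) * h \<le> C" using K by (simp add: field_simps)
      thus ?thesis using h by (simp add: distrib_right)
    qed
    have h3: "(4 * R\<^sup>2 * \<omega>0\<^sup>2 + K) * h \<le> R * \<omega>0"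
    proof -
      have p: "4 * R\<^sup>2 * \<omega>0\<^sup>2 + K + 1 > 0" using K by (simp add: add_nonneg_pos)
      have "h \<le> R * \<omega>0 / (4 * R\<^sup>2 * \<omega>0\<^sup>2 + K + 1)" using h\<eta> by (simp add: \<eta>_def)
      hence "(4 * R\<^sup>2 * \<omega>0\<^sup>2 + K + 1) * h \<le> R * \<omega>0" using p by (simp add: pos_le_divide_eq mult.commute)
      thus ?thesis using h by (simp add: distrib_right)
    qed
    have h4: "\<omega>0 * R * h \<le> 1"
    proof -
      have "h \<le> 1 / (\<omega>0 * R)" using h\<eta> by (simp add: \<eta>_def)
      thus ?thesis using R \<omega>0 by (simp add: field_simps)
    qed
    define x where "x k = real k / real N" for k
    have x_Suc: "x (Suc k) = x k + h" for k by (simp add: x_def h_def add_divide_distrib)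
    have x01: "x k \<in> {0..1}" if "k \<le> N" for k using that N by (auto simp: x_def)
    define d where "d k = ou_clock_step \<alpha> N k" for k
    have d: "d k = (exp (2 * \<alpha> * (x k + h)) - exp (2 * \<alpha> * x k)) / (2 * \<alpha>)" for k
      unfolding d_def ou_clock_step_def x_Suc [symmetric] by (simp add: x_def)
    define a where "a k = \<kappa>\<^sup>2 * complex_of_real (\<omega> (x (Suc k)) / (g (x (Suc k)))\<^sup>2 / real N)" for k
    define p where "p k = riccati_den (\<lambda>k. complex_of_real (d k)) a k" for k
    define q where "q k = riccati_num (\<lambda>k. complex_of_real (d k)) a k" for k
    define Z where "Z k = exp (- (\<kappa> * complex_of_real (\<Sum>j<k. h * \<omega> (x j))))" for k
    define E where "E k = exp (- (\<kappa> * complex_of_real (h * \<omega> (x k))))" for k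
    have Z_Suc: "Z (Suc k) = E k * Z k" for k
      by (simp add: Z_def E_def exp_add [symmetric] algebra_simps)
    have \<kappa>0: "\<kappa> \<noteq> 0" using \<kappa> by auto
    have g00: "g 0 \<noteq> 0" using g[of 0] by simp
    \<comment> \<open>The factor \<open>\<kappa> / g 0\<close> normalises both modes to 1 at the
      start, where the denominator is 1 and the numerator 0; \<open>Z\<close> removes the
      accumulated growth.\<close>
    define m where "m k = (p k * of_real (g (x k)) / \<kappa> + q k / of_real (g (x k))) * (\<kappa> / of_real (g 0)) * Z k" for k
    define n where "n k = (p k * of_real (g (x k)) / \<kappa> - q k / of_real (g (x k))) * (\<kappa> / of_real (g 0)) * Z k" for k
    define y where "y k = h * \<omega> (x k)" for k
    define \<delta> where "\<delta> k = d k / (g (x k) * g (x (Suc k)))" for k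
    define \<beta> where "\<beta> k = h * \<omega> (x (Suc k))" for k
    define r where "r k = g (x k) / g (x (Suc k))" for k
    define \<rho> where "\<rho> k = g (x (Suc k)) / g (x k)" for k
    define T where "T k = \<kappa>\<^sup>2 * of_real (\<beta> k) * complex_of_real (\<delta> k)" for k
    define FF where "FF k = (of_real (\<rho> k) + of_real (r k) + \<kappa> * of_real (\<delta> k) + \<kappa> * of_real (\<beta> k) * of_real (r k) + T k) / 2" for k
    define FD where "FD k = (of_real (\<rho> k) - of_real (r k) + \<kappa> * of_real (\<delta> k) - \<kappa> * of_real (\<beta> k) * of_real (r k) + T k) / 2" for k
    define DF where "DF k = (of_real (\<rho> k) - of_real (r k) - \<kappa> * of_real (\<delta> k) + \<kappa> * of_real (\<beta> k) * of_real (r k) + T k) / 2" for k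
    define DD where "DD k = (of_real (\<rho> k) + of_real (r k) - \<kappa> * of_real (\<delta> k) - \<kappa> * of_real (\<beta> k) * of_real (r k) + T k) / 2" for k
    have rec: "m (Suc k) = E k * FF k * m k + E k * FD k * n k" "n (Suc k) = E k * DF k * m k + E k * DD k * n k"
      if k: "k < N" for k
    proof -
      have gp: "g (x k) \<noteq> 0" "g (x (Suc k)) \<noteq> 0" using g[OF x01[of k]] g[OF x01[of "Suc k"]] k by auto
      define P Q where "P = p k * of_real (g (x k)) / \<kappa>" and "Q = q k / of_real (g (x k))"
      define P' Q' where "P' = p (Suc k) * of_real (g (x (Suc k))) / \<kappa>" and "Q' = q (Suc k) / of_real (g (x (Suc k)))"
      have q': "q (Suc k) = q k + of_real (d k) * p k" by (simp add: q_def p_def)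
      \<comment> \<open>The denominator is updated with the new numerator; substituting the latter
        is the source of the product \<open>T\<close>.\<close>
      have p': "p (Suc k) = p k + a k * q (Suc k)" by (simp add: q_def p_def)
      have Q': "Q' = of_real (r k) * Q + \<kappa> * of_real (\<delta> k) * P"
        using gp \<kappa>0 by (simp add: Q'_def q' Q_def P_def r_def \<delta>_def field_simps)
      have P': "P' = of_real (\<rho> k) * P + \<kappa> * of_real (\<beta> k) * Q'"
        using gp \<kappa>0 N by (simp add: P'_def p' Q'_def P_def \<rho>_def \<beta>_def a_def h_def field_simps power2_eq_square)
      have mk: "m k = (P + Q) * (\<kappa> / of_real (g 0)) * Z k" "n k = (P - Q) * (\<kappa> / of_real (g 0)) * Z k"
        by (simp_all add: m_def n_def P_def Q_def)
      have mk': "m (Suc k) = (P' + Q') * (\<kappa> / of_real (g 0)) * (E k * Z k)" "n (Suc k) = (P' - Q') * (\<kappa> / of_real (g 0)) * (E k * Z k)"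
        by (simp_all add: m_def n_def P'_def Q'_def Z_Suc)
      have s: "P' + Q' = FF k * (P + Q) + FD k * (P - Q)" "P' - Q' = DF k * (P + Q) + DD k * (P - Q)"
        unfolding P' Q' FF_def FD_def DF_def DD_def T_def by (simp_all add: field_simps power2_eq_square)
      show "m (Suc k) = E k * FF k * m k + E k * FD k * n k" "n (Suc k) = E k * DF k * m k + E k * DD k * n k"
        unfolding mk mk' s by (simp_all only: ring_distribs mult_ac)
    qed
    have bounds: "norm (E k * FF k - 1) \<le> K * h\<^sup>2" "norm (E k * FD k) \<le> C * h + K * h\<^sup>2"
      "norm (E k * DF k) \<le> C * h + K * h\<^sup>2" "norm (E k * DD k) \<le> exp (- (2 * R * y k)) + K * h\<^sup>2" if k: "k < N" for k
    proof -
      have xk: "0 \<le> x k" "x k + h \<le> 1" using x01[of k] x01[of "Suc k"] k by (auto simp: x_Suc)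
      note gs = G[unfolded grid_step_bounds_def, THEN conjunct2, rule_format, OF xk(1) h(1) xk(2)]
      have y0: "0 \<le> y k" using \<omega>0(2)[OF x01[of k]] \<omega>0(1) h k by (simp add: y_def)
      have r0: "0 \<le> r k" using g[OF x01[of k]] g[OF x01[of "Suc k"]] k by (simp add: r_def)
      have \<kappa>0': "0 \<le> Re \<kappa>" using \<kappa> by simp
      note w = wkb_step_coefficients[of \<kappa> C h "y k" "\<delta> k" "\<beta> k" "r k" "\<rho> k", OF \<kappa>0' C h y0 _ _ _ r0]
      have hyps: "y k \<le> C * h" "\<bar>\<delta> k - y k\<bar> \<le> C * h\<^sup>2" "\<bar>\<beta> k - y k\<bar> \<le> C * h\<^sup>2" "r k \<le> C" "\<bar>r k - 1\<bar> \<le> C * h"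
         "\<bar>\<rho> k - r k\<bar> \<le> 2 * C * h" "\<bar>\<rho> k + r k - 2\<bar> \<le> 2 * C * h\<^sup>2"
        using gs by (simp_all add: y_def \<delta>_def d \<beta>_def r_def \<rho>_def x_Suc)
      note w = w[OF hyps]
      show "norm (E k * FF k - 1) \<le> K * h\<^sup>2" "norm (E k * FD k) \<le> C * h + K * h\<^sup>2"
      "norm (E k * DF k) \<le> C * h + K * h\<^sup>2" "norm (E k * DD k) \<le> exp (- (2 * R * y k)) + K * h\<^sup>2"
        using w unfolding E_def FF_def FD_def DF_def DD_def T_def K_def R_def y_def by auto
    qed
    have main: "norm (m N + n N - 1) \<le> (B0 + (1 + (2 * C) * (1 + B0)) / \<omega>0) / R"
      unfolding B0_def A_def
    proof (rule hyperbolic_recursion_bound[OF \<omega>0(1) _ R _ N h4])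
      show "0 < 2 * C" using C by simp
      show "h = 1 / real N" by (simp add: h_def)
      have "x 0 = 0" by (simp add: x_def)
      thus "m 0 = 1" "n 0 = 1" using g00 \<kappa>0 by (simp_all add: m_def n_def p_def q_def Z_def)
      have KC: "C * h + K * h\<^sup>2 \<le> h * (2 * C)"
      proof -
        have "K * h * h \<le> C * h" using h2 h by (intro mult_right_mono) auto
        thus ?thesis by (simp add: power2_eq_square mult_ac)
      qed
      fix k assume k: "k < N"
      have "m (Suc k) - m k = (E k * FF k - 1) * m k + E k * FD k * n k"
        unfolding rec(1)[OF k] by (simp add: algebra_simps)
      also have "norm \<dots> \<le> norm ((E k * FF k - 1) * m k) + norm (E k * FD k * n k)" by (rule norm_triangle_ineq)
      also have "\<dots> = norm (E k * FF k - 1) * norm (m k) + norm (E k * FD k) * norm (n k)" by (simp only: norm_mult)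
      also have "\<dots> \<le> (h / R) * norm (m k) + (h * (2 * C)) * norm (n k)"
      proof (intro add_mono mult_right_mono)
        have "K * h * h \<le> 1 / R * h" using h1 h by (intro mult_right_mono) auto
        thus "norm (E k * FF k - 1) \<le> h / R" using bounds(1)[OF k] by (simp add: power2_eq_square mult_ac)
        show "norm (E k * FD k) \<le> h * (2 * C)" using bounds(2)[OF k] KC by linarith
      qed auto
      finally show "norm (m (Suc k) - m k) \<le> h * (norm (m k) / R + 2 * C * norm (n k))"
        by (simp add: algebra_simps)
      have "norm (n (Suc k)) \<le> norm (E k * DF k * m k) + norm (E k * DD k * n k)"
        unfolding rec(2)[OF k] by (rule norm_triangle_ineq)
      also have "\<dots> = norm (E k * DF k) * norm (m k) + norm (E k * DD k) * norm (n k)" by (simp only: norm_mult)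
      also have "\<dots> \<le> (h * (2 * C)) * norm (m k) + (1 - \<omega>0 * R * h) * norm (n k)"
      proof (intro add_mono mult_right_mono)
        show "norm (E k * DF k) \<le> h * (2 * C)" using bounds(3)[OF k] KC by linarith
        have yk: "y k \<ge> h * \<omega>0" using \<omega>0(2)[OF x01[of k]] h k by (simp add: y_def)
        have "exp (- (2 * R * y k)) \<le> exp (- (2 * R * (h * \<omega>0)))" using yk R by simp
        also have "\<dots> \<le> 1 - 2 * R * (h * \<omega>0) + (2 * R * (h * \<omega>0))\<^sup>2"
          using R h \<omega>0 by (intro exp_neg_le_quadratic) auto
        finally have "exp (- (2 * R * y k)) + K * h\<^sup>2 \<le> 1 - 2 * R * (h * \<omega>0) + h * ((4 * R\<^sup>2 * \<omega>0\<^sup>2 + K) * h)"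
          by (simp add: power2_eq_square algebra_simps)
        also have "\<dots> \<le> 1 - 2 * R * (h * \<omega>0) + h * (R * \<omega>0)"
          using h3 h by (intro add_left_mono mult_left_mono) auto
        finally show "norm (E k * DD k) \<le> 1 - \<omega>0 * R * h" using bounds(4)[OF k] by (simp add: algebra_simps)
      qed auto
      finally show "norm (n (Suc k)) \<le> (1 - \<omega>0 * R * h) * norm (n k) + h * (2 * C) * norm (m k)" by simp
    qed
    \<comment> \<open>In the sum of the two modes the numerator cancels, so that twice the
      denominator remains.\<close>
    have "x N = 1" using N by (simp add: x_def)
    hence "m N + n N = 2 * p N * complex_of_real (g 1 / g 0) * Z N"
      using \<kappa>0 g00 by (simp add: m_def n_def field_simps)
    also have "p N = riccati_den (\<lambda>k. complex_of_real (ou_clock_step \<alpha> N k))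
       (\<lambda>k. \<kappa>\<^sup>2 * complex_of_real (\<omega> (real (Suc k) / real N) / (g (real (Suc k) / real N))\<^sup>2 / real N)) N"
      unfolding p_def d_def a_def x_def ..
    also have "Z N = exp (- (\<kappa> * complex_of_real (\<Sum>k<N. \<omega> (real k / real N) / real N)))"
      by (simp add: Z_def h_def x_def)
    finally show "norm (2 * riccati_den (\<lambda>k. complex_of_real (ou_clock_step \<alpha> N k))
       (\<lambda>k. \<kappa>\<^sup>2 * complex_of_real (\<omega> (real (Suc k) / real N) / (g (real (Suc k) / real N))\<^sup>2 / real N)) N
       * complex_of_real (g 1 / g 0) * exp (- (\<kappa> * complex_of_real (\<Sum>k<N. \<omega> (real k / real N) / real N))) - 1)
      \<le> (B0 + (1 + (2 * C) * (1 + B0)) / \<omega>0) / Re \<kappa>"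
      using main unfolding R_def by simp
  qed
qed

section \<open>The Laplace transform of the weighted norm\<close>

lemma integral_eq_sum_uniform_grid:
  fixes f :: "real \<Rightarrow> real"
  assumes f: "f integrable_on {0..1}" and k: "k \<le> N" "N > 0"
  shows "integral {0..real k / real N} f = (\<Sum>j<k. integral {real j / real N..real (Suc j) / real N} f)"
  using k(1)
proof (induction k)
  case (Suc k)
  have "real (Suc k) / real N \<le> 1" using Suc.prems k(2) by (simp add: field_simps)
  hence "f integrable_on {0..real (Suc k) / real N}"
    by (intro integrable_on_subinterval[OF f]) auto
  hence "integral {0..real k / real N} f + integral {real k / real N..real (Suc k) / real N} f
      = integral {0..real (Suc k) / real N} f"
    by (intro Henstock_Kurzweil_Integration.integral_combine) (auto intro!: divide_right_mono)
  thus ?case using Suc by simp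
qed simp

text \<open>The tags are arbitrary because two kinds occur: right endpoints for the weighted square
  of \<open>U\<close>, left endpoints for the phase integral \<open>\<theta>\<close>.\<close>

lemma riemann_sum_tendsto:
  fixes f :: "real \<Rightarrow> real" and \<tau> :: "nat \<Rightarrow> nat \<Rightarrow> real"
  assumes f: "continuous_on {0..1} f"
    and \<tau>: "\<And>N k. k < N \<Longrightarrow> \<tau> N k \<in> {real k / real N..real (Suc k) / real N}"
  shows "(\<lambda>N. \<Sum>k<N. f (\<tau> N k) / real N) \<longlonglongrightarrow> (LINT t:{0..1}|lborel. f t)"
proof -
  have int: "f integrable_on {0..1}" using f by (rule integrable_continuous_real)
  have eq: "(LINT t:{0..1}|lborel. f t) = integral {0..1} f"
    by (intro set_borel_integral_eq_integral borel_integrable_atLeastAtMost' f)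
  have unif: "uniformly_continuous_on {0..1} f" using f by (intro compact_uniformly_continuous) auto
  show ?thesis unfolding eq
  proof (rule LIMSEQ_I)
    fix e :: real assume e: "e > 0"
    obtain \<delta> where \<delta>: "\<delta> > 0" "\<And>x y. x \<in> {0..1} \<Longrightarrow> y \<in> {0..1} \<Longrightarrow> dist y x < \<delta> \<Longrightarrow> dist (f y) (f x) < e / 2"
      using unif e unfolding uniformly_continuous_on_def by (metis half_gt_zero)
    have "\<forall>\<^sub>F N in sequentially. 1 / real N < \<delta>"
      using lim_1_over_n[where 'a=real] \<delta>(1) by (intro order_tendstoD) auto
    then obtain N0 where N0: "\<And>N. N \<ge> N0 \<Longrightarrow> 1 / real N < \<delta>" by (auto simp: eventually_sequentially)
    show "\<exists>no. \<forall>n\<ge>no. norm ((\<Sum>k<n. f (\<tau> n k) / real n) - integral {0..1} f) < e"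
    proof (intro exI allI impI)
      fix N assume "N \<ge> max N0 1"
      hence N: "N > 0" "1 / real N < \<delta>" using N0 by auto
      have piece: "norm (f (\<tau> N k) / real N - integral {real k / real N..real (Suc k) / real N} f) \<le> e / 2 / real N"
        if k: "k < N" for k
      proof -
        let ?I = "{real k / real N..real (Suc k) / real N}"
        have le: "real k / real N \<le> real (Suc k) / real N" by (intro divide_right_mono) auto
        have len: "real (Suc k) / real N - real k / real N = 1 / real N" by (simp add: diff_divide_distrib [symmetric])
        have I: "x \<in> {0..1}" if "x \<in> ?I" for x
        proof -
          have "real (Suc k) / real N \<le> 1" using k N by (simp add: field_simps)
          moreover have "0 \<le> real k / real N" by simp
          ultimately show ?thesis using that unfolding atLeastAtMost_iff by linarith
        qed
        have "integral ?I (\<lambda>x. f (\<tau> N k)) = f (\<tau> N k) / real N" using le len by simp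
        moreover have "integral ?I (\<lambda>x. f (\<tau> N k)) - integral ?I f = integral ?I (\<lambda>x. f (\<tau> N k) - f x)"
          using I by (intro Henstock_Kurzweil_Integration.integral_diff [symmetric] integrable_on_subinterval[OF int]) auto
        moreover have "norm (integral ?I (\<lambda>x. f (\<tau> N k) - f x)) \<le> e / 2 * (real (Suc k) / real N - real k / real N)"
        proof (rule integral_bound[OF le])
          show "continuous_on ?I (\<lambda>x. f (\<tau> N k) - f x)"
            using I by (intro continuous_intros continuous_on_subset[OF f]) auto
          fix x assume x: "x \<in> ?I"
          have "dist (\<tau> N k) x < \<delta>"
            using \<tau>[OF k] x len N(2) unfolding dist_real_def atLeastAtMost_iff by linarith
          thus "norm (f (\<tau> N k) - f x) \<le> e / 2"
            using \<delta>(2)[OF I[OF x] I[OF \<tau>[OF k]]] by (simp add: dist_real_def)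
        qed
        ultimately show ?thesis using len by simp
      qed
      have "integral {0..1} f = (\<Sum>k<N. integral {real k / real N..real (Suc k) / real N} f)"
        using integral_eq_sum_uniform_grid[OF int order_refl N(1)] N by simp
      hence "norm ((\<Sum>k<N. f (\<tau> N k) / real N) - integral {0..1} f)
          = norm (\<Sum>k<N. f (\<tau> N k) / real N - integral {real k / real N..real (Suc k) / real N} f)"
        by (simp add: sum_subtractf)
      also have "\<dots> \<le> (\<Sum>k<N. e / 2 / real N)" by (rule sum_norm_le) (use piece in auto)
      also have "\<dots> = e / 2" using N by simp
      finally show "norm ((\<Sum>k<N. f (\<tau> N k) / real N) - integral {0..1} f) < e" using e by simp
    qed
  qed
qed

text \<open>
  The recursion determines only \<open>L\<^sup>2\<close>; the sign of the square root is fixed by positivity at a real point.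
\<close>

lemma branch_of_square_near_one:
  fixes H :: "complex \<Rightarrow> complex"
  assumes D: "connected D" and H: "continuous_on D H" and s0: "s0 \<in> D" "Re (H s0) > 0"
    and sq: "\<And>s. s \<in> D \<Longrightarrow> norm ((H s)\<^sup>2 - 1) < 1" and s: "s \<in> D"
  shows "norm (H s - 1) \<le> norm ((H s)\<^sup>2 - 1)"
proof -
  \<comment> \<open>The square of a number on the imaginary axis is real and at most 0, hence at
    distance at least 1 from 1. So \<open>H\<close> cannot cross that axis on
    \<open>D\<close>.\<close>
  have nz: "Re (H s) \<noteq> 0" if "s \<in> D" for s
  proof
    assume "Re (H s) = 0"
    hence "Re ((H s)\<^sup>2 - 1) \<le> - 1" by (simp add: power2_eq_square)
    thus False using sq[OF that] abs_Re_le_cmod[of "(H s)\<^sup>2 - 1"] by linarith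
  qed
  have "connected ((\<lambda>s. Re (H s)) ` D)" by (intro connected_continuous_image continuous_intros H D)
  hence "Re (H s) > 0"
  proof (rule contrapos_pp)
    assume "\<not> Re (H s) > 0"
    hence "0 \<in> (\<lambda>s. Re (H s)) ` D"
      if "connected ((\<lambda>s. Re (H s)) ` D)"
      using connectedD_interval[OF that, of "Re (H s)" "Re (H s0)" 0] s s0 by auto
    thus "\<not> connected ((\<lambda>s. Re (H s)) ` D)" using nz by auto
  qed
  \<comment> \<open>In the right half plane \<open>H s + 1\<close> has norm at least 1, so the
    factorisation of \<open>(H s)\<^sup>2 - 1\<close> transfers the bound without loss.\<close>
  have "norm (H s - 1) * 1 \<le> norm (H s - 1) * norm (H s + 1)"
  proof (intro mult_left_mono)
    show "1 \<le> norm (H s + 1)" using \<open>Re (H s) > 0\<close> abs_Re_le_cmod[of "H s + 1"] by simp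
  qed auto
  also have "\<dots> = norm ((H s)\<^sup>2 - 1)" by (simp add: norm_mult [symmetric] algebra_simps power2_eq_square)
  finally show ?thesis by simp
qed

text \<open>\<open>Re z\<close> is the difference of the squares of the real and the imaginary part
  of the root. This turns an error in 1/Re \<kappa> into one in 1/sqrt (Re s), independent of Im
  s.\<close>

lemma Re_csqrt_ge:
  assumes "Re z \<ge> 0"
  shows "Re (csqrt z) \<ge> sqrt (Re z)"
proof -
  have "Re z = (Re (csqrt z))\<^sup>2 - (Im (csqrt z))\<^sup>2"
    using arg_cong[OF power2_csqrt[of z], of Re] by (simp only: Re_power2)
  hence "Re z \<le> (Re (csqrt z))\<^sup>2" using zero_le_power2[of "Im (csqrt z)"] by linarith
  thus ?thesis using assms by (intro real_le_lsqrt) (auto simp: csqrt.simps)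
qed

text \<open>One family for both WKB functions: \<open>\<beta> = \<alpha>\<close>,
  \<open>c = - 1 / 4\<close> is the amplitude, and \<open>\<beta> = 0\<close>,
  \<open>c = 1 / 2\<close> is the frequency sqrt \<psi>. The Lipschitz constant is the maximum of
  the derivative on the compact interval.\<close>

lemma exp_ln_lipschitz:
  fixes \<psi> \<psi>' :: "real \<Rightarrow> real"
  assumes pos: "\<And>x. x \<in> {0..1} \<Longrightarrow> \<psi> x > 0"
    and der: "\<And>x. x \<in> {0..1} \<Longrightarrow> (\<psi> has_real_derivative \<psi>' x) (at x within {0..1})"
    and cont: "continuous_on {0..1} \<psi>'"
  defines "u \<equiv> \<lambda>\<beta> c x. exp (\<beta> * x + c * ln (\<psi> x))"
  obtains l m L where "l > 0" "\<And>x. x \<in> {0..1} \<Longrightarrow> l \<le> u \<beta> c x \<and> u \<beta> c x \<le> m"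
    "\<And>x y. x \<in> {0..1} \<Longrightarrow> y \<in> {0..1} \<Longrightarrow> \<bar>u \<beta> c x - u \<beta> c y\<bar> \<le> L * \<bar>x - y\<bar>"
proof -
  define u' where "u' x = u \<beta> c x * (\<beta> + c * (\<psi>' x / \<psi> x))" for x
  have contp: "continuous_on {0..1} \<psi>"
    using der by (intro has_field_derivative_imp_has_derivative[THEN has_derivative_continuous_on]) auto
  have nz: "\<forall>x\<in>{0..1}. \<psi> x \<noteq> 0" using pos by force
  have d: "(u \<beta> c has_real_derivative u' x) (at x within {0..1})" if x: "x \<in> {0..1}" for x
    unfolding u_def u'_def using der[OF x] pos[OF x]
    by (auto intro!: derivative_eq_intros simp: field_simps)
  have cu: "continuous_on {0..1} (u \<beta> c)"
    using d by (intro has_field_derivative_imp_has_derivative[THEN has_derivative_continuous_on]) auto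
  have cu': "continuous_on {0..1} u'"
    unfolding u'_def using nz by (intro continuous_intros cu cont contp) auto
  obtain x0 where x0: "x0 \<in> {0..1}" "\<forall>y\<in>{0..1}. u \<beta> c x0 \<le> u \<beta> c y"
    using continuous_attains_inf[OF _ _ cu] by auto
  obtain x1 where x1: "\<forall>y\<in>{0..1}. u \<beta> c y \<le> u \<beta> c x1"
    using continuous_attains_sup[OF _ _ cu] by auto
  have "continuous_on {0..1} (\<lambda>x. \<bar>u' x\<bar>)" using cu' by (intro continuous_intros)
  then obtain x2 where x2: "\<forall>y\<in>{0..1}. \<bar>u' y\<bar> \<le> \<bar>u' x2\<bar>"
    using continuous_attains_sup[of "{0..1::real}"] by fastforce
  show thesis
  proof (rule that[of "u \<beta> c x0" "u \<beta> c x1" "\<bar>u' x2\<bar>"])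
    show "u \<beta> c x0 > 0" by (simp add: u_def)
    show "u \<beta> c x0 \<le> u \<beta> c x \<and> u \<beta> c x \<le> u \<beta> c x1" if "x \<in> {0..1}" for x using x0 x1 that by blast
    show "\<bar>u \<beta> c x - u \<beta> c y\<bar> \<le> \<bar>u' x2\<bar> * \<bar>x - y\<bar>" if "x \<in> {0..1}" "y \<in> {0..1}" for x y
      using field_differentiable_bound[of "{0..1}" "u \<beta> c" u' "\<bar>u' x2\<bar>" x y] d x2 that by auto
  qed
qed

lemma laplace_transform_of_real:
  "laplace_transform M W (complex_of_real r) = complex_of_real (LINT \<omega>|M. exp (- (r * W \<omega>)))"
  unfolding laplace_transform_def integral_complex_of_real [symmetric]
  by (intro Bochner_Integration.integral_cong) (auto simp: exp_of_real [symmetric])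

text \<open>At each fixed \<open>s\<close> the grid estimate passes to the limit, since its bound
  does not involve the mesh; this determines the square of the transform, and continuity on a half
  plane selects the root. The error involves \<open>Re s\<close> alone, as needed for integrating
  along vertical lines.\<close>

lemma ou_laplace_asymptotics:
  fixes \<psi> :: "real \<Rightarrow> real" and U :: "real \<Rightarrow> 'a \<Rightarrow> real"
  assumes \<alpha>: "\<alpha> \<noteq> 0" and U: "ou_process_from_zero \<alpha> M U"
    and pos: "\<And>t. t \<in> {0..1} \<Longrightarrow> \<psi> t > 0"
    and smooth: "twice_continuously_differentiable_on \<psi> {0..1}"
  defines "W \<equiv> \<lambda>\<omega>. LINT t:{0..1}|lborel. (U t \<omega>)\<^sup>2 * \<psi> t"
    and "\<theta> \<equiv> LINT t:{0..1}|lborel. sqrt (\<psi> t)"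
    and "A0 \<equiv> sqrt 2 * exp (\<alpha> / 2) * \<psi> 0 powr (1/8) / \<psi> 1 powr (1/8)"
  shows "W \<in> borel_measurable M" and "\<And>\<omega>. W \<omega> \<ge> 0"
    and "\<exists>B \<gamma>0. \<gamma>0 > 0 \<and> (\<forall>s. Re s \<ge> \<gamma>0 \<longrightarrow> laplace_transform M W s \<noteq> 0 \<and>
      norm (complex_of_real A0 * exp (- (csqrt (2 * s) * complex_of_real (\<theta> / 2))) / laplace_transform M W s - 1) \<le> B / sqrt (Re s))"
proof -
  interpret prob_space M using U by (simp add: ou_process_from_zero_def)
  have contU: "continuous_on {0..1} (\<lambda>t. U t \<omega>)" if "\<omega> \<in> space M" for \<omega>
    using U that by (auto simp: ou_process_from_zero_def continuous_process_on_def)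
  have measU: "U t \<in> borel_measurable M" if "t \<in> {0..1}" for t
    using U that unfolding ou_process_from_zero_def centered_process_on_def by auto
  obtain \<psi>' \<psi>'' where \<psi>': "\<And>x. x \<in> {0..1} \<Longrightarrow> (\<psi> has_real_derivative \<psi>' x) (at x within {0..1})"
    and \<psi>'': "\<And>x. x \<in> {0..1} \<Longrightarrow> (\<psi>' has_real_derivative \<psi>'' x) (at x within {0..1})"
    using smooth unfolding twice_continuously_differentiable_on_def by blast
  have cont\<psi>: "continuous_on {0..1} \<psi>" and cont\<psi>': "continuous_on {0..1} \<psi>'"
    by (rule DERIV_continuous_on[OF \<psi>'], assumption) (rule DERIV_continuous_on[OF \<psi>''])
  define g where "g x = exp (\<alpha> * x + (- 1 / 4) * ln (\<psi> x))" for x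
  define v where "v x = exp (0 * x + (1 / 2) * ln (\<psi> x))" for x
  have v_sqrt: "v x = sqrt (\<psi> x)" if "x \<in> {0..1}" for x
    using pos[OF that] by (simp add: v_def powr_half_sqrt [symmetric] powr_def)
  have v2: "(v x)\<^sup>2 = \<psi> x" if "x \<in> {0..1}" for x using v_sqrt[OF that] pos[OF that] by simp
  have rel: "v x * (g x)\<^sup>2 = exp (2 * \<alpha> * x)" for x
    by (simp add: v_def g_def power2_eq_square exp_add [symmetric])
  have gpos: "g x > 0" for x by (simp add: g_def)
  obtain gl gm Lg where gl: "gl > 0" "\<And>x. x \<in> {0..1} \<Longrightarrow> gl \<le> g x \<and> g x \<le> gm"
    and Lg: "\<And>x y. x \<in> {0..1} \<Longrightarrow> y \<in> {0..1} \<Longrightarrow> \<bar>g x - g y\<bar> \<le> Lg * \<bar>x - y\<bar>"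
    using exp_ln_lipschitz[OF pos \<psi>' cont\<psi>', of \<alpha> "- 1 / 4"] unfolding g_def by metis
  obtain vl vm Lv where vl: "vl > 0" "\<And>x. x \<in> {0..1} \<Longrightarrow> vl \<le> v x \<and> v x \<le> vm"
    and Lv: "\<And>x y. x \<in> {0..1} \<Longrightarrow> y \<in> {0..1} \<Longrightarrow> \<bar>v x - v y\<bar> \<le> Lv * \<bar>x - y\<bar>"
    using exp_ln_lipschitz[OF pos \<psi>' cont\<psi>', of 0 "1 / 2"] unfolding v_def by metis
  have "\<exists>C. grid_step_bounds \<alpha> g v C"
    by (rule lipschitz_grid_step_bounds[OF \<alpha> gl(1) gl(2) _ rel Lg Lv]) (use vl in \<open>auto simp: v_def\<close>)
  then obtain C where C: "grid_step_bounds \<alpha> g v C" ..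
  define tt where "tt N k = real (Suc k) / real N" for N k :: nat
  \<comment> \<open>By \<open>rel\<close>, for k < N this is
    \<open>2 * \<psi> * exp (- 2 * \<alpha> * t) / N\<close> at the grid point t. The 2 compensates
    the 1/2 in the Gaussian exponent and is the reason for \<open>\<kappa>\<^sup>2 = 2 * s\<close>
    below.\<close>
  define b where "b N k = 2 * (v (tt N k) / (g (tt N k))\<^sup>2 / real N)" for N k
  define WN where "WN N \<omega> = (\<Sum>k<N. (v (tt N k))\<^sup>2 * (U (tt N k) \<omega>)\<^sup>2 / real N)" for N \<omega>
  define p where "p N s = riccati_den (\<lambda>k. complex_of_real (ou_clock_step \<alpha> N k)) (\<lambda>k. s * complex_of_real (b N k)) N" for N s
  define \<theta>N where "\<theta>N N = (\<Sum>k<N. v (real k / real N) / real N)" for N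
  have tt01: "tt N k \<in> {0..1}" if "k < N" for N k using that by (auto simp: tt_def field_simps)
  have measWN [measurable]: "WN N \<in> borel_measurable M" for N
  proof -
    have [measurable]: "U (tt N k) \<in> borel_measurable M" if "k < N" for k using measU tt01 that by auto
    show ?thesis unfolding WN_def by (intro borel_measurable_sum) auto
  qed
  have WN0: "WN N \<omega> \<ge> 0" for N \<omega> unfolding WN_def by (intro sum_nonneg) auto
  have limW: "(\<lambda>N. WN N \<omega>) \<longlonglongrightarrow> W \<omega>" if "\<omega> \<in> space M" for \<omega>
  proof -
    have "(\<lambda>N. \<Sum>k<N. ((U (tt N k) \<omega>)\<^sup>2 * \<psi> (tt N k)) / real N) \<longlonglongrightarrow> W \<omega>"
      unfolding W_def
      by (rule riemann_sum_tendsto[of "\<lambda>t. (U t \<omega>)\<^sup>2 * \<psi> t"])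
        (auto intro!: continuous_intros contU that cont\<psi> divide_right_mono simp: tt_def)
    moreover have "(\<Sum>k<N. ((U (tt N k) \<omega>)\<^sup>2 * \<psi> (tt N k)) / real N) = WN N \<omega>" for N
      unfolding WN_def using tt01 by (intro sum.cong) (auto simp: v2)
    ultimately show ?thesis by simp
  qed
  show measW [measurable]: "W \<in> borel_measurable M"
    by (rule borel_measurable_LIMSEQ_real[OF limW measWN])
  show W0: "W \<omega> \<ge> 0" for \<omega>
    unfolding W_def set_lebesgue_integral_def
    by (intro Bochner_Integration.integral_nonneg) (auto simp: indicator_def intro!: mult_nonneg_nonneg less_imp_le[OF pos])
  have real: "expectation (\<lambda>\<omega>. exp (- (r * WN N \<omega>))) = 1 / sqrt (riccati_den (ou_clock_step \<alpha> N) (\<lambda>k. r * b N k) N)"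
    if "r > 0" for r N
  proof -
    have "expectation (\<lambda>\<omega>. exp (- (\<Sum>k<N. (2 * r * (v (tt N k))\<^sup>2 / real N) * (U (tt N k) \<omega>)\<^sup>2) / 2))
      = 1 / sqrt (riccati_den (ou_clock_step \<alpha> N) (\<lambda>k. (2 * r * (v (tt N k))\<^sup>2 / real N) * exp (- 2 * \<alpha> * tt N k)) N)"
      unfolding tt_def by (rule ou_process_quadratic_laplace[OF \<alpha> U]) (use that in auto)
    also have "(\<lambda>k. (2 * r * (v (tt N k))\<^sup>2 / real N) * exp (- 2 * \<alpha> * tt N k)) = (\<lambda>k. r * b N k)"
    proof
      fix k
      have "exp (- 2 * \<alpha> * tt N k) = 1 / (v (tt N k) * (g (tt N k))\<^sup>2)"
        unfolding rel by (simp add: exp_minus inverse_eq_divide)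
      moreover have "v (tt N k) \<noteq> 0" by (simp add: v_def)
      ultimately show "(2 * r * (v (tt N k))\<^sup>2 / real N) * exp (- 2 * \<alpha> * tt N k) = r * b N k"
        using gpos[of "tt N k"] by (simp add: b_def power2_eq_square mult_ac)
    qed
    also have "(\<lambda>\<omega>. exp (- (\<Sum>k<N. (2 * r * (v (tt N k))\<^sup>2 / real N) * (U (tt N k) \<omega>)\<^sup>2) / 2)) = (\<lambda>\<omega>. exp (- (r * WN N \<omega>)))"
    proof
      fix \<omega>
      have "(\<Sum>k<N. (2 * r * (v (tt N k))\<^sup>2 / real N) * (U (tt N k) \<omega>)\<^sup>2) = 2 * (r * WN N \<omega>)"
        unfolding WN_def sum_distrib_left by (intro sum.cong) auto
      thus "exp (- (\<Sum>k<N. (2 * r * (v (tt N k))\<^sup>2 / real N) * (U (tt N k) \<omega>)\<^sup>2) / 2) = exp (- (r * WN N \<omega>))"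
        by simp
    qed
    finally show ?thesis .
  qed
  have Lp: "(laplace_transform M (WN N) s)\<^sup>2 * p N s = 1" if "Re s > 0" for N s
    unfolding p_def
    by (rule laplace_transform_riccati[OF measWN WN0 ou_clock_step_nonneg _ real that])
      (auto simp: b_def v_def intro!: mult_nonneg_nonneg divide_nonneg_nonneg)
  have limL: "(\<lambda>N. laplace_transform M (WN N) s) \<longlonglongrightarrow> laplace_transform M W s" if "Re s > 0" for s
    unfolding laplace_transform_def
    by (rule integral_dominated_convergence[where w="\<lambda>_. 1"])
      (use limW WN0 that in \<open>auto intro!: tendsto_intros AE_I2\<close>)
  have \<theta>: "\<theta>N \<longlonglongrightarrow> \<theta>"
  proof -
    have "continuous_on {0..1} (\<lambda>t. sqrt (\<psi> t))" using cont\<psi> by (intro continuous_intros)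
    hence "(\<lambda>N. \<Sum>k<N. sqrt (\<psi> (real k / real N)) / real N) \<longlonglongrightarrow> \<theta>"
      unfolding \<theta>_def by (rule riemann_sum_tendsto) (auto intro!: divide_right_mono)
    moreover have "(\<Sum>k<N. sqrt (\<psi> (real k / real N)) / real N) = \<theta>N N" for N
      unfolding \<theta>N_def by (intro sum.cong) (auto simp: v_sqrt)
    ultimately show ?thesis by simp
  qed
  obtain B where B: "\<And>\<kappa>. Re \<kappa> \<ge> 1 \<Longrightarrow> \<forall>\<^sub>F N in sequentially.
    norm (2 * riccati_den (\<lambda>k. complex_of_real (ou_clock_step \<alpha> N k))
       (\<lambda>k. \<kappa>\<^sup>2 * complex_of_real (v (real (Suc k) / real N) / (g (real (Suc k) / real N))\<^sup>2 / real N)) N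
       * complex_of_real (g 1 / g 0) * exp (- (\<kappa> * complex_of_real (\<Sum>k<N. v (real k / real N) / real N))) - 1) \<le> B / Re \<kappa>"
    using riccati_wkb[OF C vl(1), of thesis] vl(2) gpos by blast
  define E where "E s = 2 * complex_of_real (g 1 / g 0) * exp (- (csqrt (2 * s) * complex_of_real \<theta>))" for s
  define L where "L = laplace_transform M W"
  \<comment> \<open>Kept as a product and not as a quotient, because the limit \<open>L s\<close>
    might a priori be 0. Since \<open>E\<close> never vanishes, this very form rules out zeros of
    \<open>L\<close> afterwards.\<close>
  have LE: "norm ((L s)\<^sup>2 - E s) \<le> norm ((L s)\<^sup>2) * (B / Re (csqrt (2 * s)))" if s: "Re s \<ge> 1" for s
  proof -
    define \<kappa> where "\<kappa> = csqrt (2 * s)"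
    have \<kappa>: "\<kappa>\<^sup>2 = 2 * s" by (simp add: \<kappa>_def)
    have "Re \<kappa> \<ge> sqrt (Re (2 * s))" unfolding \<kappa>_def using s by (intro Re_csqrt_ge) simp
    moreover have "sqrt (Re (2 * s)) \<ge> 1" using s by simp
    ultimately have R: "Re \<kappa> \<ge> 1" by linarith
    let ?LN = "\<lambda>N. laplace_transform M (WN N) s"
    let ?e = "\<lambda>N. 2 * complex_of_real (g 1 / g 0) * exp (- (\<kappa> * complex_of_real (\<theta>N N)))"
    have s0: "Re s > 0" using s by simp
    show ?thesis
    proof (rule tendsto_le[OF trivial_limit_sequentially])
      show "(\<lambda>N. norm ((?LN N)\<^sup>2) * (B / Re (csqrt (2 * s)))) \<longlonglongrightarrow> norm ((L s)\<^sup>2) * (B / Re (csqrt (2 * s)))"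
        unfolding L_def by (intro tendsto_intros limL s0)
      show "(\<lambda>N. norm ((?LN N)\<^sup>2 - ?e N)) \<longlonglongrightarrow> norm ((L s)\<^sup>2 - E s)"
        unfolding L_def E_def \<kappa>_def [symmetric] by (intro tendsto_intros limL s0 \<theta>)
      show "\<forall>\<^sub>F N in sequentially. norm ((?LN N)\<^sup>2 - ?e N) \<le> norm ((?LN N)\<^sup>2) * (B / Re (csqrt (2 * s)))"
        using B[OF R]
      proof eventually_elim
        fix N
        assume a: "norm (2 * riccati_den (\<lambda>k. complex_of_real (ou_clock_step \<alpha> N k))
       (\<lambda>k. \<kappa>\<^sup>2 * complex_of_real (v (real (Suc k) / real N) / (g (real (Suc k) / real N))\<^sup>2 / real N)) N
       * complex_of_real (g 1 / g 0) * exp (- (\<kappa> * complex_of_real (\<Sum>k<N. v (real k / real N) / real N))) - 1) \<le> B / Re \<kappa>"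
        have "riccati_den (\<lambda>k. complex_of_real (ou_clock_step \<alpha> N k))
          (\<lambda>k. \<kappa>\<^sup>2 * complex_of_real (v (real (Suc k) / real N) / (g (real (Suc k) / real N))\<^sup>2 / real N)) N = p N s"
          unfolding p_def \<kappa> b_def tt_def by (simp add: mult_ac)
        with a have a': "norm (2 * p N s * complex_of_real (g 1 / g 0) * exp (- (\<kappa> * complex_of_real (\<theta>N N))) - 1) \<le> B / Re \<kappa>"
          by (simp add: \<theta>N_def)
        have "?e N = (?LN N)\<^sup>2 * p N s * ?e N" using Lp[OF s0, of N] by simp
        hence "(?LN N)\<^sup>2 - ?e N = - ((?LN N)\<^sup>2 * (2 * p N s * complex_of_real (g 1 / g 0) * exp (- (\<kappa> * complex_of_real (\<theta>N N))) - 1))"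
          by (simp add: algebra_simps)
        hence "norm ((?LN N)\<^sup>2 - ?e N) = norm ((?LN N)\<^sup>2) * norm (2 * p N s * complex_of_real (g 1 / g 0) * exp (- (\<kappa> * complex_of_real (\<theta>N N))) - 1)"
          by (simp only: norm_minus_cancel norm_mult)
        also have "\<dots> \<le> norm ((?LN N)\<^sup>2) * (B / Re \<kappa>)" using a' by (intro mult_left_mono) auto
        finally show "norm ((?LN N)\<^sup>2 - ?e N) \<le> norm ((?LN N)\<^sup>2) * (B / Re (csqrt (2 * s)))"
          by (simp only: \<kappa>_def)
      qed
    qed
  qed
  have E0: "E s \<noteq> 0" for s using gpos[of 0] gpos[of 1] by (simp add: E_def)
  have L0: "L s \<noteq> 0" if "Re s \<ge> 1" for s
    using LE[OF that] E0[of s] by auto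
  define \<Lambda> where "\<Lambda> s = complex_of_real A0 * exp (- (csqrt (2 * s) * complex_of_real (\<theta> / 2)))" for s
  have A0: "A0 > 0" using pos[of 0] pos[of 1] by (simp add: A0_def)
  have "A0\<^sup>2 = 2 * (g 1 / g 0)"
  proof -
    have "\<psi> 0 powr (1/8) = exp (ln (\<psi> 0) / 8)" "\<psi> 1 powr (1/8) = exp (ln (\<psi> 1) / 8)"
      using pos[of 0] pos[of 1] by (simp_all add: powr_def)
    hence "A0 = sqrt 2 * exp (\<alpha> / 2 + ln (\<psi> 0) / 8 - ln (\<psi> 1) / 8)"
      by (simp add: A0_def exp_add exp_diff)
    hence "A0\<^sup>2 = 2 * exp ((\<alpha> / 2 + ln (\<psi> 0) / 8 - ln (\<psi> 1) / 8) + (\<alpha> / 2 + ln (\<psi> 0) / 8 - ln (\<psi> 1) / 8))"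
      unfolding exp_add [of "\<alpha> / 2 + ln (\<psi> 0) / 8 - ln (\<psi> 1) / 8"] by (simp add: power2_eq_square)
    also have "g 1 / g 0 = exp ((\<alpha> / 2 + ln (\<psi> 0) / 8 - ln (\<psi> 1) / 8) + (\<alpha> / 2 + ln (\<psi> 0) / 8 - ln (\<psi> 1) / 8))"
      by (simp add: g_def exp_diff [symmetric])
    ultimately show ?thesis by simp
  qed
  hence A02: "(complex_of_real A0)\<^sup>2 = 2 * complex_of_real (g 1 / g 0)"
    unfolding of_real_power [symmetric] by simp
  have \<Lambda>2: "(\<Lambda> s)\<^sup>2 = E s" for s
  proof -
    have "exp (- (csqrt (2 * s) * complex_of_real (\<theta> / 2))) * exp (- (csqrt (2 * s) * complex_of_real (\<theta> / 2)))
        = exp (- (csqrt (2 * s) * complex_of_real \<theta>))"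
      by (simp add: exp_add [symmetric] mult_ac)
    thus ?thesis unfolding \<Lambda>_def E_def power_mult_distrib A02 by (simp only: power2_eq_square)
  qed
  define B' where "B' = \<bar>B\<bar> + 1"
  \<comment> \<open>For \<open>Re s \<ge> \<gamma>0\<close> the quotient
    \<open>\<bar>B\<bar> / sqrt (Re s)\<close> is less than 1, the distance that
    \<open>branch_of_square_near_one\<close> requires.\<close>
  define \<gamma>0 where "\<gamma>0 = max 1 (B'\<^sup>2)"
  have B': "B' \<ge> 1" by (simp add: B'_def)
  have sq: "norm ((\<Lambda> s / L s)\<^sup>2 - 1) \<le> \<bar>B\<bar> / sqrt (Re s)" if s: "Re s \<ge> 1" for s
  proof -
    have "Re (csqrt (2 * s)) \<ge> sqrt (Re (2 * s))" using s by (intro Re_csqrt_ge) simp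
    moreover have "sqrt (Re (2 * s)) \<ge> sqrt (Re s)" using s by simp
    ultimately have R: "Re (csqrt (2 * s)) \<ge> sqrt (Re s)" by linarith
    have sp: "sqrt (Re s) > 0" using s by simp
    have "(\<Lambda> s / L s)\<^sup>2 - 1 = - (((L s)\<^sup>2 - E s) / (L s)\<^sup>2)"
      using L0[OF s] by (simp add: power_divide \<Lambda>2 field_simps)
    hence "norm ((\<Lambda> s / L s)\<^sup>2 - 1) = norm ((L s)\<^sup>2 - E s) / norm ((L s)\<^sup>2)"
      by (simp only: norm_minus_cancel norm_divide)
    also have "\<dots> \<le> B / Re (csqrt (2 * s))"
      using LE[OF s] L0[OF s] by (simp add: pos_divide_le_eq mult.commute)
    also have "\<dots> \<le> \<bar>B\<bar> / Re (csqrt (2 * s))" using R sp by (intro divide_right_mono) auto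
    also have "\<dots> \<le> \<bar>B\<bar> / sqrt (Re s)"
      using less_le_trans[OF sp R] sp by (intro divide_left_mono R mult_pos_pos) auto
    finally show ?thesis .
  qed
  have final: "norm (\<Lambda> s / L s - 1) \<le> \<bar>B\<bar> / sqrt (Re s)" if s: "Re s \<ge> \<gamma>0" for s
  proof -
    have g1: "Re z \<ge> 1" if "Re z \<ge> \<gamma>0" for z using that by (simp add: \<gamma>0_def)
    have "norm (\<Lambda> s / L s - 1) \<le> norm ((\<Lambda> s / L s)\<^sup>2 - 1)"
    proof (rule branch_of_square_near_one[of "{s. Re s \<ge> \<gamma>0}" "\<lambda>s. \<Lambda> s / L s" "complex_of_real \<gamma>0"])
      show "connected {s. Re s \<ge> \<gamma>0}" by (intro convex_connected convex_halfspace_Re_ge)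
      have "continuous_on {s. Re s \<ge> \<gamma>0} L"
        unfolding L_def using g1
        by (intro continuous_on_subset[OF holomorphic_on_imp_continuous_on[OF laplace_transform_holomorphic[OF measW W0]]])
          (auto intro: less_le_trans[OF zero_less_one])
      moreover have "continuous_on {s. Re s \<ge> \<gamma>0} (\<lambda>s. csqrt (2 * s))"
        using g1 by (intro continuous_on_compose2[OF continuous_on_csqrt] continuous_intros)
          (auto simp: complex_nonpos_Reals_iff dest!: g1)
      ultimately show "continuous_on {s. Re s \<ge> \<gamma>0} (\<lambda>s. \<Lambda> s / L s)"
        unfolding \<Lambda>_def using L0 g1 by (intro continuous_intros) auto
      show "complex_of_real \<gamma>0 \<in> {s. Re s \<ge> \<gamma>0}" by simp
      have \<gamma>1: "\<gamma>0 \<ge> 1" by (simp add: \<gamma>0_def)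
      have "csqrt (2 * complex_of_real \<gamma>0) = complex_of_real (sqrt (2 * \<gamma>0))"
        using \<gamma>1 of_real_sqrt[of "2 * \<gamma>0"] by simp
      hence \<Lambda>r: "\<Lambda> (complex_of_real \<gamma>0) = complex_of_real (A0 * exp (- (sqrt (2 * \<gamma>0) * (\<theta> / 2))))"
        by (simp add: \<Lambda>_def exp_of_real [symmetric])
      define l where "l = (LINT \<omega>|M. exp (- (\<gamma>0 * W \<omega>)))"
      have Lr: "L (complex_of_real \<gamma>0) = complex_of_real l"
        unfolding L_def l_def by (rule laplace_transform_of_real)
      have "l \<ge> 0" unfolding l_def by (intro Bochner_Integration.integral_nonneg) auto
      moreover have "l \<noteq> 0" using L0[of "complex_of_real \<gamma>0"] \<gamma>1 Lr by auto
      ultimately have "l > 0" by simp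
      thus "Re (\<Lambda> (complex_of_real \<gamma>0) / L (complex_of_real \<gamma>0)) > 0"
        unfolding \<Lambda>r Lr of_real_divide [symmetric] using A0 by simp
      show "s \<in> {s. Re s \<ge> \<gamma>0}" using s by simp
      fix z assume "z \<in> {s. Re s \<ge> \<gamma>0}"
      hence z: "Re z \<ge> \<gamma>0" by simp
      have "B'\<^sup>2 \<le> Re z" using z by (simp add: \<gamma>0_def)
      hence "B' \<le> sqrt (Re z)" using B' by (intro real_le_rsqrt)
      hence "\<bar>B\<bar> / sqrt (Re z) < 1"
        unfolding B'_def by (subst pos_divide_less_eq) linarith+
      thus "norm ((\<Lambda> z / L z)\<^sup>2 - 1) < 1" using sq[OF g1[OF z]] by linarith
    qed
    also have "\<dots> \<le> \<bar>B\<bar> / sqrt (Re s)" using sq[OF g1[OF s]] .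
    finally show ?thesis .
  qed
  show "\<exists>B \<gamma>0. \<gamma>0 > 0 \<and> (\<forall>s. Re s \<ge> \<gamma>0 \<longrightarrow> laplace_transform M W s \<noteq> 0 \<and>
      norm (complex_of_real A0 * exp (- (csqrt (2 * s) * complex_of_real (\<theta> / 2))) / laplace_transform M W s - 1) \<le> B / sqrt (Re s))"
  proof (intro exI conjI allI impI)
    show "\<gamma>0 > 0" by (simp add: \<gamma>0_def)
    fix s assume s: "Re s \<ge> \<gamma>0"
    show "laplace_transform M W s \<noteq> 0" using L0[of s] s by (simp add: L_def \<gamma>0_def)
    show "norm (complex_of_real A0 * exp (- (csqrt (2 * s) * complex_of_real (\<theta> / 2))) / laplace_transform M W s - 1) \<le> \<bar>B\<bar> / sqrt (Re s)"
      using final[OF s] by (simp add: \<Lambda>_def L_def)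
  qed
qed

section \<open>Inversion along a vertical line\<close>

lemma exp_tail_integral_real:
  fixes r w :: real
  assumes "r > 0"
  shows "integrable lborel (\<lambda>y. if w \<le> y then exp (- (r * y)) else 0)"
    and "(LINT y|lborel. (if w \<le> y then exp (- (r * y)) else 0)) = exp (- (r * w)) / r"
proof -
  have "(\<integral>\<^sup>+ y. ennreal (exp (- (r * y))) * indicator {w..} y \<partial>lborel) = ennreal (0 - (- exp (- (r * w)) / r))"
  proof (rule nn_integral_FTC_atLeast)
    show "((\<lambda>y. - exp (- (r * y)) / r) has_real_derivative exp (- (r * x))) (at x)" for x
      using assms by (auto intro!: derivative_eq_intros)
    have "filterlim (\<lambda>y. - (r * y)) at_bot at_top"
      using assms filterlim_tendsto_pos_mult_at_top[OF tendsto_const assms filterlim_ident]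
      by (simp add: filterlim_uminus_at_top)
    hence "((\<lambda>y. exp (- (r * y))) \<longlongrightarrow> 0) at_top"
      using filterlim_compose[OF exp_at_bot] by blast
    hence "((\<lambda>y. - exp (- (r * y)) / r) \<longlongrightarrow> - 0 / r) at_top"
      using assms by (intro tendsto_intros) auto
    thus "((\<lambda>y. - exp (- (r * y)) / r) \<longlongrightarrow> 0) at_top" by simp
  qed auto
  also have "(\<integral>\<^sup>+ y. ennreal (exp (- (r * y))) * indicator {w..} y \<partial>lborel)
      = (\<integral>\<^sup>+ y. ennreal (if w \<le> y then exp (- (r * y)) else 0) \<partial>lborel)"
    by (intro nn_integral_cong) (auto simp: indicator_def)
  finally have nn: "(\<integral>\<^sup>+ y. ennreal (if w \<le> y then exp (- (r * y)) else 0) \<partial>lborel) = ennreal (exp (- (r * w)) / r)"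
    by simp
  show "integrable lborel (\<lambda>y. if w \<le> y then exp (- (r * y)) else 0)"
    by (rule integrableI_nn_integral_finite[OF _ _ nn]) (use assms in auto)
  show "(LINT y|lborel. (if w \<le> y then exp (- (r * y)) else 0)) = exp (- (r * w)) / r"
    by (rule integral_eq_nn_integral[THEN trans]) (use assms nn in auto)
qed

lemma exp_tail_integral:
  fixes z :: complex and w :: real
  assumes z: "Re z > 0"
  shows "integrable lborel (\<lambda>y. if w \<le> y then exp (- (z * of_real y)) else 0)"
    and "(CLINT y|lborel. (if w \<le> y then exp (- (z * of_real y)) else 0)) = exp (- (z * of_real w)) / z"
proof -
  show int: "integrable lborel (\<lambda>y. if w \<le> y then exp (- (z * of_real y)) else 0)"
    by (rule Bochner_Integration.integrable_bound[OF exp_tail_integral_real(1)[OF z, of w]]) auto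
  have z0: "z \<noteq> 0" using z by auto
  have "(\<lambda>n. CLINT y|lborel. indicator {w..w + real n} y *\<^sub>R exp (- (z * of_real y)))
      \<longlonglongrightarrow> (CLINT y|lborel. (if w \<le> y then exp (- (z * of_real y)) else 0))"
  proof (rule integral_dominated_convergence[where w="\<lambda>y. norm (if w \<le> y then exp (- (z * of_real y)) else 0)"])
    show "AE y in lborel. (\<lambda>n. indicator {w..w + real n} y *\<^sub>R exp (- (z * of_real y)))
      \<longlonglongrightarrow> (if w \<le> y then exp (- (z * of_real y)) else 0)"
    proof (intro AE_I2 tendsto_eventually)
      fix y
      show "\<forall>\<^sub>F n in sequentially. indicator {w..w + real n} y *\<^sub>R exp (- (z * of_real y)) = (if w \<le> y then exp (- (z * of_real y)) else 0)"
        using eventually_ge_at_top[of "nat \<lceil>y - w\<rceil>"]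
      proof eventually_elim
        fix n :: nat assume "n \<ge> nat \<lceil>y - w\<rceil>"
        hence "y \<le> w + real n" by linarith
        thus "indicator {w..w + real n} y *\<^sub>R exp (- (z * of_real y)) = (if w \<le> y then exp (- (z * of_real y)) else 0)"
          by (auto simp: indicator_def)
      qed
    qed
  qed (auto simp: indicator_def intro!: integrable_norm int)
  moreover have "(CLINT y|lborel. indicator {w..w + real n} y *\<^sub>R exp (- (z * of_real y)))
      = exp (- (z * of_real w)) / z - exp (- (z * of_real (w + real n))) / z" for n
  proof -
    have "((\<lambda>y. - exp (- (z * of_real y)) / z) has_vector_derivative exp (- (z * of_real x))) (at x within S)" for x S
      using z0 by (auto intro!: derivative_eq_intros has_vector_derivative_real_field)
    hence "has_bochner_integral lborel (\<lambda>x. indicator {w..w + real n} x *\<^sub>R exp (- (z * of_real x)))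
        (- exp (- (z * of_real (w + real n))) / z - - exp (- (z * of_real w)) / z)"
      by (intro has_bochner_integral_FTC_Icc) (auto intro!: continuous_intros)
    thus ?thesis by (simp add: has_bochner_integral_integral_eq)
  qed
  moreover have "(\<lambda>n. exp (- (z * of_real w)) / z - exp (- (z * of_real (w + real n))) / z) \<longlonglongrightarrow> exp (- (z * of_real w)) / z - 0 / z"
  proof (intro tendsto_intros z0)
    have "filterlim (\<lambda>n. w + real n) at_top sequentially"
      by (rule filterlim_tendsto_add_at_top[OF tendsto_const filterlim_real_sequentially])
    hence "filterlim (\<lambda>n. Re z * (w + real n)) at_top sequentially"
      by (rule filterlim_tendsto_pos_mult_at_top[OF tendsto_const z])
    hence "(\<lambda>n. exp (- (Re z * (w + real n)))) \<longlonglongrightarrow> 0"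
      by (intro filterlim_compose[OF exp_at_bot]) (simp add: filterlim_uminus_at_top)
    thus "(\<lambda>n. exp (- (z * of_real (w + real n)))) \<longlonglongrightarrow> 0"
      by (intro tendsto_norm_zero_cancel[where f="\<lambda>n. exp (- (z * of_real (w + real n)))"]) simp
  qed
  ultimately show "(CLINT y|lborel. (if w \<le> y then exp (- (z * of_real y)) else 0)) = exp (- (z * of_real w)) / z"
    using LIMSEQ_unique by fastforce
qed

text \<open>Fubini, with e^(-zW)/z as the integral of e^(-zy) over y \<ge> W. Passing from the law
  of \<open>W\<close> to its distribution function gains the factor 1/z and provides a function that
  can serve as a density.\<close>

lemma (in prob_space) laplace_transform_cdf:
  assumes W [measurable]: "W \<in> borel_measurable M" and W0: "\<And>\<omega>. W \<omega> \<ge> 0" and z: "Re z > 0"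
  defines "F \<equiv> \<lambda>y. prob {\<omega> \<in> space M. W \<omega> \<le> y}"
  shows "integrable lborel (\<lambda>y. exp (- (z * of_real y)) * of_real (F y))"
    and "(CLINT y|lborel. exp (- (z * of_real y)) * of_real (F y)) = laplace_transform M W z / z"
proof -
  interpret P: pair_sigma_finite M lborel ..
  define K where "K \<omega> y = (if W \<omega> \<le> y then exp (- (z * of_real y)) else 0)" for \<omega> y
  have Kint: "integrable (M \<Otimes>\<^sub>M lborel) (\<lambda>(\<omega>, y). K \<omega> y)"
  proof (rule P.Fubini_integrable)
    show "(\<lambda>(\<omega>, y). K \<omega> y) \<in> borel_measurable (M \<Otimes>\<^sub>M lborel)" unfolding K_def by measurable
    have n: "norm (case (\<omega>, y) of (\<omega>, y) \<Rightarrow> K \<omega> y) = (if W \<omega> \<le> y then exp (- (Re z * y)) else 0)" for \<omega> y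
      by (simp add: K_def)
    show "integrable M (\<lambda>\<omega>. LINT y|lborel. norm (case (\<omega>, y) of (\<omega>, y) \<Rightarrow> K \<omega> y))"
      unfolding n exp_tail_integral_real(2)[OF z]
      by (rule integrable_const_bound[where B="1 / Re z"])
        (use z W0 in \<open>auto intro!: AE_I2 divide_right_mono\<close>)
    show "AE \<omega> in M. integrable lborel (\<lambda>y. case (\<omega>, y) of (\<omega>, y) \<Rightarrow> K \<omega> y)"
      unfolding K_def using exp_tail_integral(1)[OF z] by auto
  qed
  have inner: "(CLINT \<omega>|M. K \<omega> y) = exp (- (z * of_real y)) * of_real (F y)" for y
  proof -
    have "(CLINT \<omega>|M. K \<omega> y) = (CLINT \<omega>|M. indicator {\<omega> \<in> space M. W \<omega> \<le> y} \<omega> *\<^sub>R exp (- (z * of_real y)))"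
      by (intro Bochner_Integration.integral_cong) (auto simp: K_def indicator_def)
    also have "\<dots> = F y *\<^sub>R exp (- (z * of_real y))"
      unfolding F_def by (subst integral_scaleR_left) (auto simp: less_top [symmetric])
    finally show ?thesis by (simp add: scaleR_conv_of_real mult.commute)
  qed
  show "integrable lborel (\<lambda>y. exp (- (z * of_real y)) * of_real (F y))"
    using P.integrable_snd[OF Kint] by (simp add: inner)
  have "(CLINT y|lborel. exp (- (z * of_real y)) * of_real (F y)) = (CLINT \<omega>|M. CLINT y|lborel. K \<omega> y)"
    using P.Fubini_integral[OF Kint] by (simp add: inner)
  also have "\<dots> = (CLINT \<omega>|M. exp (- (z * of_real (W \<omega>))) / z)"
    unfolding K_def exp_tail_integral(2)[OF z] ..
  also have "\<dots> = laplace_transform M W z / z" by (simp add: laplace_transform_def)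
  finally show "(CLINT y|lborel. exp (- (z * of_real y)) * of_real (F y)) = laplace_transform M W z / z" .
qed

text \<open>The kernel is bounded by \<open>b - a\<close>, so an integrable characteristic function
  turns the symmetric limit of the inversion formula into an absolutely convergent integral.\<close>

lemma (in real_distribution) Levy_inversion_integrable_char:
  assumes \<phi>: "integrable lborel (char M)" and ab: "a \<le> b" and null: "measure M {a} = 0" "measure M {b} = 0"
  shows "complex_of_real (measure M {a<..b})
    = 1 / (2 * pi) * (CLINT t|lborel. (iexp (- (t * a)) - iexp (- (t * b))) / (\<i> * t) * char M t)"
proof -
  let ?G = "\<lambda>t. (iexp (- (t * a)) - iexp (- (t * b))) / (\<i> * complex_of_real t)"
  have G: "norm (?G t) \<le> b - a" for t
    using Levy_Inversion_aux2[of "- b" "- a" t] ab by (cases "t = 0") auto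
  have Gm [measurable]: "?G \<in> borel_measurable borel" by measurable
  have dom: "integrable lborel (\<lambda>t. (b - a) * norm (char M t))" using \<phi> by simp
  have bnd: "norm (?G t * char M t) \<le> (b - a) * norm (char M t)" for t
    unfolding norm_mult by (intro mult_right_mono G) auto
  have "(\<lambda>n. CLBINT t=- real n..real n. ?G t * char M t) \<longlonglongrightarrow> (CLINT t|lborel. ?G t * char M t)"
  proof -
    have "(\<lambda>n. CLINT t|lborel. indicator {- real n<..<real n} t *\<^sub>R (?G t * char M t)) \<longlonglongrightarrow> (CLINT t|lborel. ?G t * char M t)"
    proof (rule integral_dominated_convergence[OF _ _ dom])
      show "AE t in lborel. (\<lambda>n. indicator {- real n<..<real n} t *\<^sub>R (?G t * char M t)) \<longlonglongrightarrow> ?G t * char M t"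
      proof (intro AE_I2 tendsto_eventually)
        fix t
        show "\<forall>\<^sub>F n in sequentially. indicator {- real n<..<real n} t *\<^sub>R (?G t * char M t) = ?G t * char M t"
          using eventually_gt_at_top[of "nat \<lceil>\<bar>t\<bar>\<rceil>"]
        proof eventually_elim
          fix n :: nat assume "n > nat \<lceil>\<bar>t\<bar>\<rceil>"
          hence "\<bar>t\<bar> < real n" by linarith
          thus "indicator {- real n<..<real n} t *\<^sub>R (?G t * char M t) = ?G t * char M t"
            by (simp add: indicator_def abs_less_iff)
        qed
      qed
      show "AE t in lborel. norm (indicator {- real n<..<real n} t *\<^sub>R (?G t * char M t)) \<le> (b - a) * norm (char M t)" for n
      proof (intro AE_I2)
        fix t
        show "norm (indicator {- real n<..<real n} t *\<^sub>R (?G t * char M t)) \<le> (b - a) * norm (char M t)"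
          using bnd[of t] ab by (cases "t \<in> {- real n<..<real n}") (auto intro: mult_nonneg_nonneg)
      qed
    qed measurable
    moreover have "(CLINT t|lborel. indicator {- real n<..<real n} t *\<^sub>R (?G t * char M t)) = (CLBINT t=- real n..real n. ?G t * char M t)" for n
      by (simp add: interval_lebesgue_integral_def set_lebesgue_integral_def)
    ultimately show ?thesis by simp
  qed
  hence "(\<lambda>n. 1 / (2 * pi) * (CLBINT t=- real n..real n. ?G t * char M t)) \<longlonglongrightarrow> 1 / (2 * pi) * (CLINT t|lborel. ?G t * char M t)"
    by (intro tendsto_intros)
  moreover have "(\<lambda>n. 1 / (2 * pi) * (CLBINT t=- real n..real n. ?G t * char M t)) \<longlonglongrightarrow> complex_of_real (measure M {a<..b})"
    using Levy_Inversion[OF ab null] by simp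
  ultimately show ?thesis using LIMSEQ_unique by blast
qed

lemma char_difference_quotient_tendsto:
  assumes t: "t \<noteq> 0" and \<delta>: "\<delta> \<longlonglongrightarrow> 0" "\<And>n. \<delta> n \<noteq> (0::real)"
  shows "(\<lambda>n. (iexp (- (t * a)) - iexp (- (t * (a + \<delta> n)))) / (\<i> * complex_of_real t) / complex_of_real (\<delta> n)) \<longlonglongrightarrow> iexp (- (t * a))"
proof -
  have "((\<lambda>z. exp (- (\<i> * t * z))) has_field_derivative (- (\<i> * t) * exp (- (\<i> * t * complex_of_real a)))) (at (complex_of_real a))"
    by (auto intro!: derivative_eq_intros)
  hence "((\<lambda>h. (exp (- (\<i> * t * (complex_of_real a + h))) - exp (- (\<i> * t * complex_of_real a))) / h) \<longlongrightarrow>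
      - (\<i> * t) * exp (- (\<i> * t * complex_of_real a))) (at 0)"
    by (simp only: DERIV_def)
  moreover have "filterlim (\<lambda>n. complex_of_real (\<delta> n)) (at 0) sequentially"
    using \<delta>(2) tendsto_of_real[OF \<delta>(1), where 'a=complex] by (auto simp: filterlim_at)
  ultimately have "(\<lambda>n. (exp (- (\<i> * t * (complex_of_real a + complex_of_real (\<delta> n)))) - exp (- (\<i> * t * complex_of_real a))) / complex_of_real (\<delta> n))
      \<longlonglongrightarrow> - (\<i> * t) * exp (- (\<i> * t * complex_of_real a))"
    by (rule filterlim_compose)
  moreover have "exp (- (\<i> * t * complex_of_real b)) = iexp (- (t * b))" for b by (simp add: mult.assoc)
  ultimately have "(\<lambda>n. (iexp (- (t * (a + \<delta> n))) - iexp (- (t * a))) / complex_of_real (\<delta> n)) \<longlonglongrightarrow> - (\<i> * t) * iexp (- (t * a))"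
    by (simp only: of_real_add [symmetric])
  hence "(\<lambda>n. (iexp (- (t * (a + \<delta> n))) - iexp (- (t * a))) / complex_of_real (\<delta> n) / (- (\<i> * t))) \<longlonglongrightarrow> - (\<i> * t) * iexp (- (t * a)) / (- (\<i> * t))"
    using t by (intro tendsto_intros) auto
  moreover have "(iexp (- (t * (a + \<delta> n))) - iexp (- (t * a))) / complex_of_real (\<delta> n) / (- (\<i> * t))
     = (iexp (- (t * a)) - iexp (- (t * (a + \<delta> n)))) / (\<i> * complex_of_real t) / complex_of_real (\<delta> n)" for n
    using t \<delta>(2)[of n] by (simp add: divide_simps) 
  ultimately show ?thesis using t by simp
qed

text \<open>Exponential tilting: with l the transform at \<gamma>, the function \<gamma>
  e^(-\<gamma> y) F(y) / l is a probability density whose characteristic function is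
  \<open>\<phi>\<close>. Inversion on the interval from a to a + \<delta>, divided by \<delta>,
  yields its value at a as \<delta> tends to 0.\<close>

lemma (in prob_space) cdf_inversion:
  assumes W [measurable]: "W \<in> borel_measurable M" and W0: "\<And>\<omega>. W \<omega> \<ge> 0" and \<gamma>: "\<gamma> > 0"
    and L0: "laplace_transform M W (of_real \<gamma>) \<noteq> 0"
  defines "F \<equiv> \<lambda>y. prob {\<omega> \<in> space M. W \<omega> \<le> y}"
    and "\<phi> \<equiv> \<lambda>t. of_real \<gamma> / (of_real \<gamma> - \<i> * of_real t) * (laplace_transform M W (of_real \<gamma> - \<i> * of_real t) / laplace_transform M W (of_real \<gamma>))"
  assumes \<phi>int: "integrable lborel \<phi>"
  shows "of_real (exp (- (\<gamma> * a)) * F a * \<gamma>) / laplace_transform M W (of_real \<gamma>)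
    = 1 / (2 * pi) * (CLINT t|lborel. iexp (- (t * a)) * \<phi> t)"
proof -
  define l where "l = expectation (\<lambda>\<omega>. exp (- (\<gamma> * W \<omega>)))"
  have Ll: "laplace_transform M W (of_real \<gamma>) = of_real l"
    unfolding l_def by (rule laplace_transform_of_real)
  have "l \<ge> 0" unfolding l_def by (intro Bochner_Integration.integral_nonneg) auto
  moreover have "l \<noteq> 0" using L0 Ll by auto
  ultimately have l: "l > 0" by simp
  have F0: "F y \<ge> 0" for y by (simp add: F_def)
  have Fmono: "F x \<le> F y" if "x \<le> y" for x y
    unfolding F_def using that by (intro finite_measure_mono) auto
  have Fcdf: "F = cdf (distr M borel W)"
    by (auto simp: F_def cdf_def fun_eq_iff measure_distr vimage_def Int_def conj_commute)
  interpret D: real_distribution "distr M borel W"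
    by (rule real_distribution_distr) simp
  have Fm [measurable]: "F \<in> borel_measurable borel"
    using Fmono by (intro borel_measurable_mono) (auto simp: mono_def)
  define f where "f y = \<gamma> / l * (exp (- (\<gamma> * y)) * F y)" for y
  have fm [measurable]: "f \<in> borel_measurable borel" unfolding f_def by measurable
  have f0: "f y \<ge> 0" for y using \<gamma> l F0 by (simp add: f_def)
  have fc: "complex_of_real (f y) = of_real (\<gamma> / l) * (exp (- (of_real \<gamma> * of_real y)) * of_real (F y))" for y
    by (simp add: f_def exp_of_real [symmetric])
  have lc: "integrable lborel (\<lambda>y. exp (- (z * of_real y)) * of_real (F y))"
    "(CLINT y|lborel. exp (- (z * of_real y)) * of_real (F y)) = laplace_transform M W z / z" if "Re z > 0" for z
    unfolding F_def using laplace_transform_cdf[OF W W0 that] by auto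
  have ge: "Re (complex_of_real \<gamma>) > 0" using \<gamma> by simp
  have fint: "integrable lborel f"
  proof -
    have "integrable lborel (\<lambda>y. complex_of_real (f y))" unfolding fc by (intro integrable_mult_right lc(1) ge)
    thus ?thesis by (simp only: complex_of_real_integrable_eq)
  qed
  have f1: "(LINT y|lborel. f y) = 1"
  proof -
    have "complex_of_real (LINT y|lborel. f y) = (CLINT y|lborel. complex_of_real (f y))" by simp
    also have "\<dots> = of_real (\<gamma> / l) * (laplace_transform M W (of_real \<gamma>) / of_real \<gamma>)"
      unfolding fc by (subst integral_mult_right_zero) (simp only: lc(2)[OF ge])
    also have "\<dots> = 1" using l \<gamma> by (simp add: Ll)
    finally show ?thesis by (simp only: of_real_eq_1_iff)
  qed
  define \<mu> where "\<mu> = density lborel (\<lambda>y. ennreal (f y))"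
  have "prob_space \<mu>"
  proof
    have "emeasure \<mu> (space \<mu>) = (\<integral>\<^sup>+ y. ennreal (f y) \<partial>lborel)"
      unfolding \<mu>_def by (subst emeasure_density) (auto intro!: nn_integral_cong)
    also have "\<dots> = 1" using nn_integral_eq_integral[OF fint] f0 f1 by simp
    finally show "emeasure \<mu> (space \<mu>) = 1" .
  qed
  then interpret \<mu>: real_distribution \<mu>
    by (auto simp: real_distribution_def real_distribution_axioms_def \<mu>_def)
  have char: "char \<mu> = \<phi>"
  proof
    fix t
    have z: "Re (complex_of_real \<gamma> - \<i> * of_real t) > 0" using \<gamma> by simp
    have "char \<mu> t = (CLINT y|lborel. f y *\<^sub>R iexp (t * y))"
      unfolding char_def \<mu>_def using f0 by (subst integral_density) auto
    also have "\<dots> = (CLINT y|lborel. of_real (\<gamma> / l) * (exp (- ((of_real \<gamma> - \<i> * of_real t) * of_real y)) * of_real (F y)))"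
      unfolding scaleR_conv_of_real fc
    proof (intro Bochner_Integration.integral_cong refl)
      fix y
      have "exp (- ((of_real \<gamma> - \<i> * of_real t) * of_real y)) = exp (- (of_real \<gamma> * of_real y)) * iexp (t * y)"
        by (simp add: exp_add [symmetric] algebra_simps)
      thus "of_real (\<gamma> / l) * (exp (- (of_real \<gamma> * of_real y)) * of_real (F y)) * iexp (t * y)
        = of_real (\<gamma> / l) * (exp (- ((of_real \<gamma> - \<i> * of_real t) * of_real y)) * of_real (F y))"
        by (simp only: mult_ac)
    qed
    also have "\<dots> = of_real (\<gamma> / l) * (laplace_transform M W (of_real \<gamma> - \<i> * of_real t) / (of_real \<gamma> - \<i> * of_real t))"
      by (subst integral_mult_right_zero) (simp only: lc(2)[OF z])
    also have "\<dots> = \<phi> t" by (simp add: \<phi>_def Ll mult_ac)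
    finally show "char \<mu> t = \<phi> t" .
  qed
  have null: "measure \<mu> {y} = 0" for y
  proof -
    have "emeasure \<mu> {y} = 0" unfolding \<mu>_def
      by (subst emeasure_density) (auto simp: nn_integral_0_iff_AE intro!: AE_I[where N="{y}"])
    thus ?thesis by (simp add: measure_def)
  qed
  define \<delta> where "\<delta> n = 1 / real (Suc n)" for n
  have \<delta>0: "\<delta> n > 0" for n by (simp add: \<delta>_def)
  have \<delta>lim: "\<delta> \<longlonglongrightarrow> 0" unfolding \<delta>_def by (rule LIMSEQ_Suc[OF lim_1_over_n])
  let ?Q = "\<lambda>n t. (iexp (- (t * a)) - iexp (- (t * (a + \<delta> n)))) / (\<i> * complex_of_real t) / complex_of_real (\<delta> n)"
  have "complex_of_real (measure \<mu> {a<..a + \<delta> n} / \<delta> n) = 1 / (2 * pi) * (CLINT t|lborel. ?Q n t * \<phi> t)" for n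
  proof -
    have "complex_of_real (measure \<mu> {a<..a + \<delta> n})
      = 1 / (2 * pi) * (CLINT t|lborel. (iexp (- (t * a)) - iexp (- (t * (a + \<delta> n)))) / (\<i> * t) * \<phi> t)"
      using \<mu>.Levy_inversion_integrable_char[of a "a + \<delta> n"] \<phi>int char null \<delta>0[of n] by simp
    hence "complex_of_real (measure \<mu> {a<..a + \<delta> n} / \<delta> n)
      = 1 / (2 * pi) * ((CLINT t|lborel. (iexp (- (t * a)) - iexp (- (t * (a + \<delta> n)))) / (\<i> * t) * \<phi> t) / complex_of_real (\<delta> n))"
      by simp
    also have "(CLINT t|lborel. (iexp (- (t * a)) - iexp (- (t * (a + \<delta> n)))) / (\<i> * t) * \<phi> t) / complex_of_real (\<delta> n)
        = (CLINT t|lborel. (iexp (- (t * a)) - iexp (- (t * (a + \<delta> n)))) / (\<i> * t) * \<phi> t / complex_of_real (\<delta> n))"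
      by (rule integral_divide_zero [symmetric])
    also have "\<dots> = (CLINT t|lborel. ?Q n t * \<phi> t)"
      by (intro Bochner_Integration.integral_cong) (auto simp: mult_ac)
    finally show ?thesis .
  qed
  moreover have "(\<lambda>n. CLINT t|lborel. ?Q n t * \<phi> t) \<longlonglongrightarrow> (CLINT t|lborel. iexp (- (t * a)) * \<phi> t)"
  proof (rule integral_dominated_convergence[where w="\<lambda>t. norm (\<phi> t)"])
    have \<phi>m [measurable]: "\<phi> \<in> borel_measurable borel" using \<phi>int by (auto dest: borel_measurable_integrable)
    show "(\<lambda>t. iexp (- (t * a)) * \<phi> t) \<in> borel_measurable lborel" by measurable
    show "(\<lambda>t. ?Q n t * \<phi> t) \<in> borel_measurable lborel" for n by measurable
    show "integrable lborel (\<lambda>t. norm (\<phi> t))" using \<phi>int by simp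
    have "AE t in lborel. t \<noteq> (0::real)" by (rule AE_lborel_singleton)
    thus "AE t in lborel. (\<lambda>n. ?Q n t * \<phi> t) \<longlonglongrightarrow> iexp (- (t * a)) * \<phi> t"
    proof eventually_elim
      fix t :: real assume t: "t \<noteq> 0"
      show "(\<lambda>n. ?Q n t * \<phi> t) \<longlonglongrightarrow> iexp (- (t * a)) * \<phi> t"
        using \<delta>0 by (intro tendsto_mult tendsto_const char_difference_quotient_tendsto t \<delta>lim) (metis less_irrefl)
    qed
    show "AE t in lborel. norm (?Q n t * \<phi> t) \<le> norm (\<phi> t)" for n
    proof (intro AE_I2)
      fix t
      have "norm ((iexp (- (t * a)) - iexp (- (t * (a + \<delta> n)))) / (\<i> * complex_of_real t)) \<le> \<delta> n"
      proof (cases "t = 0")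
        case False
        have "- (a + \<delta> n) \<le> - a" using \<delta>0[of n] by simp
        from Levy_Inversion_aux2[OF this False] show ?thesis by (simp only: mult_minus_right)
      qed (use \<delta>0[of n] in auto)
      hence "norm (?Q n t) \<le> 1"
        using \<delta>0[of n] unfolding norm_divide[of _ "complex_of_real (\<delta> n)"] by simp
      thus "norm (?Q n t * \<phi> t) \<le> norm (\<phi> t)"
        unfolding norm_mult using mult_right_mono[of "norm (?Q n t)" 1 "norm (\<phi> t)"] by simp
    qed
  qed
  ultimately have lim1: "(\<lambda>n. complex_of_real (measure \<mu> {a<..a + \<delta> n} / \<delta> n)) \<longlonglongrightarrow> 1 / (2 * pi) * (CLINT t|lborel. iexp (- (t * a)) * \<phi> t)"
    by (simp only:) (intro tendsto_intros)
  \<comment> \<open>\<open>F\<close> increases and the exponential decreases, so taking each factor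
    at its extreme end sandwiches the mean density. The intervals lie to the right of
    \<open>a\<close>, so right continuity of \<open>F\<close> closes the sandwich.\<close>
  have bounds: "\<gamma> / l * (exp (- (\<gamma> * (a + \<delta> n))) * F a) \<le> measure \<mu> {a<..a + \<delta> n} / \<delta> n \<and>
      measure \<mu> {a<..a + \<delta> n} / \<delta> n \<le> \<gamma> / l * (exp (- (\<gamma> * a)) * F (a + \<delta> n))" for n
  proof -
    let ?I = "{a<..a + \<delta> n}"
    have em: "ennreal (measure \<mu> ?I) = (\<integral>\<^sup>+ y. ennreal (f y) * indicator ?I y \<partial>lborel)"
      unfolding \<mu>.emeasure_eq_measure [symmetric] unfolding \<mu>_def by (subst emeasure_density) auto
    have cst: "(\<integral>\<^sup>+ y. ennreal c * indicator ?I y \<partial>lborel) = ennreal (c * \<delta> n)" if "c \<ge> 0" for c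
      using that \<delta>0[of n] by (simp add: nn_integral_cmult_indicator ennreal_mult less_imp_le)
    have lo: "\<gamma> / l * (exp (- (\<gamma> * (a + \<delta> n))) * F a) \<le> f y" if "y \<in> ?I" for y
      unfolding f_def using that \<gamma> l F0 Fmono[of a y] by (intro mult_left_mono mult_mono) auto
    have hi: "f y \<le> \<gamma> / l * (exp (- (\<gamma> * a)) * F (a + \<delta> n))" if "y \<in> ?I" for y
      unfolding f_def using that \<gamma> l F0 Fmono[of y "a + \<delta> n"] by (intro mult_left_mono mult_mono) auto
    have "ennreal (\<gamma> / l * (exp (- (\<gamma> * (a + \<delta> n))) * F a) * \<delta> n) \<le> ennreal (measure \<mu> ?I)"
      unfolding em using \<gamma> l F0 lo
      by (subst cst [symmetric]) (auto intro!: nn_integral_mono ennreal_leI simp: indicator_def)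
    hence 1: "\<gamma> / l * (exp (- (\<gamma> * (a + \<delta> n))) * F a) * \<delta> n \<le> measure \<mu> ?I" by simp
    have "ennreal (measure \<mu> ?I) \<le> ennreal (\<gamma> / l * (exp (- (\<gamma> * a)) * F (a + \<delta> n)) * \<delta> n)"
      unfolding em using \<gamma> l F0 hi
      by (subst cst [symmetric]) (auto intro!: nn_integral_mono ennreal_leI simp: indicator_def)
    moreover have "0 \<le> \<gamma> / l * (exp (- (\<gamma> * a)) * F (a + \<delta> n)) * \<delta> n"
      using \<gamma> l F0 \<delta>0[of n] by (intro mult_nonneg_nonneg divide_nonneg_nonneg) (auto intro: less_imp_le)
    ultimately have 2: "measure \<mu> ?I \<le> \<gamma> / l * (exp (- (\<gamma> * a)) * F (a + \<delta> n)) * \<delta> n" by simp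
    show ?thesis using 1 2 \<delta>0[of n] by (simp only: pos_le_divide_eq pos_divide_le_eq)
  qed
  have alim: "(\<lambda>n. a + \<delta> n) \<longlonglongrightarrow> a" using tendsto_add[OF tendsto_const \<delta>lim, of a] by simp
  have "filterlim (\<lambda>n. a + \<delta> n) (at_right a) sequentially"
    using alim \<delta>0 by (auto simp: filterlim_at less_imp_neq[symmetric, OF \<delta>0])
  moreover have "(F \<longlongrightarrow> F a) (at_right a)"
    using D.cdf_is_right_cont[of a] by (simp add: Fcdf continuous_within)
  ultimately have Flim: "(\<lambda>n. F (a + \<delta> n)) \<longlonglongrightarrow> F a" by (rule filterlim_compose[rotated])
  have lim2: "(\<lambda>n. measure \<mu> {a<..a + \<delta> n} / \<delta> n) \<longlonglongrightarrow> \<gamma> / l * (exp (- (\<gamma> * a)) * F a)"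
  proof (rule tendsto_sandwich)
    show "(\<lambda>n. \<gamma> / l * (exp (- (\<gamma> * (a + \<delta> n))) * F a)) \<longlonglongrightarrow> \<gamma> / l * (exp (- (\<gamma> * a)) * F a)"
      using l by (intro tendsto_intros alim) auto
    show "(\<lambda>n. \<gamma> / l * (exp (- (\<gamma> * a)) * F (a + \<delta> n))) \<longlonglongrightarrow> \<gamma> / l * (exp (- (\<gamma> * a)) * F a)"
      using l by (intro tendsto_intros Flim) auto
  qed (use bounds in auto)
  have "complex_of_real (\<gamma> / l * (exp (- (\<gamma> * a)) * F a)) = 1 / (2 * pi) * (CLINT t|lborel. iexp (- (t * a)) * \<phi> t)"
    using LIMSEQ_unique[OF tendsto_of_real[OF lim2] lim1] .
  thus ?thesis by (simp add: Ll mult_ac)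
qed

section \<open>The saddle point\<close>

lemma csqrt_of_real_mult:
  assumes "c > 0"
  shows "csqrt (of_real c * z) = of_real (sqrt c) * csqrt z"
proof (rule csqrt_unique)
  have "(complex_of_real (sqrt c))\<^sup>2 = of_real c"
    using assms unfolding of_real_power [symmetric] by simp
  thus "(of_real (sqrt c) * csqrt z)\<^sup>2 = of_real c * z" by (simp add: power_mult_distrib)
  have "Re (of_real (sqrt c) * csqrt z) = sqrt c * Re (csqrt z)"
    "Im (of_real (sqrt c) * csqrt z) = sqrt c * Im (csqrt z)" by (simp_all del: csqrt.simps)
  thus "0 < Re (of_real (sqrt c) * csqrt z) \<or> Re (of_real (sqrt c) * csqrt z) = 0 \<and> 0 \<le> Im (of_real (sqrt c) * csqrt z)"
    using csqrt_principal[of z] assms by (auto simp del: csqrt.simps)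
qed

text \<open>Multiplied by \<open>u\<^sup>2 / 2\<close> this is what remains of the root of 1 - \<i>u
  after its linear Taylor part 1 - \<i>u/2, in a form without singularity at 0.\<close>

definition saddle_kernel :: "real \<Rightarrow> complex" where
  "saddle_kernel u = 1 / (csqrt (1 - \<i> * of_real u) + 1)\<^sup>2"

lemma saddle_kernel_0: "saddle_kernel 0 = 1 / 4"
  by (simp add: saddle_kernel_def)

lemma csqrt_plus_1_nonzero:
  assumes "Re z \<ge> 0" shows "csqrt z + 1 \<noteq> 0"
proof
  assume "csqrt z + 1 = 0"
  hence "Re (csqrt z + 1) = 0" by simp
  moreover have "Re (csqrt z) \<ge> 0" using csqrt_principal[of z] by auto
  ultimately show False by (simp del: csqrt.simps)
qed

text \<open>For the root c one has \<i>u = 1 - c^2, which makes the left side the perfect square -(c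
  - 1)^2 / 2; then c - 1 = -\<i>u / (c + 1).\<close>

lemma saddle_exponent:
  "csqrt (1 - \<i> * of_real u) - 1 + \<i> * of_real u / 2 = (of_real u)\<^sup>2 * saddle_kernel u / 2"
proof -
  define c where "c = csqrt (1 - \<i> * of_real u)"
  have c2: "c\<^sup>2 = 1 - \<i> * of_real u" by (simp add: c_def)
  have c1: "c + 1 \<noteq> 0" unfolding c_def by (rule csqrt_plus_1_nonzero) simp
  have "(c - 1) * (c + 1) = - (\<i> * of_real u)" using c2 by (simp add: algebra_simps power2_eq_square)
  hence "((c - 1) * (c + 1))\<^sup>2 = - ((of_real u)\<^sup>2)" by (simp add: power_mult_distrib)
  hence "(c - 1)\<^sup>2 = - ((of_real u)\<^sup>2) / (c + 1)\<^sup>2" using c1 unfolding power_mult_distrib by (intro eq_divide_imp) auto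
  moreover have iu: "\<i> * of_real u = 1 - c\<^sup>2" using c2 by simp
  have "c - 1 + \<i> * of_real u / 2 = - (c - 1)\<^sup>2 / 2"
    unfolding iu by (simp add: power2_eq_square field_simps)
  ultimately show ?thesis by (simp add: saddle_kernel_def c_def)
qed

text \<open>For the root c, Re (c^2) = 1 gives Re ((c + 1)^2) = 2 Re c + 2 and norm c \<le> 2 Re c.
  The numerator of the real part is thus at least 1 + norm c, against a denominator of at most (1 +
  norm c)^4.\<close>

lemma Re_saddle_kernel_ge:
  "Re (saddle_kernel u) \<ge> 1 / (1 + sqrt (1 + \<bar>u\<bar>)) ^ 3"
proof -
  define c where "c = csqrt (1 - \<i> * of_real u)"
  have c2: "c\<^sup>2 = 1 - \<i> * of_real u" by (simp add: c_def)
  define X Y where "X = Re c" and "Y = Im c"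
  have XY: "X\<^sup>2 - Y\<^sup>2 = 1" using arg_cong[OF c2, of Re] by (simp add: Re_power2 X_def Y_def)
  have X0: "X \<ge> 0" unfolding X_def c_def using csqrt_principal[of "1 - \<i> * of_real u"] by auto
  have nc: "norm c \<le> sqrt (1 + \<bar>u\<bar>)"
  proof -
    have "(norm c)\<^sup>2 = norm (1 - \<i> * complex_of_real u)" using c2 by (metis norm_power)
    also have "\<dots> \<le> 1 + \<bar>u\<bar>" using norm_triangle_ineq4[of 1 "\<i> * complex_of_real u"] by (simp add: norm_mult)
    finally show ?thesis by (rule real_le_rsqrt)
  qed
  have X1: "2 * X + 2 \<ge> 1 + norm c"
  proof -
    have "(norm c)\<^sup>2 = X\<^sup>2 + Y\<^sup>2" by (simp add: cmod_power2 X_def Y_def)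
    also have "\<dots> \<le> 4 * X\<^sup>2" using XY zero_le_power2[of X] zero_le_power2[of Y] by linarith
    also have "\<dots> = (2 * X)\<^sup>2" by (simp add: power_mult_distrib)
    finally have "(norm c)\<^sup>2 \<le> (2 * X)\<^sup>2" .
    hence "norm c \<le> 2 * X" by (rule power2_le_imp_le) (use X0 in simp)
    thus ?thesis by simp
  qed
  have sk: "saddle_kernel u = inverse ((c + 1)\<^sup>2)" by (simp add: saddle_kernel_def c_def inverse_eq_divide)
  have "Re ((c + 1)\<^sup>2) = 2 * X + 2" using XY by (simp add: Re_power2 X_def Y_def power2_eq_square algebra_simps)
  moreover have "(Re ((c + 1)\<^sup>2))\<^sup>2 + (Im ((c + 1)\<^sup>2))\<^sup>2 = norm (c + 1) ^ 4"
    unfolding cmod_power2 [symmetric] norm_power by simp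
  ultimately have Re: "Re (saddle_kernel u) = (2 * X + 2) / norm (c + 1) ^ 4"
    unfolding sk by (simp only: inverse_complex.simps)
  have c1: "norm (c + 1) > 0"
    using csqrt_plus_1_nonzero[of "1 - \<i> * of_real u"] by (simp add: c_def)
  have ncp: "norm (c + 1) \<le> 1 + norm c" using norm_triangle_ineq[of c 1] by simp
  have "1 / (1 + sqrt (1 + \<bar>u\<bar>)) ^ 3 \<le> 1 / (1 + norm c) ^ 3"
    using nc by (intro divide_left_mono power_mono) (auto intro!: mult_pos_pos zero_less_power add_pos_nonneg)
  also have "\<dots> = (1 + norm c) / (1 + norm c) ^ 4"
    using norm_ge_zero[of c] by (simp add: power_eq_if)
  also have "\<dots> \<le> (2 * X + 2) / norm (c + 1) ^ 4"
    using X1 ncp c1 X0 by (intro frac_le power_mono) auto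
  finally show ?thesis unfolding Re .
qed

lemma continuous_on_saddle_kernel: "continuous_on UNIV saddle_kernel"
  unfolding saddle_kernel_def using csqrt_plus_1_nonzero
  by (intro continuous_intros continuous_on_compose2[OF continuous_on_csqrt])
    (auto simp: complex_nonpos_Reals_iff)

lemma exp_neg_le_inverse_power4:
  assumes "y > (0::real)"
  shows "exp (- y) \<le> 256 / y ^ 4"
proof -
  have "(y / 4) ^ 4 \<le> (1 + y / 4) ^ 4" using assms by (intro power_mono) auto
  also have "\<dots> \<le> exp y" using exp_ge_one_plus_x_over_n_power_n[of 4 y] assms by simp
  finally have "y ^ 4 / 256 \<le> exp y" by (simp add: power_divide)
  thus ?thesis using assms by (simp add: exp_minus field_simps)
qed

text \<open>A majorant independent of \<tau>. For |v| > 1, bounding |v/\<tau>| by |v| leaves an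
  exponent of at least k/27 times the square root of |v|, where 27 is 3^3 from
  \<open>(3 * w) ^ 3\<close>; the fourth-power bound for the exponential turns this into decay like
  1/v^2.\<close>

lemma saddle_kernel_dominated:
  fixes k v \<tau> :: real
  assumes k: "k > 0" and \<tau>: "\<tau> \<ge> 1"
  shows "exp (- (k * v\<^sup>2 * Re (saddle_kernel (v / \<tau>)))) \<le> (2 + 512 / (k / 27) ^ 4) * inverse (1 + v\<^sup>2)"
proof -
  have ReK: "Re (saddle_kernel (v / \<tau>)) \<ge> 1 / (1 + sqrt (1 + \<bar>v / \<tau>\<bar>)) ^ 3" by (rule Re_saddle_kernel_ge)
  have Re0: "Re (saddle_kernel (v / \<tau>)) \<ge> 0" by (rule order_trans[OF _ ReK]) simp
  have pos: "1 + v\<^sup>2 > 0" by (simp add: add_pos_nonneg)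
  show ?thesis
  proof (cases "\<bar>v\<bar> \<le> 1")
    case True
    hence "v\<^sup>2 \<le> 1" by (simp add: abs_square_le_1)
    hence "1 \<le> 2 * inverse (1 + v\<^sup>2)" using pos by (simp add: field_simps)
    moreover have "exp (- (k * v\<^sup>2 * Re (saddle_kernel (v / \<tau>)))) \<le> 1"
      using mult_nonneg_nonneg[OF _ Re0, of "k * v\<^sup>2"] k by simp
    moreover have "0 \<le> 512 / (k / 27) ^ 4 * inverse (1 + v\<^sup>2)" using k pos by simp
    ultimately show ?thesis unfolding distrib_right by linarith
  next
    case False
    define w where "w = sqrt \<bar>v\<bar>"
    have w: "w \<ge> 1" using False by (simp add: w_def)
    have w2: "w\<^sup>2 = \<bar>v\<bar>" by (simp add: w_def)
    have w4: "w ^ 4 = v\<^sup>2" using w2 by (metis power2_abs power_mult numeral_Bit0 mult_2 power_even_eq)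
    have "\<bar>v / \<tau>\<bar> \<le> \<bar>v\<bar>" using \<tau> by (simp add: abs_divide divide_le_eq mult_le_cancel_left1)
    hence "1 + \<bar>v / \<tau>\<bar> \<le> (2 * w)\<^sup>2" using False w2 by (simp add: power_mult_distrib)
    hence "sqrt (1 + \<bar>v / \<tau>\<bar>) \<le> 2 * w" using w by (intro real_le_lsqrt) auto
    hence "1 + sqrt (1 + \<bar>v / \<tau>\<bar>) \<le> 3 * w" using w by linarith
    hence "(1 + sqrt (1 + \<bar>v / \<tau>\<bar>)) ^ 3 \<le> (3 * w) ^ 3" by (intro power_mono) auto
    hence "1 / (3 * w) ^ 3 \<le> 1 / (1 + sqrt (1 + \<bar>v / \<tau>\<bar>)) ^ 3"
      using w by (intro divide_left_mono) (auto intro!: mult_pos_pos zero_less_power add_pos_nonneg)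
    hence "1 / (3 * w) ^ 3 \<le> Re (saddle_kernel (v / \<tau>))" using ReK by linarith
    hence "k * v\<^sup>2 * (1 / (3 * w) ^ 3) \<le> k * v\<^sup>2 * Re (saddle_kernel (v / \<tau>))" using k by (intro mult_left_mono) auto
    moreover have "k * v\<^sup>2 * (1 / (3 * w) ^ 3) = k / 27 * w"
      using w unfolding w4 [symmetric] by (simp add: power_mult_distrib eval_nat_numeral)
    ultimately have "k / 27 * w \<le> k * v\<^sup>2 * Re (saddle_kernel (v / \<tau>))" by linarith
    hence "exp (- (k * v\<^sup>2 * Re (saddle_kernel (v / \<tau>)))) \<le> exp (- (k / 27 * w))"
      unfolding exp_le_cancel_iff neg_le_iff_le .
    also have "\<dots> \<le> 256 / (k / 27 * w) ^ 4"
      using k w by (intro exp_neg_le_inverse_power4) simp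
    also have "\<dots> = 256 / (k / 27) ^ 4 * (1 / v\<^sup>2)" unfolding power_mult_distrib w4 by simp
    also have "\<dots> \<le> 256 / (k / 27) ^ 4 * (2 * inverse (1 + v\<^sup>2))"
    proof (intro mult_left_mono)
      have "1 \<le> v\<^sup>2" using False abs_square_le_1[of v] by linarith
      moreover have "v \<noteq> 0" using False by auto
      ultimately show "1 / v\<^sup>2 \<le> 2 * inverse (1 + v\<^sup>2)" using pos by (simp add: field_simps)
    qed simp
    also have "\<dots> \<le> (2 + 512 / (k / 27) ^ 4) * inverse (1 + v\<^sup>2)" using pos by (simp add: distrib_right)
    finally show ?thesis .
  qed
qed

lemma gaussian_integral:
  fixes k :: real
  assumes "k > 0"
  shows "(LINT v|lborel. exp (- (k * v\<^sup>2))) = sqrt (pi / k)"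
proof -
  define \<sigma> where "\<sigma> = 1 / sqrt (2 * k)"
  have \<sigma>: "\<sigma> > 0" using assms by (simp add: \<sigma>_def)
  have s2: "\<sigma>\<^sup>2 = 1 / (2 * k)" using assms by (simp add: \<sigma>_def power_divide)
  have "exp (- (k * v\<^sup>2)) = sqrt (pi / k) * normal_density 0 \<sigma> v" for v
    using assms by (simp add: normal_density_def s2 field_simps)
  hence "(LINT v|lborel. exp (- (k * v\<^sup>2))) = (LINT v|lborel. sqrt (pi / k) * normal_density 0 \<sigma> v)" by simp
  thus ?thesis using \<sigma> by simp
qed

lemma integrable_inverse_1_plus_square_lborel: "integrable lborel (\<lambda>v::real. inverse (1 + v\<^sup>2))"
  using integrable_inverse_1_plus_square by (simp add: set_integrable_def einterval_def)


text \<open>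
  With the saddle point at \<open>\<gamma> = \<tau>\<^sup>4\<close>, the substitution \<open>t = \<tau>\<^sup>3v\<close> turns the phase of the inversion
  integral into \<open>-(A/\<surd>2) v\<^sup>2\<close> times the saddle kernel at \<open>v/\<tau>\<close>.
\<close>

lemma (in prob_space) cdf_asymptotics_of_laplace_transform:
  fixes A A0 B \<gamma>0 :: real
  assumes W [measurable]: "W \<in> borel_measurable M" and W0: "\<And>\<omega>. W \<omega> \<ge> 0"
    and A: "A > 0" and A0: "A0 > 0" and \<gamma>0: "\<gamma>0 > 0"
    and L: "\<And>s. Re s \<ge> \<gamma>0 \<Longrightarrow> laplace_transform M W s \<noteq> 0 \<and>
      norm (complex_of_real A0 * exp (- (csqrt (2 * s) * complex_of_real A)) / laplace_transform M W s - 1) \<le> B / sqrt (Re s)"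
  shows "((\<lambda>\<tau>. prob {\<omega> \<in> space M. W \<omega> \<le> A / (sqrt 2 * \<tau>\<^sup>2)} * \<tau> * exp (A * \<tau>\<^sup>2 / sqrt 2))
     \<longlongrightarrow> A0 / (2 * pi) * sqrt (pi / (A * sqrt 2 / 8))) at_top"
proof -
  define \<Lambda> where "\<Lambda> s = complex_of_real A0 * exp (- (csqrt (2 * s) * complex_of_real A))" for s
  define H where "H s = \<Lambda> s / laplace_transform M W s" for s
  define k where "k = A * sqrt 2 / 2"
  have k: "k > 0" using A by (simp add: k_def)
  \<comment> \<open>From here on \<open>H\<close> is within 1/2 of 1 on the whole line, so a
    quotient of two of its values has norm at most 3, the factor in the majorant
    \<open>w\<close>.\<close>
  define \<tau>0 where "\<tau>0 = max 1 (max \<gamma>0 (2 * \<bar>B\<bar>))"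
  have \<tau>0: "\<tau> \<ge> 1" "\<tau> ^ 4 \<ge> \<gamma>0" "B / sqrt (\<tau> ^ 4) \<le> 1 / 2" if "\<tau> \<ge> \<tau>0" for \<tau>
  proof -
    show 1: "\<tau> \<ge> 1" using that by (simp add: \<tau>0_def)
    have le: "\<tau> \<le> \<tau> ^ n" if "n > 0" for n using 1 that by (intro self_le_power) auto
    show "\<tau> ^ 4 \<ge> \<gamma>0" using le[of 4] that by (simp add: \<tau>0_def)
    have "sqrt (\<tau> ^ 4) = \<tau>\<^sup>2" by (intro real_sqrt_unique) auto
    moreover have "2 * \<bar>B\<bar> \<le> \<tau>\<^sup>2" using le[of 2] that by (simp add: \<tau>0_def)
    ultimately show "B / sqrt (\<tau> ^ 4) \<le> 1 / 2" using 1 by (simp add: field_simps)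
  qed
  have sqrt4: "sqrt (\<tau> ^ 4) = \<tau>\<^sup>2" for \<tau> :: real by (intro real_sqrt_unique) auto
  have H1: "norm (H s - 1) \<le> B / sqrt (Re s)" "laplace_transform M W s \<noteq> 0" "\<Lambda> s \<noteq> 0" "H s \<noteq> 0" if "Re s \<ge> \<gamma>0" for s
    using L[OF that] A0 by (auto simp: H_def \<Lambda>_def)
  define sp where "sp \<tau> v = complex_of_real (\<tau> ^ 4) - \<i> * of_real (\<tau> ^ 3 * v)" for \<tau> v
  define g where "g \<tau> v = 1 / (1 - \<i> * of_real (v / \<tau>)) * (H (of_real (\<tau> ^ 4)) / H (sp \<tau> v))
      * exp (- (of_real (k * v\<^sup>2) * saddle_kernel (v / \<tau>)))" for \<tau> v
  define \<phi> where "\<phi> \<tau> t = of_real (\<tau> ^ 4) / (of_real (\<tau> ^ 4) - \<i> * of_real t) *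
      (laplace_transform M W (of_real (\<tau> ^ 4) - \<i> * of_real t) / laplace_transform M W (of_real (\<tau> ^ 4)))" for \<tau> t
  \<comment> \<open>The level for which \<open>\<tau> ^ 4\<close> is the stationary point of s x - A
    sqrt(2s).\<close>
  define x where "x \<tau> = A / (sqrt 2 * \<tau>\<^sup>2)" for \<tau>
  have g_eq: "g \<tau> v = iexp (- (\<tau> ^ 3 * v * x \<tau>)) * \<phi> \<tau> (\<tau> ^ 3 * v)" if \<tau>: "\<tau> \<ge> \<tau>0" for \<tau> v
  proof -
    note t = \<tau>0[OF \<tau>]
    have tp: "\<tau> > 0" using t(1) by simp
    define u where "u = v / \<tau>"
    have v: "v = u * \<tau>" using tp by (simp add: u_def)
    define c where "c = csqrt (1 - \<i> * of_real u)"
    have s: "sp \<tau> v = of_real (\<tau> ^ 4) * (1 - \<i> * of_real u)"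
      by (simp add: sp_def v algebra_simps eval_nat_numeral)
    have nz: "1 - \<i> * complex_of_real u \<noteq> 0" by (simp add: complex_eq_iff)
    have sq: "sqrt (2 * \<tau> ^ 4) = sqrt 2 * \<tau>\<^sup>2" by (simp add: real_sqrt_mult sqrt4)
    have cs: "csqrt (2 * sp \<tau> v) = of_real (sqrt 2 * \<tau>\<^sup>2) * c"
    proof -
      have "2 * sp \<tau> v = of_real (2 * \<tau> ^ 4) * (1 - \<i> * of_real u)" by (simp add: s)
      thus ?thesis using csqrt_of_real_mult[of "2 * \<tau> ^ 4" "1 - \<i> * of_real u"] tp unfolding sq c_def by (simp add: mult.assoc)
    qed
    have cs0: "csqrt (2 * of_real (\<tau> ^ 4)) = of_real (sqrt 2 * \<tau>\<^sup>2)"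
      using csqrt_of_real_mult[of "2 * \<tau> ^ 4" 1] tp unfolding sq by simp
    have Res: "Re (sp \<tau> v) \<ge> \<gamma>0" "Re (complex_of_real (\<tau> ^ 4)) \<ge> \<gamma>0" using t by (simp_all add: sp_def)
    have LH: "laplace_transform M W s = \<Lambda> s / H s" if "Re s \<ge> \<gamma>0" for s
      using H1[OF that] by (simp add: H_def)
    have "laplace_transform M W (sp \<tau> v) / laplace_transform M W (of_real (\<tau> ^ 4))
        = H (of_real (\<tau> ^ 4)) / H (sp \<tau> v) * (\<Lambda> (sp \<tau> v) / \<Lambda> (of_real (\<tau> ^ 4)))"
      unfolding LH[OF Res(1)] LH[OF Res(2)] by simp
    also have "\<Lambda> (sp \<tau> v) / \<Lambda> (of_real (\<tau> ^ 4)) = exp (- (of_real (sqrt 2 * \<tau>\<^sup>2 * A) * (c - 1)))"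
      unfolding \<Lambda>_def cs cs0 using A0 by (simp add: exp_diff [symmetric] algebra_simps)
    finally have Lr: "laplace_transform M W (sp \<tau> v) / laplace_transform M W (of_real (\<tau> ^ 4))
        = H (of_real (\<tau> ^ 4)) / H (sp \<tau> v) * exp (- (of_real (sqrt 2 * \<tau>\<^sup>2 * A) * (c - 1)))" .
    have fr: "of_real (\<tau> ^ 4) / sp \<tau> v = 1 / (1 - \<i> * of_real u)" unfolding s using tp by simp
    have ph: "\<phi> \<tau> (\<tau> ^ 3 * v) = 1 / (1 - \<i> * of_real u) *
        (H (of_real (\<tau> ^ 4)) / H (sp \<tau> v) * exp (- (of_real (sqrt 2 * \<tau>\<^sup>2 * A) * (c - 1))))"
      unfolding \<phi>_def sp_def [symmetric] Lr fr ..
    have xe: "\<tau> ^ 3 * v * x \<tau> = sqrt 2 * \<tau>\<^sup>2 * A * (u / 2)"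
    proof -
      have s2: "1 / sqrt 2 = sqrt 2 / 2" by (simp add: field_simps)
      have "\<tau> ^ 3 * v * x \<tau> = \<tau>\<^sup>2 * A * u * (1 / sqrt 2)"
        using tp by (simp add: x_def v eval_nat_numeral)
      thus ?thesis unfolding s2 by simp
    qed
    \<comment> \<open>By the choice of \<open>x\<close> the oscillating factor contributes exactly
      \<i>u/2, which cancels the linear part of the root and leaves the kernel.\<close>
    have "of_real (sqrt 2 * \<tau>\<^sup>2 * A) * (c - 1) + \<i> * of_real (\<tau> ^ 3 * v * x \<tau>)
        = of_real (sqrt 2 * \<tau>\<^sup>2 * A) * (c - 1 + \<i> * of_real u / 2)"
      unfolding xe by (simp add: algebra_simps)
    also have "\<dots> = of_real (sqrt 2 * \<tau>\<^sup>2 * A) * ((of_real u)\<^sup>2 * saddle_kernel u / 2)"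
      unfolding c_def saddle_exponent ..
    also have "\<dots> = of_real (k * v\<^sup>2) * saddle_kernel u"
      by (simp add: k_def v power_mult_distrib)
    finally have e: "of_real (sqrt 2 * \<tau>\<^sup>2 * A) * (c - 1) + \<i> * of_real (\<tau> ^ 3 * v * x \<tau>) = of_real (k * v\<^sup>2) * saddle_kernel u" .
    have "iexp (- (\<tau> ^ 3 * v * x \<tau>)) * exp (- (of_real (sqrt 2 * \<tau>\<^sup>2 * A) * (c - 1))) = exp (- (of_real (k * v\<^sup>2) * saddle_kernel u))"
      unfolding exp_add [symmetric] e [symmetric] by (simp add: algebra_simps)
    thus ?thesis unfolding ph g_def u_def [symmetric] by (simp only: mult_ac)
  qed
  have \<phi>m: "\<phi> \<tau> \<in> borel_measurable borel" if "\<tau> \<ge> \<tau>0" for \<tau>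
  proof -
    have tp: "\<tau> > 0" using \<tau>0(1)[OF that] by simp
    have "continuous_on UNIV (\<lambda>t. laplace_transform M W (of_real (\<tau> ^ 4) - \<i> * of_real t))"
      using tp by (intro continuous_on_compose2[OF holomorphic_on_imp_continuous_on[OF laplace_transform_holomorphic[OF W W0]]] continuous_intros) auto
    hence [measurable]: "(\<lambda>t. laplace_transform M W (of_real (\<tau> ^ 4) - \<i> * of_real t)) \<in> borel_measurable borel"
      by (rule borel_measurable_continuous_onI)
    show ?thesis unfolding \<phi>_def by measurable
  qed
  have gm: "g \<tau> \<in> borel_measurable borel" if "\<tau> \<ge> \<tau>0" for \<tau>
  proof -
    have [measurable]: "\<phi> \<tau> \<in> borel_measurable borel" by (rule \<phi>m[OF that])
    have "g \<tau> = (\<lambda>v. iexp (- (\<tau> ^ 3 * v * x \<tau>)) * \<phi> \<tau> (\<tau> ^ 3 * v))" using g_eq[OF that] by auto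
    thus ?thesis by simp
  qed
  define w where "w v = 3 * ((2 + 512 / (k / 27) ^ 4) * inverse (1 + v\<^sup>2))" for v :: real
  have wint: "integrable lborel w" unfolding w_def
    by (intro integrable_mult_right integrable_inverse_1_plus_square_lborel)
  have gbound: "norm (g \<tau> v) \<le> w v" if \<tau>: "\<tau> \<ge> \<tau>0" for \<tau> v
  proof -
    note t = \<tau>0[OF \<tau>]
    have 1: "norm (1 / (1 - \<i> * complex_of_real (v / \<tau>))) \<le> 1"
    proof -
      have "1 \<le> norm (1 - \<i> * complex_of_real (v / \<tau>))"
        using abs_Re_le_cmod[of "1 - \<i> * complex_of_real (v / \<tau>)"] by simp
      thus ?thesis by (simp add: norm_divide divide_le_eq)
    qed
    have Res: "Re (sp \<tau> v) = \<tau> ^ 4" "Re (complex_of_real (\<tau> ^ 4)) = \<tau> ^ 4" by (simp_all add: sp_def)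
    have h1: "norm (H (of_real (\<tau> ^ 4)) - 1) \<le> 1 / 2" "norm (H (sp \<tau> v) - 1) \<le> 1 / 2"
      using order_trans[OF H1(1)[of "of_real (\<tau> ^ 4)", unfolded Res] t(3)]
        order_trans[OF H1(1)[of "sp \<tau> v", unfolded Res] t(3)] t(2) by auto
    have "norm (H (of_real (\<tau> ^ 4))) \<le> 3 / 2" using norm_triangle_sub[of "H (of_real (\<tau> ^ 4))" 1] h1 by simp
    moreover have "norm (H (sp \<tau> v)) \<ge> 1 / 2"
      using norm_triangle_sub[of 1 "H (sp \<tau> v)"] h1 by (simp add: norm_minus_commute)
    ultimately have 2: "norm (H (of_real (\<tau> ^ 4)) / H (sp \<tau> v)) \<le> 3"
      unfolding norm_divide using frac_le[of "3 / 2" "norm (H (of_real (\<tau> ^ 4)))" "1 / 2" "norm (H (sp \<tau> v))"] by simp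
    have 3: "norm (exp (- (of_real (k * v\<^sup>2) * saddle_kernel (v / \<tau>)))) \<le> (2 + 512 / (k / 27) ^ 4) * inverse (1 + v\<^sup>2)"
      using saddle_kernel_dominated[OF k t(1), of v] by simp
    have "norm (g \<tau> v) \<le> 1 * 3 * ((2 + 512 / (k / 27) ^ 4) * inverse (1 + v\<^sup>2))"
      unfolding g_def norm_mult using 1 2 3 by (intro mult_mono) auto
    thus ?thesis by (simp add: w_def)
  qed
  have gint: "integrable lborel (g \<tau>)" if \<tau>: "\<tau> \<ge> \<tau>0" for \<tau>
    by (rule Bochner_Integration.integrable_bound[OF wint])
      (use gm[OF \<tau>] gbound[OF \<tau>] in \<open>auto intro!: AE_I2 intro: order_trans[OF _ abs_ge_self]\<close>)
  have Hl: "((\<lambda>\<tau>. H (f \<tau>)) \<longlongrightarrow> 1) at_top" if "\<And>\<tau>. Re (f \<tau>) = \<tau> ^ 4" for f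
  proof -
    have "filterlim (\<lambda>\<tau>::real. \<tau>\<^sup>2) at_top at_top" by (rule filterlim_pow_at_top[OF _ filterlim_ident]) simp
    hence "((\<lambda>\<tau>::real. B / \<tau>\<^sup>2) \<longlongrightarrow> 0) at_top"
      by (intro tendsto_divide_0[OF tendsto_const] filterlim_at_top_imp_at_infinity)
    moreover have "\<forall>\<^sub>F \<tau> in at_top. norm (H (f \<tau>) - 1) \<le> norm (B / \<tau>\<^sup>2)"
      using eventually_ge_at_top[of \<tau>0]
    proof eventually_elim
      fix \<tau> assume "\<tau> \<ge> \<tau>0"
      hence "norm (H (f \<tau>) - 1) \<le> B / sqrt (Re (f \<tau>))" using \<tau>0 by (intro H1) (simp add: that)
      thus "norm (H (f \<tau>) - 1) \<le> norm (B / \<tau>\<^sup>2)"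
        unfolding that sqrt4 real_norm_def by (rule order_trans[OF _ abs_ge_self])
    qed
    ultimately have "((\<lambda>\<tau>. H (f \<tau>) - 1) \<longlongrightarrow> 0) at_top"
      by (rule Lim_null_comparison[rotated, OF tendsto_norm_zero])
    thus ?thesis by (rule LIM_zero_cancel)
  qed
  have glim: "((\<lambda>\<tau>. g \<tau> v) \<longlongrightarrow> of_real (exp (- (A * sqrt 2 / 8 * v\<^sup>2)))) at_top" for v
  proof -
    have u: "((\<lambda>\<tau>. v / \<tau>) \<longlongrightarrow> 0) at_top" by (rule tendsto_divide_0[OF tendsto_const filterlim_at_top_imp_at_infinity[OF filterlim_ident]])
    have "((\<lambda>\<tau>. g \<tau> v) \<longlongrightarrow> 1 / (1 - \<i> * of_real 0) * (1 / 1) * exp (- (of_real (k * v\<^sup>2) * saddle_kernel 0))) at_top"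
      unfolding g_def using continuous_on_saddle_kernel
      by (intro tendsto_intros u Hl continuous_on_tendsto_compose[OF continuous_on_saddle_kernel u]) (auto simp: sp_def)
    also have "1 / (1 - \<i> * of_real 0) * (1 / 1) * exp (- (of_real (k * v\<^sup>2) * saddle_kernel 0)) = complex_of_real (exp (- (A * sqrt 2 / 8 * v\<^sup>2)))"
      by (simp add: saddle_kernel_0 k_def exp_of_real [symmetric])
    finally show ?thesis .
  qed
  \<comment> \<open>The dominated convergence rule along \<open>at_top\<close> asks for
    measurability at every \<tau>, hence the cut-off below \<open>\<tau>0\<close>.\<close>
  define g' where "g' \<tau> = (if \<tau> \<ge> \<tau>0 then g \<tau> else (\<lambda>_. 0))" for \<tau>
  have "((\<lambda>\<tau>. CLINT v|lborel. g' \<tau> v) \<longlongrightarrow> (CLINT v|lborel. complex_of_real (exp (- (A * sqrt 2 / 8 * v\<^sup>2))))) at_top"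
  proof (rule integral_dominated_convergence_at_top[OF _ _ wint])
    show "g' \<tau> \<in> borel_measurable lborel" for \<tau> using gm by (simp add: g'_def)
    show "AE v in lborel. ((\<lambda>\<tau>. g' \<tau> v) \<longlongrightarrow> complex_of_real (exp (- (A * sqrt 2 / 8 * v\<^sup>2)))) at_top"
    proof (intro AE_I2)
      fix v
      show "((\<lambda>\<tau>. g' \<tau> v) \<longlongrightarrow> complex_of_real (exp (- (A * sqrt 2 / 8 * v\<^sup>2)))) at_top"
        by (rule Lim_transform_eventually[OF glim[of v]])
          (use eventually_ge_at_top[of \<tau>0] in eventually_elim, simp add: g'_def)
    qed
    show "\<forall>\<^sub>F \<tau> in at_top. AE v in lborel. norm (g' \<tau> v) \<le> w v"
      using eventually_ge_at_top[of \<tau>0] by eventually_elim (auto simp: g'_def gbound)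
  qed simp
  also have "(CLINT v|lborel. complex_of_real (exp (- (A * sqrt 2 / 8 * v\<^sup>2)))) = of_real (sqrt (pi / (A * sqrt 2 / 8)))"
    by (subst integral_complex_of_real, subst gaussian_integral) (use A in auto)
  finally have Ilim: "((\<lambda>\<tau>. CLINT v|lborel. g' \<tau> v) \<longlongrightarrow> of_real (sqrt (pi / (A * sqrt 2 / 8)))) at_top" .
  have Hlim: "((\<lambda>\<tau>. H (of_real (\<tau> ^ 4))) \<longlongrightarrow> 1) at_top"
    by (rule Hl) simp
  have "((\<lambda>\<tau>. complex_of_real A0 / (2 * pi) * (CLINT v|lborel. g' \<tau> v) / H (of_real (\<tau> ^ 4))) \<longlongrightarrow>
      complex_of_real A0 / (2 * pi) * of_real (sqrt (pi / (A * sqrt 2 / 8))) / 1) at_top"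
    by (intro tendsto_intros Ilim Hlim) auto
  moreover have "\<forall>\<^sub>F \<tau> in at_top. complex_of_real A0 / (2 * pi) * (CLINT v|lborel. g' \<tau> v) / H (of_real (\<tau> ^ 4))
      = complex_of_real (prob {\<omega> \<in> space M. W \<omega> \<le> x \<tau>} * \<tau> * exp (A * \<tau>\<^sup>2 / sqrt 2))"
    using eventually_ge_at_top[of \<tau>0]
  proof eventually_elim
    fix \<tau> assume \<tau>: "\<tau> \<ge> \<tau>0"
    have tp: "\<tau> > 0" using \<tau>0[OF \<tau>] by simp
    let ?\<gamma> = "\<tau> ^ 4"
    have \<gamma>: "?\<gamma> > 0" using tp by simp
    have Rg: "Re (complex_of_real ?\<gamma>) \<ge> \<gamma>0" using \<tau>0[OF \<tau>] by simp
    have int1: "integrable lborel (\<lambda>v. iexp (- (\<tau> ^ 3 * v * x \<tau>)) * \<phi> \<tau> (\<tau> ^ 3 * v))"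
      using gint[OF \<tau>] by (simp only: g_eq[OF \<tau>, symmetric])
    \<comment> \<open>The oscillating factor has modulus 1, so integrability passes from
      \<open>g\<close> to \<open>\<phi>\<close>; the summand 0 puts the argument into the affine
      shape of the substitution rule.\<close>
    have "integrable lborel (\<lambda>v. \<phi> \<tau> (0 + \<tau> ^ 3 * v))"
    proof (rule Bochner_Integration.integrable_bound[OF int1])
      show "(\<lambda>v. \<phi> \<tau> (0 + \<tau> ^ 3 * v)) \<in> borel_measurable lborel"
        using \<phi>m[OF \<tau>] by measurable
    qed (auto simp: norm_mult)
    hence \<phi>int: "integrable lborel (\<phi> \<tau>)"
      using tp by (subst (asm) lborel_integrable_real_affine_iff) auto
    have "(CLINT t|lborel. iexp (- (t * x \<tau>)) * \<phi> \<tau> t) = \<bar>\<tau> ^ 3\<bar> *\<^sub>R (CLINT v|lborel. iexp (- ((0 + \<tau> ^ 3 * v) * x \<tau>)) * \<phi> \<tau> (0 + \<tau> ^ 3 * v))"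
      using tp by (intro lborel_integral_real_affine) auto
    also have "\<dots> = of_real (\<tau> ^ 3) * (CLINT v|lborel. g' \<tau> v)"
      using tp \<tau> by (simp only: add_0 g_eq[OF \<tau>, symmetric]) (simp add: g'_def scaleR_conv_of_real)
    finally have I: "(CLINT t|lborel. iexp (- (t * x \<tau>)) * \<phi> \<tau> t) = of_real (\<tau> ^ 3) * (CLINT v|lborel. g' \<tau> v)" .
    have inv: "of_real (exp (- (?\<gamma> * x \<tau>)) * prob {\<omega> \<in> space M. W \<omega> \<le> x \<tau>} * ?\<gamma>) / laplace_transform M W (of_real ?\<gamma>)
        = 1 / (2 * pi) * (of_real (\<tau> ^ 3) * (CLINT v|lborel. g' \<tau> v))"
      using cdf_inversion[OF W W0 \<gamma> H1(2)[OF Rg], of "x \<tau>"] \<phi>int unfolding \<phi>_def [symmetric] I by simp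
    have "csqrt (2 * of_real ?\<gamma>) = of_real (sqrt 2 * \<tau>\<^sup>2)"
      using csqrt_of_real_mult[of "2 * ?\<gamma>" 1] tp by (simp add: real_sqrt_mult sqrt4)
    hence "laplace_transform M W (of_real ?\<gamma>) = of_real (A0 * exp (- (sqrt 2 * \<tau>\<^sup>2 * A))) / H (of_real ?\<gamma>)"
      using H1[OF Rg] by (simp add: H_def \<Lambda>_def exp_of_real [symmetric])
    moreover have gx: "?\<gamma> * x \<tau> = A * \<tau>\<^sup>2 / sqrt 2" using tp by (simp add: x_def field_simps eval_nat_numeral)
    moreover have "sqrt 2 * \<tau>\<^sup>2 * A = A * \<tau>\<^sup>2 / sqrt 2 + A * \<tau>\<^sup>2 / sqrt 2" by (simp add: field_simps)
    ultimately have Le: "laplace_transform M W (of_real ?\<gamma>)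
       = of_real (A0 * (exp (- (?\<gamma> * x \<tau>)) * exp (- (A * \<tau>\<^sup>2 / sqrt 2)))) / H (of_real ?\<gamma>)"
      by (simp add: exp_add [symmetric])
    \<comment> \<open>The tilt \<open>exp (- (?\<gamma> * x \<tau>))\<close> cancels half of the
      exponent of the transform at the saddle. The factor \<open>\<tau> ^ 4\<close> from \<gamma>
      against \<open>\<tau> ^ 3\<close> from the substitution leaves a single \<tau>.\<close>
    have "of_real (\<tau> ^ 3) * (complex_of_real (prob {\<omega> \<in> space M. W \<omega> \<le> x \<tau>} * \<tau> * exp (A * \<tau>\<^sup>2 / sqrt 2)) * H (of_real ?\<gamma>) / of_real A0)
       = of_real (\<tau> ^ 3) * (1 / (2 * pi) * (CLINT v|lborel. g' \<tau> v))"
      using inv unfolding Le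
      using A0 by (simp add: exp_minus field_simps eval_nat_numeral)
    hence "complex_of_real (prob {\<omega> \<in> space M. W \<omega> \<le> x \<tau>} * \<tau> * exp (A * \<tau>\<^sup>2 / sqrt 2)) * H (of_real ?\<gamma>) / of_real A0
       = 1 / (2 * pi) * (CLINT v|lborel. g' \<tau> v)"
      using tp by (subst (asm) mult_left_cancel) auto
    thus "complex_of_real A0 / (2 * pi) * (CLINT v|lborel. g' \<tau> v) / H (of_real ?\<gamma>)
      = complex_of_real (prob {\<omega> \<in> space M. W \<omega> \<le> x \<tau>} * \<tau> * exp (A * \<tau>\<^sup>2 / sqrt 2))"
      using A0 H1(4)[OF Rg] by (simp add: field_simps)
  qed
  ultimately have "((\<lambda>\<tau>. complex_of_real (prob {\<omega> \<in> space M. W \<omega> \<le> x \<tau>} * \<tau> * exp (A * \<tau>\<^sup>2 / sqrt 2))) \<longlongrightarrow>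
      complex_of_real (A0 / (2 * pi) * sqrt (pi / (A * sqrt 2 / 8)))) at_top"
    by (rule_tac Lim_transform_eventually) simp_all
  thus ?thesis unfolding x_def by (simp only: tendsto_of_real_iff)
qed

section \<open>Positivity of the phase integral and the passage from \<tau> to \<epsilon>\<close>

lemma set_integral_pos_of_continuous:
  fixes f :: "real \<Rightarrow> real"
  assumes f: "continuous_on {0..1} f" and pos: "\<And>t. t \<in> {0..1} \<Longrightarrow> f t > 0"
  shows "(LINT t:{0..1}|lborel. f t) > 0"
proof -
  obtain t0 where t0: "t0 \<in> {0..1}" "\<forall>t\<in>{0..1}. f t0 \<le> f t"
    using continuous_attains_inf[OF _ _ f] by auto
  have "f t0 = (LINT t:{0..1::real}|lborel. f t0)" by (simp add: set_lebesgue_integral_def)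
  also have "\<dots> \<le> (LINT t:{0..1}|lborel. f t)"
    using t0(2) by (intro set_integral_mono borel_integrable_atLeastAtMost' f continuous_intros) auto
  finally show ?thesis using pos[OF t0(1)] by linarith
qed

theorem theorem4:
  fixes \<alpha> :: real and M :: "'a measure" and U :: "real \<Rightarrow> 'a \<Rightarrow> real"
    and \<psi> :: "real \<Rightarrow> real" and \<theta> :: real
  assumes "\<alpha> \<noteq> 0"
    and "ou_process_from_zero \<alpha> M U"
    and "\<And>t. t \<in> {0..1} \<Longrightarrow> \<psi> t > 0"
    and "twice_continuously_differentiable_on \<psi> {0..1}"
    and "\<theta> = (LINT t:{0..1}|lborel. sqrt (\<psi> t))"
  shows "(\<lambda>\<epsilon>. measure M {\<omega> \<in> space M. weighted_L2_norm \<psi> (\<lambda>t. U t \<omega>) \<le> \<epsilon>})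
    \<sim>[at_right 0]
    (\<lambda>\<epsilon>. 4 * exp (\<alpha> / 2) * \<psi> 0 powr (1/8) / (sqrt pi * \<theta> * \<psi> 1 powr (1/8)) * \<epsilon>
          * exp (- (\<theta>\<^sup>2 / 8) * \<epsilon> powi (-2)))"
proof -
  interpret prob_space M using assms(2) by (simp add: ou_process_from_zero_def)
  define W where "W \<omega> = (LINT t:{0..1}|lborel. (U t \<omega>)\<^sup>2 * \<psi> t)" for \<omega>
  define A0 where "A0 = sqrt 2 * exp (\<alpha> / 2) * \<psi> 0 powr (1/8) / \<psi> 1 powr (1/8)"
  define A where "A = \<theta> / 2"
  have A0: "A0 > 0" using assms(3)[of 0] assms(3)[of 1] by (simp add: A0_def)
  note oul = ou_laplace_asymptotics[OF assms(1-4), folded assms(5) W_def A0_def A_def]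
  have A: "A > 0"
  proof -
    obtain \<psi>' where "\<And>t. t \<in> {0..1} \<Longrightarrow> (\<psi> has_real_derivative \<psi>' t) (at t within {0..1})"
      using assms(4) unfolding twice_continuously_differentiable_on_def by blast
    hence "continuous_on {0..1} \<psi>" by (rule DERIV_continuous_on)
    thus ?thesis unfolding A_def assms(5)
      using assms(3) by (intro divide_pos_pos set_integral_pos_of_continuous continuous_intros) auto
  qed
  obtain B \<gamma>0 where \<gamma>0: "\<gamma>0 > 0" and L: "\<And>s. Re s \<ge> \<gamma>0 \<Longrightarrow> laplace_transform M W s \<noteq> 0 \<and>
      norm (complex_of_real A0 * exp (- (csqrt (2 * s) * complex_of_real A)) / laplace_transform M W s - 1) \<le> B / sqrt (Re s)"
    using oul(3) by blast
  let ?F = "\<lambda>x. prob {\<omega> \<in> space M. W \<omega> \<le> x}"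
  have lim: "((\<lambda>\<tau>. ?F (A / (sqrt 2 * \<tau>\<^sup>2)) * \<tau> * exp (A * \<tau>\<^sup>2 / sqrt 2))
     \<longlongrightarrow> A0 / (2 * pi) * sqrt (pi / (A * sqrt 2 / 8))) at_top"
    by (rule cdf_asymptotics_of_laplace_transform[OF oul(1) oul(2) A A0 \<gamma>0 L])
  \<comment> \<open>With \<tau> = r / \<epsilon> the level
    \<open>A / (sqrt 2 * \<tau>\<^sup>2)\<close> becomes \<open>\<epsilon>\<^sup>2\<close>, and
    \<open>\<tau> ^ 4\<close> becomes
    \<open>\<theta>\<^sup>2 / (8 * \<epsilon> ^ 4)\<close>.\<close>
  define r where "r = sqrt (A / sqrt 2)"
  have r: "r > 0" using A by (simp add: r_def)
  have r2: "r\<^sup>2 = A / sqrt 2" using A by (simp add: r_def)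
  define C where "C = 4 * exp (\<alpha> / 2) * \<psi> 0 powr (1/8) / (sqrt pi * \<theta> * \<psi> 1 powr (1/8))"
  have C_A0: "C = A0 * (4 / (sqrt 2 * sqrt pi * (2 * A)))"
    by (simp add: C_def A0_def A_def mult_ac)
  have const: "A0 / (2 * pi) * sqrt (pi / (A * sqrt 2 / 8)) = C * r"
  proof -
    \<comment> \<open>Both constants are nonnegative, so they are compared through their squares,
      where the nested roots disappear.\<close>
    have "(1 / (2 * pi) * sqrt (pi / (A * sqrt 2 / 8)))\<^sup>2 = (4 / (sqrt 2 * sqrt pi * (2 * A)) * r)\<^sup>2"
      using A by (simp add: power_mult_distrib power_divide r2 field_simps) (simp add: power2_eq_square)
    hence "1 / (2 * pi) * sqrt (pi / (A * sqrt 2 / 8)) = 4 / (sqrt 2 * sqrt pi * (2 * A)) * r"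
      by (rule power2_eq_imp_eq) (use A r in auto)
    hence "A0 * (1 / (2 * pi) * sqrt (pi / (A * sqrt 2 / 8))) = A0 * (4 / (sqrt 2 * sqrt pi * (2 * A)) * r)"
      by simp
    thus ?thesis by (simp add: C_A0)
  qed
  have C: "C > 0" using A A0 by (simp add: C_A0)
  have "filterlim (\<lambda>\<epsilon>. r / \<epsilon>) at_top (at_right 0)"
    using filterlim_tendsto_pos_mult_at_top[OF tendsto_const r filterlim_inverse_at_top_right]
    by (simp add: divide_inverse)
  from filterlim_compose[OF lim this]
  have "((\<lambda>\<epsilon>. ?F (A / (sqrt 2 * (r / \<epsilon>)\<^sup>2)) * (r / \<epsilon>) * exp (A * (r / \<epsilon>)\<^sup>2 / sqrt 2) / (C * r)) \<longlongrightarrow> C * r / (C * r)) (at_right 0)"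
    unfolding const using C r by (intro tendsto_divide tendsto_const) auto
  hence "((\<lambda>\<epsilon>. ?F (A / (sqrt 2 * (r / \<epsilon>)\<^sup>2)) * (r / \<epsilon>) * exp (A * (r / \<epsilon>)\<^sup>2 / sqrt 2) / (C * r)) \<longlongrightarrow> 1) (at_right 0)"
    using C r by simp
  moreover have "\<forall>\<^sub>F \<epsilon> in at_right 0. ?F (A / (sqrt 2 * (r / \<epsilon>)\<^sup>2)) * (r / \<epsilon>) * exp (A * (r / \<epsilon>)\<^sup>2 / sqrt 2) / (C * r)
     = measure M {\<omega> \<in> space M. weighted_L2_norm \<psi> (\<lambda>t. U t \<omega>) \<le> \<epsilon>} / (C * \<epsilon> * exp (- (\<theta>\<^sup>2 / 8) * \<epsilon> powi (-2)))"
    using eventually_at_right_less[of "0::real"]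
  proof eventually_elim
    fix \<epsilon> :: real assume e: "0 < \<epsilon>"
    have "A / (sqrt 2 * (r / \<epsilon>)\<^sup>2) = \<epsilon>\<^sup>2" using A e by (simp add: power_divide r2)
    moreover have "A * (r / \<epsilon>)\<^sup>2 / sqrt 2 = \<theta>\<^sup>2 / 8 / \<epsilon>\<^sup>2"
      using e by (simp add: power_divide r2 A_def) (simp add: power2_eq_square)
    moreover have "{\<omega> \<in> space M. weighted_L2_norm \<psi> (\<lambda>t. U t \<omega>) \<le> \<epsilon>} = {\<omega> \<in> space M. W \<omega> \<le> \<epsilon>\<^sup>2}"
    proof -
      have "weighted_L2_norm \<psi> (\<lambda>t. U t \<omega>) \<le> \<epsilon> \<longleftrightarrow> W \<omega> \<le> \<epsilon>\<^sup>2" for \<omega>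
        unfolding weighted_L2_norm_def W_def [symmetric] using e real_sqrt_le_iff[of "W \<omega>" "\<epsilon>\<^sup>2"] by simp
      thus ?thesis by simp
    qed
    moreover have "\<epsilon> powi (-2) = 1 / \<epsilon>\<^sup>2" using e by (simp add: power_int_minus_divide)
    moreover have "exp (- (\<theta>\<^sup>2 / 8) * (1 / \<epsilon>\<^sup>2)) = 1 / exp (\<theta>\<^sup>2 / 8 / \<epsilon>\<^sup>2)" by (simp add: exp_minus inverse_eq_divide)
    ultimately show "?F (A / (sqrt 2 * (r / \<epsilon>)\<^sup>2)) * (r / \<epsilon>) * exp (A * (r / \<epsilon>)\<^sup>2 / sqrt 2) / (C * r)
     = measure M {\<omega> \<in> space M. weighted_L2_norm \<psi> (\<lambda>t. U t \<omega>) \<le> \<epsilon>} / (C * \<epsilon> * exp (- (\<theta>\<^sup>2 / 8) * \<epsilon> powi (-2)))"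
      using r by simp
  qed
  ultimately have "((\<lambda>\<epsilon>. measure M {\<omega> \<in> space M. weighted_L2_norm \<psi> (\<lambda>t. U t \<omega>) \<le> \<epsilon>}
      / (C * \<epsilon> * exp (- (\<theta>\<^sup>2 / 8) * \<epsilon> powi (-2)))) \<longlongrightarrow> 1) (at_right 0)"
    by (rule Lim_transform_eventually)
  thus ?thesis unfolding C_def by (rule asymp_equivI')
qed

end
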